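(* For all real resonance points $r_\lambda$ (of a line $\{H_r=H_0+rV:r\in\mathbb R\}$ regular at an essentially regular point $\lambda$), $$\bigl|\operatorname{ind}_{res}(\lambda;H_{r_\lambda},V)\bigr|\le\dim\Upsilon^1_{\lambda+i0}(r_\lambda).$$
   Context: Setting. $\mathcal H,\mathcal K$ are complex separable Hilbert spaces. $F:\mathcal H\to\mathcal K$ is a closed densely defined operator with trivial kernel and co-kernel. $\{H_r=H_0+rV:r\in\mathbb R\}$ is a line of self-adjoint operators on $\mathcal H$, $V=F^*JF$ self-adjoint with $J$ bounded self-adjoint on $\mathcal K$. Standing assumptions: all $H_r$ have a common dense domain $\mathcal D$, $\mathcal D\subset\operatorname{dom}(F)\cap\operatorname{dom}(V)$, $V$ is relatively compact with respect to each $H_r$, and for non-real $z$ the operator $T_z(H_r):=F(H_r-z)^{-1}F^*$ (densely defined on $\operatorname{dom}F^*$) extends to a compact operator on $\mathcal K$, also denoted $T_z(H_r)$. $\Lambda(H_r,F)$ is the set of real $\lambda$ for which the norm limits $T_{\lambda\pm i0}(H_r):=\lim_{y\to0^+}T_{\lambda\pm iy}(H_r)$ exist (assumed of full Lebesgue measure). It is assumed that $\lambda\in\Lambda(H_r,F)$ for some real $r$ (that is, the line is regular at $\lambda$); a real $r$ is non-resonant if $\lambda\in\Lambda(H_r,F)$, otherwise it is a real resonance point. For $z$ non-real and real $s$, or $z=\lambda\pm i0$ and non-resonant $s$, put $A_z(s)=T_z(H_s)J$; as a function of $s$ it extends meromorphically to $\mathbb C$, and for $z=\lambda\pm i0$ its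 real poles are exactly the real resonance points. $\Upsilon^1_{\lambda+i0}(r_\lambda)=\{u\in\mathcal K:(1+(r_\lambda-s)T_{\lambda+i0}(H_s)J)u=0\}$, independent of the non-resonant real $s$. Resonance index: when $\lambda+i0$ is replaced by $\lambda+iy$ with small $y>0$, the pole $r_\lambda$ of $A_{\lambda+i0}(s)$ splits into poles $r^1_{\lambda+iy},\ldots,r^N_{\lambda+iy}$ of $A_{\lambda+iy}(s)$ converging to $r_\lambda$ as $y\to0^+$, none of which is real; a pole $r$ of $A_{\lambda+iy}(s)$ is counted with its algebraic multiplicity, i.e. the algebraic multiplicity of the eigenvalue $(s-r)^{-1}$ of the compact operator $A_{\lambda+iy}(s)$, which does not depend on real $s$. If $N_+$ (respectively $N_-$) of them lie in the open upper (respectively lower) half-plane, then $\operatorname{ind}_{res}(\lambda;H_{r_\lambda},V)=N_+-N_-$. *)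

theory Defs
  imports "HOL-Analysis.Analysis" "HOL-Complex_Analysis.Complex_Analysis"
begin

section \<open>Complex Hilbert spaces\<close>

class complex_vector = real_vector +
  fixes scaleC :: "complex \<Rightarrow> 'a \<Rightarrow> 'a"  (infixr "*\<^sub>C" 75)
  assumes scaleC_add_right: "a *\<^sub>C (x + y) = a *\<^sub>C x + a *\<^sub>C y"
    and scaleC_add_left: "(a + b) *\<^sub>C x = a *\<^sub>C x + b *\<^sub>C x"
    and scaleC_scaleC: "a *\<^sub>C b *\<^sub>C x = (a * b) *\<^sub>C x"
    and scaleC_one: "1 *\<^sub>C x = x"
    and scaleR_scaleC: "r *\<^sub>R x = complex_of_real r *\<^sub>C x"

text \<open>The inner product is antilinear in its first argument. Completeness comes from
  \<^class>\<open>banach\<close>; separability is added through \<^class>\<open>second_countable_topology\<close>.\<close>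

class chilbert_space = complex_vector + banach +
  fixes cinner :: "'a \<Rightarrow> 'a \<Rightarrow> complex"
  assumes cinner_commute: "cinner x y = cnj (cinner y x)"
    and cinner_add_right: "cinner x (y + z) = cinner x y + cinner x z"
    and cinner_scaleC_right: "cinner x (a *\<^sub>C y) = a * cinner x y"
    and cinner_self: "cinner x x = complex_of_real ((norm x)\<^sup>2)"

global_interpretation complex_vector: vector_space "scaleC :: complex \<Rightarrow> 'a \<Rightarrow> 'a::complex_vector"
  by unfold_locales (rule scaleC_add_right scaleC_add_left scaleC_scaleC scaleC_one)+

section \<open>Unbounded operators\<close>

text \<open>An unbounded operator is identified with its graph, so that composition of operators is
  relational composition (in diagrammatic order: \<open>A O B\<close> applies \<open>A\<close> first), with the natural
  domain, and \<^const>\<open>Domain\<close> is the domain of definition.\<close>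

definition linear_operator :: "('a::complex_vector \<times> 'b::complex_vector) set \<Rightarrow> bool" where
  "linear_operator A \<longleftrightarrow> single_valued A \<and> (0, 0) \<in> A \<and>
     (\<forall>x y x' y'. (x, y) \<in> A \<longrightarrow> (x', y') \<in> A \<longrightarrow> (x + x', y + y') \<in> A) \<and>
     (\<forall>c x y. (x, y) \<in> A \<longrightarrow> (c *\<^sub>C x, c *\<^sub>C y) \<in> A)"

definition densely_defined :: "('a::topological_space \<times> 'b) set \<Rightarrow> bool" where
  "densely_defined A \<longleftrightarrow> closure (Domain A) = UNIV"

definition op_kernel :: "('a \<times> 'b::zero) set \<Rightarrow> 'a set" where
  "op_kernel A = {x. (x, 0) \<in> A}"

definition graph_of :: "('a \<Rightarrow> 'b) \<Rightarrow> ('a \<times> 'b) set" where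
  "graph_of f = {(x, f x) |x. True}"

definition adjoint_op :: "('a::chilbert_space \<times> 'b::chilbert_space) set \<Rightarrow> ('b \<times> 'a) set" where
  "adjoint_op A = {(v, u). \<forall>(x, y) \<in> A. cinner v y = cinner u x}"

definition selfadjoint_op :: "('a::chilbert_space \<times> 'a) set \<Rightarrow> bool" where
  "selfadjoint_op A \<longleftrightarrow> linear_operator A \<and> densely_defined A \<and> adjoint_op A = A"

text \<open>The operators \<open>H\<^sub>0 + rV\<close>, with domain \<open>dom H\<^sub>0 \<inter> dom V\<close>.\<close>

definition op_line :: "('a::real_vector \<times> 'a) set \<Rightarrow> ('a \<times> 'a) set \<Rightarrow> real \<Rightarrow> ('a \<times> 'a) set" where
  "op_line H0 V r = {(x, y + r *\<^sub>R v) |x y v. (x, y) \<in> H0 \<and> (x, v) \<in> V}"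

text \<open>\<open>(H - z)\<^sup>-\<^sup>1\<close>\<close>

definition resolvent :: "('a::complex_vector \<times> 'a) set \<Rightarrow> complex \<Rightarrow> ('a \<times> 'a) set" where
  "resolvent H z = {(y - z *\<^sub>C x, x) |x y. (x, y) \<in> H}"

definition compact_operator :: "('a::real_normed_vector \<Rightarrow>\<^sub>L 'b::real_normed_vector) \<Rightarrow> bool" where
  "compact_operator T \<longleftrightarrow> compact (closure (blinfun_apply T ` cball 0 1))"

definition relatively_compact :: "('a::chilbert_space \<times> 'a) set \<Rightarrow> ('a \<times> 'a) set \<Rightarrow> bool" where
  "relatively_compact V H \<longleftrightarrow> Domain H \<subseteq> Domain V \<and>
     (\<forall>z. Im z \<noteq> 0 \<longrightarrow> (\<exists>K. compact_operator K \<and> resolvent H z O V = graph_of (blinfun_apply K)))"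

section \<open>The sandwiched resolvent\<close>

text \<open>Bounded operators are real-linear \<^typ>\<open>'k \<Rightarrow>\<^sub>L 'k\<close>; those below are complex-linear because
  they extend complex-linear operators with dense domain, or are limits of such.\<close>

definition sandwiched_extension ::
    "('h::chilbert_space \<times> 'k::chilbert_space) set \<Rightarrow> ('h \<times> 'h) set \<Rightarrow> complex \<Rightarrow> ('k \<Rightarrow>\<^sub>L 'k) \<Rightarrow> bool" where
  "sandwiched_extension F H z T \<longleftrightarrow>
     adjoint_op F O resolvent H z O F \<subseteq> graph_of (blinfun_apply T)"

definition sandwiched ::
    "('h::chilbert_space \<times> 'k::chilbert_space) set \<Rightarrow> ('h \<times> 'h) set \<Rightarrow> complex \<Rightarrow> ('k \<Rightarrow>\<^sub>L 'k)" where
  "sandwiched F H z = (THE T. sandwiched_extension F H z T)"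

text \<open>\<open>T\<^bsub>lam+i0\<^esub>(H)\<close>, a limit in operator norm\<close>

definition sandwiched_plus ::
    "('h::chilbert_space \<times> 'k::chilbert_space) set \<Rightarrow> ('h \<times> 'h) set \<Rightarrow> real \<Rightarrow> ('k \<Rightarrow>\<^sub>L 'k)" where
  "sandwiched_plus F H lam = Lim (at_right 0) (\<lambda>y. sandwiched F H (Complex lam y))"

definition regular_points ::
    "('h::chilbert_space \<times> 'k::chilbert_space) set \<Rightarrow> ('h \<times> 'h) set \<Rightarrow> real set" where
  "regular_points F H =
     {lam. (\<exists>L. ((\<lambda>y. sandwiched F H (Complex lam y)) \<longlongrightarrow> L) (at_right 0)) \<and>
         (\<exists>L. ((\<lambda>y. sandwiched F H (Complex lam (- y))) \<longlongrightarrow> L) (at_right 0))}"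

section \<open>Standing assumptions\<close>

text \<open>\<open>F\<close> has trivial co-kernel when \<open>ker F\<^sup>* = 0\<close>, i.e. when its range is dense.\<close>

locale resonance_setting =
  fixes F :: "('h::{chilbert_space,second_countable_topology}
                \<times> 'k::{chilbert_space,second_countable_topology}) set"
    and J :: "'k \<Rightarrow>\<^sub>L 'k"
    and H0 V :: "('h \<times> 'h) set"
    and D :: "'h set"
  assumes F_linear: "linear_operator F"
    and F_closed: "closed F"
    and F_dense: "densely_defined F"
    and F_kernel: "op_kernel F = {0}"
    and F_cokernel: "op_kernel (adjoint_op F) = {0}"
    and J_selfadjoint: "\<And>x y. cinner (blinfun_apply J x) y = cinner x (blinfun_apply J y)"
    and V_eq: "V = F O graph_of (blinfun_apply J) O adjoint_op F"
    and V_selfadjoint: "selfadjoint_op V"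
    and H0_selfadjoint: "selfadjoint_op H0"
    and H_selfadjoint: "\<And>r. selfadjoint_op (op_line H0 V r)"
    and D_dense: "closure D = UNIV"
    and H0_domain: "Domain H0 = D"
    and H_domain: "\<And>r. Domain (op_line H0 V r) = D"
    and D_subset: "D \<subseteq> Domain F \<inter> Domain V"
    and V_relatively_compact: "\<And>r. relatively_compact V (op_line H0 V r)"
    and sandwiched_compact:
      "\<And>r z. Im z \<noteq> 0 \<Longrightarrow> \<exists>T. compact_operator T \<and> sandwiched_extension F (op_line H0 V r) z T"
    and regular_full_measure: "\<And>r. - regular_points F (op_line H0 V r) \<in> null_sets lebesgue"

section \<open>Resonance points and the resonance index\<close>

text \<open>Real resonance points of the line at \<open>lam\<close>; non-resonant means not in this set.\<close>

definition resonance_points ::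
    "('h::chilbert_space \<times> 'k::chilbert_space) set \<Rightarrow> ('h \<times> 'h) set \<Rightarrow> ('h \<times> 'h) set \<Rightarrow> real \<Rightarrow> real set" where
  "resonance_points F H0 V lam = {r. lam \<notin> regular_points F (op_line H0 V r)}"

text \<open>\<open>A\<^sub>z(s) = T\<^sub>z(H\<^sub>s)J\<close> for non-real \<open>z\<close> and real \<open>s\<close>\<close>

definition A_op ::
    "('h::chilbert_space \<times> 'k::chilbert_space) set \<Rightarrow> ('k \<Rightarrow>\<^sub>L 'k) \<Rightarrow> ('h \<times> 'h) set \<Rightarrow> ('h \<times> 'h) set
      \<Rightarrow> complex \<Rightarrow> real \<Rightarrow> ('k \<Rightarrow>\<^sub>L 'k)" where
  "A_op F J H0 V z s = sandwiched F (op_line H0 V s) z o\<^sub>L J"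

definition A_op_plus ::
    "('h::chilbert_space \<times> 'k::chilbert_space) set \<Rightarrow> ('k \<Rightarrow>\<^sub>L 'k) \<Rightarrow> ('h \<times> 'h) set \<Rightarrow> ('h \<times> 'h) set
      \<Rightarrow> real \<Rightarrow> real \<Rightarrow> ('k \<Rightarrow>\<^sub>L 'k)" where
  "A_op_plus F J H0 V lam s = sandwiched_plus F (op_line H0 V s) lam o\<^sub>L J"

text \<open>\<open>\<Upsilon>\<^sup>1\<^bsub>lam+i0\<^esub>(r)\<close>, computed from the non-resonant point \<open>s\<close>.\<close>

definition Upsilon1 ::
    "('h::chilbert_space \<times> 'k::chilbert_space) set \<Rightarrow> ('k \<Rightarrow>\<^sub>L 'k) \<Rightarrow> ('h \<times> 'h) set \<Rightarrow> ('h \<times> 'h) set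
      \<Rightarrow> real \<Rightarrow> real \<Rightarrow> real \<Rightarrow> 'k set" where
  "Upsilon1 F J H0 V lam s r = {u. u + (r - s) *\<^sub>R blinfun_apply (A_op_plus F J H0 V lam s) u = 0}"

text \<open>Holomorphy of operator-valued functions in the operator norm, on open sets: the real
  derivative is multiplication by a complex number.\<close>

definition op_holomorphic_on ::
    "(complex \<Rightarrow> ('k::chilbert_space \<Rightarrow>\<^sub>L 'k)) \<Rightarrow> complex set \<Rightarrow> bool" where
  "op_holomorphic_on M S \<longleftrightarrow>
     (\<forall>s\<in>S. (\<forall>c x. blinfun_apply (M s) (c *\<^sub>C x) = c *\<^sub>C blinfun_apply (M s) x) \<and>
        (\<exists>M'. (M has_derivative M') (at s) \<and>
           (\<forall>h x. blinfun_apply (M' h) x = h *\<^sub>C blinfun_apply (M' 1) x)))"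

definition op_meromorphic :: "(complex \<Rightarrow> ('k::chilbert_space \<Rightarrow>\<^sub>L 'k)) \<Rightarrow> bool" where
  "op_meromorphic M \<longleftrightarrow>
     (\<exists>P. (\<forall>p. \<not> p islimpt P) \<and> op_holomorphic_on M (- P) \<and>
        (\<forall>p\<in>P. \<exists>n e G. 0 < e \<and> op_holomorphic_on G (ball p e) \<and>
           (\<forall>s\<in>ball p e - {p}. \<forall>x.
              blinfun_apply (G s) x = (s - p) ^ n *\<^sub>C blinfun_apply (M s) x)))"

text \<open>Poles of the meromorphic continuation of \<open>A\<^sub>z\<close> from the real line (\<open>z\<close> non-real); the
  continuation is unique off a discrete set, which does not affect \<^const>\<open>is_pole\<close>.\<close>

definition A_pole ::
    "('h::chilbert_space \<times> 'k::chilbert_space) set \<Rightarrow> ('k \<Rightarrow>\<^sub>L 'k) \<Rightarrow> ('h \<times> 'h) set \<Rightarrow> ('h \<times> 'h) set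
      \<Rightarrow> complex \<Rightarrow> complex \<Rightarrow> bool" where
  "A_pole F J H0 V z p \<longleftrightarrow>
     (\<exists>M. op_meromorphic M \<and> (\<forall>s::real. M (complex_of_real s) = A_op F J H0 V z s) \<and> is_pole M p)"

text \<open>The complex dimension of the generalized eigenspace. It is used for non-zero eigenvalues of
  compact operators, where it is finite.\<close>

definition alg_multiplicity :: "('k::chilbert_space \<Rightarrow>\<^sub>L 'k) \<Rightarrow> complex \<Rightarrow> nat" where
  "alg_multiplicity A \<sigma> =
     complex_vector.dim {u. \<exists>n. ((\<lambda>v. blinfun_apply A v - \<sigma> *\<^sub>C v) ^^ n) u = 0}"

definition pole_multiplicity ::
    "('h::chilbert_space \<times> 'k::chilbert_space) set \<Rightarrow> ('k \<Rightarrow>\<^sub>L 'k) \<Rightarrow> ('h \<times> 'h) set \<Rightarrow> ('h \<times> 'h) set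
      \<Rightarrow> complex \<Rightarrow> real \<Rightarrow> complex \<Rightarrow> nat" where
  "pole_multiplicity F J H0 V z s p =
     (if A_pole F J H0 V z p
      then alg_multiplicity (A_op F J H0 V z s) (inverse (complex_of_real s - p)) else 0)"

text \<open>For small \<open>y > 0\<close>, the poles of \<open>A\<^bsub>lam+iy\<^esub>\<close> near \<open>r\<close>, listed with multiplicity, are
  \<open>\<rho> 0 y, \<dots>, \<rho> (N - 1) y\<close>. They converge to \<open>r\<close>, none is real, and \<open>Np\<close> and \<open>Nm\<close> of them lie in
  the upper and lower half-plane. The multiplicity does not depend on \<open>s\<close>.\<close>

definition pole_splits ::
    "('h::chilbert_space \<times> 'k::chilbert_space) set \<Rightarrow> ('k \<Rightarrow>\<^sub>L 'k) \<Rightarrow> ('h \<times> 'h) set \<Rightarrow> ('h \<times> 'h) set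
      \<Rightarrow> real \<Rightarrow> real \<Rightarrow> nat \<Rightarrow> (nat \<Rightarrow> real \<Rightarrow> complex) \<Rightarrow> nat \<Rightarrow> nat \<Rightarrow> bool" where
  "pole_splits F J H0 V lam r N \<rho> Np Nm \<longleftrightarrow>
     (\<exists>e>0. \<forall>\<^sub>F y in at_right 0. \<forall>p\<in>ball (complex_of_real r) e. \<forall>s::real.
        card {j. j < N \<and> \<rho> j y = p} = pole_multiplicity F J H0 V (Complex lam y) s p) \<and>
     (\<forall>j<N. (\<rho> j \<longlongrightarrow> complex_of_real r) (at_right 0)) \<and>
     (\<forall>\<^sub>F y in at_right 0. (\<forall>j<N. Im (\<rho> j y) \<noteq> 0) \<and>
        card {j. j < N \<and> Im (\<rho> j y) > 0} = Np \<and> card {j. j < N \<and> Im (\<rho> j y) < 0} = Nm)"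

definition res_index ::
    "('h::chilbert_space \<times> 'k::chilbert_space) set \<Rightarrow> ('k \<Rightarrow>\<^sub>L 'k) \<Rightarrow> ('h \<times> 'h) set \<Rightarrow> ('h \<times> 'h) set
      \<Rightarrow> real \<Rightarrow> real \<Rightarrow> int" where
  "res_index F J H0 V lam r =
     (THE n. \<exists>N \<rho> Np Nm. pole_splits F J H0 V lam r N \<rho> Np Nm \<and> n = int Np - int Nm)"

end

theory Submission
  imports Defs "HOL-Computational_Algebra.Fundamental_Theorem_Algebra"
begin

text \<open>Write \<open>A\<^sub>z = T\<^sub>z(H\<^sub>s)J\<close> and \<open>b(u, v) = \<langle>u, Jv\<rangle>\<close>. Since \<open>Im T\<^sub>z \<ge> 0\<close> for \<open>Im z > 0\<close>, the operator \<open>A\<^sub>z\<close>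
  is dissipative for the indefinite form \<open>b\<close>, also in the limit \<open>z = lam + i0\<close>. The poles near \<open>r\<close> are
  the points \<open>p\<close> for which \<open>1/(s - p)\<close> is an eigenvalue of \<open>A\<^sub>z\<close>; for \<open>z = lam + iy\<close> the sum of
  the generalized eigenspaces over the upper (lower) half-plane is \<open>b\<close>-positive (\<open>b\<close>-negative), and
  the sum of both is a small perturbation of the Riesz space \<open>X\<close> of \<open>A\<^bsub>lam+i0\<^esub>\<close> at \<open>1/(s - r)\<close>.
  As \<open>b\<close> is nondegenerate on \<open>X\<close>, the resonance index is the signature of \<open>b\<close> on \<open>X\<close>. With
  \<open>W = A\<^bsub>lam+i0\<^esub> - 1/(s - r)\<close>, nilpotent on \<open>X\<close>, a maximal \<open>W\<close>-invariant isotropic subspace \<open>C\<close>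
  satisfies \<open>W C\<^sup>\<bottom> \<subseteq> C\<close>, so \<open>dim X - 2 dim C\<close> bounds the modulus of the signature and is itself at most
  \<open>dim ker W\<close>, the dimension of \<open>\<Upsilon>\<^sup>1\<close>.\<close>

text \<open>The sign of the form enters through \<open>b(u, A v) = <J u, T J v>\<close>. The
  obstacle is that the boundary operator is only weakly dissipative and its eigenvalue at the
  resonance is real, so half-planes say nothing about \<open>b\<close> on \<open>X\<close> itself;
  strict dissipation holds only at \<open>lam + iy\<close>, on a subspace that moves with
  \<open>y\<close>. That subspace is therefore written as the graph over \<open>X\<close> of an
  operator of small norm, found from a Riccati equation by contraction. Subspaces of
  \<open>X\<close> on which \<open>b\<close> is definite stay definite when lifted to the graph, and
  meet the generalized eigenvectors of the opposite half-plane only in 0. This gives one inequality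
  per sign; the two indices of inertia and the two pole counts each add up to \<open>dim X\<close>,
  so the inequalities are equalities. \<open>J\<close> may have a kernel, so nondegeneracy of
  \<open>b\<close> on \<open>X\<close> has to come from \<open>1/(s - r)\<close> being non-zero.
  Bounded operators are only real-linear by type, which is why complex linearity is carried along as
  a separate property.\<close>

abbreviation cspan :: "'a::complex_vector set \<Rightarrow> 'a set" where "cspan \<equiv> complex_vector.span"
abbreviation csubspace :: "'a::complex_vector set \<Rightarrow> bool" where "csubspace \<equiv> complex_vector.subspace"
abbreviation cindependent :: "'a::complex_vector set \<Rightarrow> bool" where "cindependent \<equiv> complex_vector.independent"

section \<open>Hilbert space geometry\<close>

abbreviation clinear :: "('a::complex_vector \<Rightarrow> 'b::complex_vector) \<Rightarrow> bool" where
  "clinear \<equiv> Vector_Spaces.linear scaleC scaleC"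

interpretation cpair: vector_space_pair
  "scaleC :: complex \<Rightarrow> 'a::complex_vector \<Rightarrow> 'a" "scaleC :: complex \<Rightarrow> 'b::complex_vector \<Rightarrow> 'b"
  by unfold_locales

lemma clinear_iff:
  "clinear f \<longleftrightarrow> (\<forall>x y. f (x + y) = f x + f y) \<and> (\<forall>c x. f (c *\<^sub>C x) = c *\<^sub>C f x)"
  unfolding Vector_Spaces.linear_iff by (simp add: complex_vector.vector_space_axioms)

lemma clinear_blinfun_iff:
  fixes T :: "'a::chilbert_space \<Rightarrow>\<^sub>L 'b::chilbert_space"
  shows "clinear (blinfun_apply T) \<longleftrightarrow> (\<forall>c x. T (c *\<^sub>C x) = c *\<^sub>C T x)"
  by (simp add: clinear_iff blinfun.add_right)

lemmas clinear_simps = cpair.linear_add cpair.linear_scale cpair.linear_diff cpair.linear_neg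
  cpair.linear_0 cpair.linear_sum

lemma clinear_compose: "clinear f \<Longrightarrow> clinear g \<Longrightarrow> clinear (\<lambda>x. g (f x))"
  by (simp add: clinear_iff)

lemma clinear_add: "clinear f \<Longrightarrow> clinear g \<Longrightarrow> clinear (\<lambda>x. f x + g x)"
  by (rule cpair.module_hom_add)

lemma clinear_diff: "clinear f \<Longrightarrow> clinear g \<Longrightarrow> clinear (\<lambda>x. f x - g x)"
  by (rule cpair.module_hom_sub)

lemma clinear_scale: "clinear f \<Longrightarrow> clinear (\<lambda>x. c *\<^sub>C f x)"
  by (rule cpair.module_hom_scale)

lemma clinear_ident: "clinear (\<lambda>x. x)"
  by (simp add: clinear_iff)

lemma clinear_sum: "(\<And>i. i \<in> I \<Longrightarrow> clinear (f i)) \<Longrightarrow> clinear (\<lambda>x. \<Sum>i\<in>I. f i x)"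
  by (induction I rule: infinite_finite_induct)
     (simp_all add: clinear_add cpair.module_hom_zero)

lemma clinear_funpow: "clinear (f :: 'a::complex_vector \<Rightarrow> 'a) \<Longrightarrow> clinear (f ^^ n)"
  by (induction n) (auto simp: clinear_iff)

lemma cinner_add_left: "cinner (x + y) z = cinner x z + cinner y z"
  by (metis cinner_add_right cinner_commute complex_cnj_add)

lemma cinner_scaleC_left: "cinner (a *\<^sub>C x) y = cnj a * cinner x y"
  by (metis cinner_scaleC_right cinner_commute complex_cnj_mult)

lemma cinner_zero_right [simp]: "cinner x 0 = 0"
  using cinner_add_right [of x 0 0] by simp

lemma cinner_zero_left [simp]: "cinner 0 x = 0"
  using cinner_add_left [of 0 0 x] by simp

lemma cinner_minus_right: "cinner x (- y) = - cinner x y"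
  using cinner_add_right [of x y "- y"] by (simp add: eq_neg_iff_add_eq_0 add.commute)

lemma cinner_minus_left: "cinner (- x) y = - cinner x y"
  using cinner_add_left [of x "- x" y] by (simp add: eq_neg_iff_add_eq_0 add.commute)

lemma cinner_diff_right: "cinner x (y - z) = cinner x y - cinner x z"
  using cinner_add_right [of x y "- z"] by (simp add: cinner_minus_right)

lemma cinner_diff_left: "cinner (x - y) z = cinner x z - cinner y z"
  using cinner_add_left [of x "- y" z] by (simp add: cinner_minus_left)

lemma cinner_sum_right: "cinner x (\<Sum>i\<in>I. f i) = (\<Sum>i\<in>I. cinner x (f i))"
  by (induction I rule: infinite_finite_induct) (auto simp: cinner_add_right)

lemmas cinner_simps = cinner_add_left cinner_add_right cinner_diff_left cinner_diff_right
  cinner_scaleC_left cinner_scaleC_right cinner_minus_left cinner_minus_right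

lemma cinner_self_eq_0_iff [simp]: "cinner x x = 0 \<longleftrightarrow> x = 0"
  by (simp add: cinner_self)

lemma norm_scaleC [simp]: "norm (a *\<^sub>C (x::'a::chilbert_space)) = cmod a * norm x"
proof -
  have "complex_of_real ((norm (a *\<^sub>C x))\<^sup>2) = complex_of_real ((cmod a * norm x)\<^sup>2)"
    unfolding cinner_self [symmetric] cinner_scaleC_left cinner_scaleC_right
    by (simp add: cinner_self power_mult_distrib complex_norm_square [symmetric] mult_ac)
  then have "(norm (a *\<^sub>C x))\<^sup>2 = (cmod a * norm x)\<^sup>2"
    using of_real_eq_iff by blast
  then show ?thesis
    by (simp add: power2_eq_iff_nonneg)
qed

lemma norm_add_sq: "(norm (x + y :: 'a::chilbert_space))\<^sup>2 = (norm x)\<^sup>2 + (norm y)\<^sup>2 + 2 * Re (cinner x y)"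
proof -
  have "complex_of_real ((norm (x + y))\<^sup>2)
      = complex_of_real ((norm x)\<^sup>2) + complex_of_real ((norm y)\<^sup>2) + (cinner x y + cnj (cinner x y))"
    unfolding cinner_self [symmetric] cinner_commute [of x y, symmetric]
    using cinner_commute [of y x] by (simp add: cinner_simps)
  then show ?thesis
    by (metis Re_complex_of_real complex_add_cnj of_real_add)
qed

lemma cinner_Cauchy_Schwarz: "cmod (cinner x y) \<le> norm x * norm y"
proof (cases "x = 0")
  case False
  define t where "t = - cinner x y / complex_of_real ((norm x)\<^sup>2)"
  have nx: "norm x \<noteq> 0" using False by simp
  have "0 \<le> (norm (y + t *\<^sub>C x))\<^sup>2" by simp
  also have "\<dots> = (norm y)\<^sup>2 + (cmod t * norm x)\<^sup>2 + 2 * Re (t * cnj (cinner x y))"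
    by (simp add: norm_add_sq cinner_scaleC_right cinner_commute [of y x])
  also have "t * cnj (cinner x y) = complex_of_real (- ((cmod (cinner x y))\<^sup>2 / (norm x)\<^sup>2))"
    by (simp add: t_def complex_norm_square [symmetric])
  also have "(cmod t * norm x)\<^sup>2 = (cmod (cinner x y))\<^sup>2 / (norm x)\<^sup>2"
    using nx by (simp add: t_def norm_divide norm_mult power2_eq_square)
  finally have "(cmod (cinner x y))\<^sup>2 / (norm x)\<^sup>2 \<le> (norm y)\<^sup>2"
    by simp
  then have "(cmod (cinner x y))\<^sup>2 \<le> (norm x * norm y)\<^sup>2"
    using nx by (simp add: divide_le_eq power_mult_distrib mult.commute)
  then show ?thesis
    by (meson mult_nonneg_nonneg norm_ge_zero power2_le_imp_le)
qed simp

lemma bounded_bilinear_cinner: "bounded_bilinear (cinner :: 'a::chilbert_space \<Rightarrow> 'a \<Rightarrow> complex)"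
proof
  show "\<exists>K. \<forall>a b::'a. cmod (cinner a b) \<le> norm a * norm b * K"
    by (rule exI [of _ 1]) (simp add: cinner_Cauchy_Schwarz)
qed (simp_all add: cinner_simps scaleR_scaleC scaleR_conv_of_real)

lemmas tendsto_cinner = bounded_bilinear.tendsto [OF bounded_bilinear_cinner]

lemma bounded_bilinear_scaleC: "bounded_bilinear (scaleC :: complex \<Rightarrow> 'a::chilbert_space \<Rightarrow> 'a)"
proof
  show "\<exists>K. \<forall>a (b::'a). norm (a *\<^sub>C b) \<le> norm a * norm b * K"
    by (rule exI [of _ 1]) simp
next
  fix r a and b :: 'a
  show "(r *\<^sub>R a) *\<^sub>C b = r *\<^sub>R a *\<^sub>C b"
    by (simp add: scaleR_scaleC scaleR_conv_of_real scaleC_scaleC)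
  show "a *\<^sub>C (r *\<^sub>R b) = r *\<^sub>R a *\<^sub>C b"
    by (simp add: scaleR_scaleC scaleC_scaleC mult.commute)
qed (simp_all add: scaleC_add_left scaleC_add_right)

lemmas bounded_linear_scaleC = bounded_bilinear.bounded_linear_right [OF bounded_bilinear_scaleC]
lemmas tendsto_scaleC [tendsto_intros] = bounded_bilinear.tendsto [OF bounded_bilinear_scaleC]
lemmas continuous_on_scaleC [continuous_intros] = bounded_bilinear.continuous_on [OF bounded_bilinear_scaleC]

text \<open>The first-order condition for a nearest point: the coefficient \<open>t\<close> below
  makes \<open>x + t *\<^sub>C v\<close> orthogonal to \<open>v\<close>, which lowers the norm
  strictly unless \<open>x\<close> was orthogonal already.\<close>

lemma cinner_eq_0_if_minimal:
  fixes x v :: "'a::chilbert_space"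
  assumes "\<And>t. norm x \<le> norm (x + t *\<^sub>C v)"
  shows "cinner v x = 0"
proof (cases "v = 0")
  case False
  define t where "t = - cinner v x / complex_of_real ((norm v)\<^sup>2)"
  have nv: "norm v \<noteq> 0" using False by simp
  have "(norm x)\<^sup>2 \<le> (norm (x + t *\<^sub>C v))\<^sup>2"
    using assms by (simp add: power_mono)
  also have "\<dots> = (norm x)\<^sup>2 + (cmod t * norm v)\<^sup>2 + 2 * Re (t * cnj (cinner v x))"
    by (simp add: norm_add_sq cinner_scaleC_right cinner_commute [of x v])
  also have "t * cnj (cinner v x) = complex_of_real (- ((cmod (cinner v x))\<^sup>2 / (norm v)\<^sup>2))"
    by (simp add: t_def complex_norm_square [symmetric])
  also have "(cmod t * norm v)\<^sup>2 = (cmod (cinner v x))\<^sup>2 / (norm v)\<^sup>2"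
    using nv by (simp add: t_def norm_divide norm_mult power2_eq_square)
  finally have "(cmod (cinner v x))\<^sup>2 / (norm v)\<^sup>2 \<le> 0"
    by simp
  then show ?thesis
    using nv by (simp add: divide_le_0_iff)
qed simp

text \<open>A minimizing sequence is Cauchy by the parallelogram law, because midpoints stay in
  \<open>S\<close>; its limit satisfies the first-order condition.\<close>

theorem orthogonal_projection:
  fixes x :: "'a::chilbert_space"
  assumes S: "csubspace S" and cl: "closed S"
  obtains p where "p \<in> S" "\<And>v. v \<in> S \<Longrightarrow> cinner v (x - p) = 0"
proof -
  define d where "d = Inf ((\<lambda>v. norm (x - v)) ` S)"
  have S0: "0 \<in> S" using complex_vector.subspace_0 [OF S] .
  have bdd: "bdd_below ((\<lambda>v. norm (x - v)) ` S)"
    by (intro bdd_belowI [of _ 0]) auto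
  have d_le: "d \<le> norm (x - v)" if "v \<in> S" for v
    unfolding d_def using bdd that by (intro cInf_lower) auto
  have d0: "0 \<le> d"
    unfolding d_def using S0 by (intro cInf_greatest) auto
  have "\<exists>v\<in>S. norm (x - v) < d + 1 / real (Suc n)" for n
    using cInf_lessD [of "(\<lambda>v. norm (x - v)) ` S" "d + 1 / real (Suc n)"] S0
    unfolding d_def [symmetric] by auto
  then obtain f where f: "\<And>n. f n \<in> S" "\<And>n. norm (x - f n) < d + 1 / real (Suc n)"
    by metis
  have inv: "(\<lambda>n. 1 / real (Suc n)) \<longlonglongrightarrow> 0"
    using LIMSEQ_inverse_real_of_nat by (simp add: inverse_eq_divide)
  have par: "(norm (u - v))\<^sup>2 = 2 * (norm u)\<^sup>2 + 2 * (norm v)\<^sup>2 - (norm (u + v))\<^sup>2" for u v :: 'a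
    using norm_add_sq [of u v] norm_add_sq [of u "- v"] by (simp add: cinner_minus_right)
  have dist_f: "(dist (f m) (f n))\<^sup>2 \<le> (4 * d + 2) * (1 / real (Suc m) + 1 / real (Suc n))" for m n
  proof -
    let ?a = "1 / real (Suc m)" and ?b = "1 / real (Suc n)"
    have mid: "(1/2::complex) *\<^sub>C (f m + f n) \<in> S"
      using f S by (intro complex_vector.subspace_scale complex_vector.subspace_add)
    have "(x - f m) + (x - f n) = (2::complex) *\<^sub>C (x - (1/2::complex) *\<^sub>C (f m + f n))"
      by (simp add: complex_vector.scale_right_diff_distrib scaleC_scaleC scaleC_one)
         (metis one_add_one scaleC_add_left scaleC_one)
    then have "norm ((x - f m) + (x - f n)) \<ge> 2 * d"
      using d_le [OF mid] by simp
    then have "(norm ((x - f m) + (x - f n)))\<^sup>2 \<ge> (2 * d)\<^sup>2"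
      using d0 by (intro power_mono) auto
    moreover have "(norm (x - f m))\<^sup>2 \<le> (d + ?a)\<^sup>2" "(norm (x - f n))\<^sup>2 \<le> (d + ?b)\<^sup>2"
      using f(2)[of m] f(2)[of n] by (intro power_mono; simp add: less_imp_le)+
    ultimately have "(norm ((x - f m) - (x - f n)))\<^sup>2 \<le> 2 * (d + ?a)\<^sup>2 + 2 * (d + ?b)\<^sup>2 - (2 * d)\<^sup>2"
      using par [of "x - f m" "x - f n"] by linarith
    also have "\<dots> = 4 * d * (?a + ?b) + 2 * (?a\<^sup>2 + ?b\<^sup>2)"
      by (simp add: power2_eq_square algebra_simps)
    \<comment> \<open>\<open>?a\<close> and \<open>?b\<close> are at most 1, so they bound their own
      squares; this is the origin of \<open>4 * d + 2\<close>.\<close>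
    also have "\<dots> \<le> 4 * d * (?a + ?b) + 2 * (?a + ?b)"
      by (intro add_left_mono mult_left_mono add_mono) (auto simp: power2_eq_square mult_le_one divide_simps)
    finally show ?thesis
      by (simp add: dist_norm norm_minus_commute algebra_simps)
  qed
  have "Cauchy f"
  proof (rule metric_CauchyI)
    fix e :: real assume e: "0 < e"
    define q where "q = e\<^sup>2 / (2 * (4 * d + 2))"
    have q: "q > 0" using e d0 by (simp add: q_def)
    obtain M where M: "\<And>n. n \<ge> M \<Longrightarrow> 1 / real (Suc n) < q"
      using order_tendstoD(2)[OF inv q] by (auto simp: eventually_sequentially)
    show "\<exists>M. \<forall>m\<ge>M. \<forall>n\<ge>M. dist (f m) (f n) < e"
    proof (intro exI allI impI)
      fix m n assume "M \<le> m" "M \<le> n"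
      then have "1 / real (Suc m) + 1 / real (Suc n) < 2 * q" using M [of m] M [of n] by linarith
      then have "(4 * d + 2) * (1 / real (Suc m) + 1 / real (Suc n)) < (4 * d + 2) * (2 * q)"
        using d0 by (intro mult_strict_left_mono) auto
      also have "\<dots> = e\<^sup>2" using d0 by (simp add: q_def field_simps)
      finally have "(dist (f m) (f n))\<^sup>2 < e\<^sup>2" using dist_f [of m n] by linarith
      then show "dist (f m) (f n) < e" using e by (meson less_imp_le power_less_imp_less_base)
    qed
  qed
  then obtain p where p: "f \<longlonglongrightarrow> p"
    using Cauchy_convergent convergent_def by blast
  have pS: "p \<in> S"
    using closed_sequentially [OF cl _ p] f by blast
  have "(\<lambda>n. norm (x - f n)) \<longlonglongrightarrow> norm (x - p)"
    by (intro tendsto_intros p)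
  moreover have "(\<lambda>n. d + 1 / real (Suc n)) \<longlonglongrightarrow> d + 0"
    by (intro tendsto_intros inv)
  ultimately have "norm (x - p) \<le> d + 0"
    by (rule LIMSEQ_le) (use f(2) in \<open>auto intro: less_imp_le\<close>)
  then have min: "norm (x - p) \<le> norm (x - v)" if "v \<in> S" for v
    using d_le [OF that] by simp
  have "cinner v (x - p) = 0" if "v \<in> S" for v
  proof (rule cinner_eq_0_if_minimal)
    fix t
    have "p - t *\<^sub>C v \<in> S"
      using S pS that by (intro complex_vector.subspace_diff complex_vector.subspace_scale)
    from min [OF this] show "norm (x - p) \<le> norm (x - p + t *\<^sub>C v)"
      by (simp add: algebra_simps)
  qed
  with pS show thesis by (rule that)
qed

section \<open>Products of Hilbert spaces, where graphs of closed operators are closed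
  subspaces\<close>

instantiation prod :: (complex_vector, complex_vector) complex_vector
begin
definition "scaleC a x = (a *\<^sub>C fst x, a *\<^sub>C snd x)"
instance
  by standard (auto simp: scaleC_prod_def scaleC_add_right scaleC_add_left scaleC_scaleC scaleC_one scaleR_scaleC prod_eq_iff)
end

instantiation prod :: (chilbert_space, chilbert_space) chilbert_space
begin
definition "cinner x y = cinner (fst x) (fst y) + cinner (snd x) (snd y)"
instance
proof
  fix x y z :: "'a \<times> 'b" and a
  show "cinner x y = cnj (cinner y x)"
    by (simp add: cinner_prod_def cinner_commute [of "fst x"] cinner_commute [of "snd x"])
  show "cinner x (y + z) = cinner x y + cinner x z"
    by (simp add: cinner_prod_def cinner_simps)
  show "cinner x (a *\<^sub>C y) = a * cinner x y"
    by (simp add: cinner_prod_def scaleC_prod_def cinner_simps algebra_simps)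
  show "cinner x x = complex_of_real ((norm x)\<^sup>2)"
    by (simp add: cinner_prod_def cinner_self norm_prod_def)
qed
end

text \<open>What remains of a vector after projection onto the closure of \<open>S\<close> is
  orthogonal to \<open>S\<close>, hence zero.\<close>

lemma dense_iff_orthogonal_trivial:
  assumes S: "csubspace S"
    and triv: "\<And>w :: 'a::chilbert_space. (\<And>v. v \<in> S \<Longrightarrow> cinner v w = 0) \<Longrightarrow> w = 0"
  shows "closure S = UNIV"
proof -
  have sub: "csubspace (closure S)"
    unfolding complex_vector.subspace_def
  proof (intro conjI ballI allI)
    show "0 \<in> closure S"
      using complex_vector.subspace_0 [OF S] closure_subset by blast
  next
    fix x y assume "x \<in> closure S" "y \<in> closure S"
    then obtain f g where "\<And>n. f n \<in> S" "f \<longlonglongrightarrow> x" "\<And>n. g n \<in> S" "g \<longlonglongrightarrow> y"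
      unfolding closure_sequential by metis
    then show "x + y \<in> closure S"
      unfolding closure_sequential
      by (intro exI [of _ "\<lambda>n. f n + g n"]) (auto intro: tendsto_add complex_vector.subspace_add [OF S])
  next
    fix c x assume "x \<in> closure S"
    then obtain f where "\<And>n. f n \<in> S" "f \<longlonglongrightarrow> x"
      unfolding closure_sequential by metis
    then show "c *\<^sub>C x \<in> closure S"
      unfolding closure_sequential
      by (intro exI [of _ "\<lambda>n. c *\<^sub>C f n"]) (auto intro: tendsto_intros complex_vector.subspace_scale [OF S])
  qed
  have "x \<in> closure S" for x
  proof -
    obtain p where p: "p \<in> closure S" "\<And>v. v \<in> closure S \<Longrightarrow> cinner v (x - p) = 0"
      using orthogonal_projection [OF sub closed_closure] by blast
    then have "x - p = 0"
      using closure_subset by (intro triv) blast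
    with p show ?thesis by simp
  qed
  then show ?thesis by auto
qed

section \<open>Compact operators\<close>

lemma compact_operatorI:
  assumes "blinfun_apply T ` cball 0 1 \<subseteq> K" "compact K"
  shows "compact_operator T"
proof -
  have "closure (blinfun_apply T ` cball 0 1) \<subseteq> K"
    using assms by (intro closure_minimal compact_imp_closed)
  then show ?thesis
    unfolding compact_operator_def using assms(2)
    by (metis closed_closure compact_Int_closed inf.absorb_iff2)
qed

lemma compact_operator_add:
  assumes "compact_operator S" "compact_operator T"
  shows "compact_operator (S + T)"
proof (rule compact_operatorI)
  show "compact {x + y |x y. x \<in> closure (blinfun_apply S ` cball 0 1) \<and> y \<in> closure (blinfun_apply T ` cball 0 1)}"
    using assms unfolding compact_operator_def by (rule compact_sums)
  show "blinfun_apply (S + T) ` cball 0 1 \<subseteq> {x + y |x y. x \<in> closure (blinfun_apply S ` cball 0 1) \<and> y \<in> closure (blinfun_apply T ` cball 0 1)}"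
    using closure_subset [of "blinfun_apply S ` cball 0 1"] closure_subset [of "blinfun_apply T ` cball 0 1"]
    by (fastforce simp: blinfun.add_left)
qed

lemma compact_operator_compose_left:
  assumes "compact_operator T"
  shows "compact_operator (R o\<^sub>L T)"
proof (rule compact_operatorI)
  show "compact (blinfun_apply R ` closure (blinfun_apply T ` cball 0 1))"
    using assms unfolding compact_operator_def
    by (intro compact_continuous_image continuous_intros)
  show "blinfun_apply (R o\<^sub>L T) ` cball 0 1 \<subseteq> blinfun_apply R ` closure (blinfun_apply T ` cball 0 1)"
    using closure_subset [of "blinfun_apply T ` cball 0 1"] by auto
qed

lemma compact_operator_compose_right:
  assumes "compact_operator T"
  shows "compact_operator (T o\<^sub>L R)"
proof (rule compact_operatorI)
  show "compact ((\<lambda>x. norm R *\<^sub>R x) ` closure (blinfun_apply T ` cball 0 1))"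
    using assms unfolding compact_operator_def
    by (intro compact_continuous_image continuous_intros)
  show "blinfun_apply (T o\<^sub>L R) ` cball 0 1 \<subseteq> (\<lambda>x. norm R *\<^sub>R x) ` closure (blinfun_apply T ` cball 0 1)"
  proof
    fix y assume "y \<in> blinfun_apply (T o\<^sub>L R) ` cball 0 1"
    then obtain x where x: "norm x \<le> 1" "y = T (R x)" by auto
    define z where "z = R x /\<^sub>R norm R"
    have nz: "norm z \<le> 1"
    proof -
      have "norm (R x) \<le> norm R"
        using x(1) by (intro order_trans [OF norm_blinfun mult_left_le]) auto
      then show ?thesis by (cases "norm R = 0") (auto simp: z_def field_simps)
    qed
    have "R x = norm R *\<^sub>R z"
      by (cases "norm R = 0") (auto simp: z_def)
    then have "y = norm R *\<^sub>R T z" by (simp add: x blinfun.scaleR_right)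
    moreover have "T z \<in> closure (blinfun_apply T ` cball 0 1)"
      using nz closure_subset [of "blinfun_apply T ` cball 0 1"] by auto
    ultimately show "y \<in> (\<lambda>x. norm R *\<^sub>R x) ` closure (blinfun_apply T ` cball 0 1)" by blast
  qed
qed

text \<open>Finite nets are the form of compactness that survives a small change in operator norm;
  completeness of the target supplies the rest.\<close>

lemma compact_operator_totally_bounded:
  fixes T :: "'a::real_normed_vector \<Rightarrow>\<^sub>L 'b::banach"
  shows "compact_operator T \<longleftrightarrow> (\<forall>e>0. \<exists>k. finite k \<and> blinfun_apply T ` cball 0 1 \<subseteq> (\<Union>x\<in>k. ball x e))"
    (is "_ = (\<forall>e>0. ?tb e)")
proof
  assume "compact_operator T"
  then show "\<forall>e>0. ?tb e"
    unfolding compact_operator_def compact_eq_totally_bounded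
    by (meson closure_subset order_trans)
next
  assume tb: "\<forall>e>0. ?tb e"
  show "compact_operator T"
    unfolding compact_operator_def compact_eq_totally_bounded
  proof (intro conjI allI impI)
    show "complete (closure (blinfun_apply T ` cball 0 1))"
      by (simp add: complete_eq_closed)
    fix e :: real assume "e > 0"
    then obtain k where k: "finite k" "blinfun_apply T ` cball 0 1 \<subseteq> (\<Union>x\<in>k. ball x (e/2))"
      using tb half_gt_zero by blast
    then have "closure (blinfun_apply T ` cball 0 1) \<subseteq> (\<Union>x\<in>k. cball x (e/2))"
      by (intro closure_minimal closed_UN ballI closed_cball subset_trans [OF _ UN_mono [OF subset_refl ball_subset_cball]])
    also have "\<dots> \<subseteq> (\<Union>x\<in>k. ball x e)" using \<open>e > 0\<close> by fastforce
    finally show "\<exists>k. finite k \<and> closure (blinfun_apply T ` cball 0 1) \<subseteq> (\<Union>x\<in>k. ball x e)"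
      using k by blast
  qed
qed

text \<open>A finite net at scale \<open>e/2\<close> for a nearby compact operator is one at scale
  \<open>e\<close> for \<open>T\<close>. This carries compactness from non-real \<open>z\<close> to
  the boundary value.\<close>

lemma compact_operator_limit:
  fixes T :: "'a::real_normed_vector \<Rightarrow>\<^sub>L 'b::banach"
  assumes lim: "(f \<longlongrightarrow> T) G" "G \<noteq> bot" and ev: "\<forall>\<^sub>F y in G. compact_operator (f y)"
  shows "compact_operator T"
  unfolding compact_operator_totally_bounded
proof (intro allI impI)
  fix e :: real assume "e > 0"
  then have "\<forall>\<^sub>F y in G. dist (f y) T < e/2"
    using lim tendstoD half_gt_zero by blast
  with ev obtain y where y: "compact_operator (f y)" "dist (f y) T < e/2"
    using eventually_happens [OF eventually_conj] lim(2) by blast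
  from y(1) obtain k where k: "finite k" "blinfun_apply (f y) ` cball 0 1 \<subseteq> (\<Union>x\<in>k. ball x (e/2))"
    unfolding compact_operator_totally_bounded using \<open>e > 0\<close> half_gt_zero by blast
  have "blinfun_apply T ` cball 0 1 \<subseteq> (\<Union>x\<in>k. ball x e)"
  proof
    fix v assume "v \<in> blinfun_apply T ` cball 0 1"
    then obtain x where x: "norm x \<le> 1" "v = T x" by auto
    then obtain c where c: "c \<in> k" "dist c (f y x) < e/2" using k by force
    have "dist (f y x) (T x) \<le> norm (f y - T) * norm x"
      by (metis dist_norm blinfun.diff_left norm_blinfun)
    also have "\<dots> \<le> norm (f y - T)" using x by (simp add: mult_left_le)
    also have "\<dots> < e/2" using y(2) by (simp add: dist_norm)
    finally have "dist c v < e" using c x dist_triangle_half_l [of c "f y x" e v] by (metis dist_commute dist_triangle_half_r)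
    with c show "v \<in> (\<Union>x\<in>k. ball x e)" by auto
  qed
  with k show "\<exists>k. finite k \<and> blinfun_apply T ` cball 0 1 \<subseteq> (\<Union>x\<in>k. ball x e)" by blast
qed

lemma compact_operator_subseq:
  assumes "compact_operator T" "\<And>n::nat. norm (u n) \<le> 1"
  obtains l r where "strict_mono (r :: nat \<Rightarrow> nat)" "(\<lambda>n. T (u (r n))) \<longlonglongrightarrow> l"
proof -
  have "\<forall>n. T (u n) \<in> closure (blinfun_apply T ` cball 0 1)"
    using assms(2) closure_subset [of "blinfun_apply T ` cball 0 1"] by auto
  then obtain l r where "strict_mono (r :: nat \<Rightarrow> nat)" "((\<lambda>n. T (u n)) \<circ> r) \<longlonglongrightarrow> l"
    using assms(1) unfolding compact_operator_def compact_def by (elim allE [of _ "\<lambda>n. T (u n)"]) blast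
  then show thesis using that by (auto simp: o_def)
qed

text \<open>The contradiction behind both Riesz-Schauder arguments below (descending ranges,
  ascending kernels): compactness prevents the images of a bounded sequence from staying a fixed
  distance apart.\<close>

lemma compact_operator_not_separated:
  assumes T: "compact_operator T" and u: "\<And>n::nat. norm (u n) \<le> 1" and e: "e > 0"
  obtains m n where "m < n" "norm (T (u m) - T (u n)) < e"
proof -
  obtain l r where r: "strict_mono (r :: nat \<Rightarrow> nat)" "(\<lambda>n. T (u (r n))) \<longlonglongrightarrow> l"
    by (rule compact_operator_subseq [OF T u])
  then have "Cauchy (\<lambda>n. T (u (r n)))" by (simp add: LIMSEQ_imp_Cauchy)
  from CauchyD [OF this e] obtain M where "norm (T (u (r M)) - T (u (r (Suc M)))) < e"
    by (meson le_SucI order_refl)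
  then show thesis using that [of "r M" "r (Suc M)"] strict_monoD [OF r(1), of M "Suc M"] by simp
qed

lemma compact_operator_rank_one:
  fixes e :: "'a::chilbert_space" and a :: "'b::chilbert_space"
  obtains T where "compact_operator T" "clinear (blinfun_apply T)" "\<And>u. T u = cinner e u *\<^sub>C a"
proof -
  have bl: "bounded_linear (\<lambda>u. cinner e u *\<^sub>C a)"
    by (intro bounded_linear_compose [OF bounded_bilinear.bounded_linear_left [OF bounded_bilinear_scaleC]]
        bounded_bilinear.bounded_linear_right [OF bounded_bilinear_cinner])
  define T where "T = Blinfun (\<lambda>u. cinner e u *\<^sub>C a)"
  have T: "T u = cinner e u *\<^sub>C a" for u
    unfolding T_def by (simp add: bounded_linear_Blinfun_apply [OF bl])
  have "compact_operator T"
  proof (rule compact_operatorI)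
    show "compact ((\<lambda>c. c *\<^sub>C a) ` cball 0 (norm e))"
      by (intro compact_continuous_image continuous_intros compact_cball)
    show "blinfun_apply T ` cball 0 1 \<subseteq> (\<lambda>c. c *\<^sub>C a) ` cball 0 (norm e)"
      using cinner_Cauchy_Schwarz [of e] mult_left_le [of "norm _" "norm e"] order_trans
      by (fastforce simp: T)
  qed
  moreover have "clinear (blinfun_apply T)"
    by (simp add: clinear_blinfun_iff T cinner_scaleC_right scaleC_scaleC)
  ultimately show thesis using T that by blast
qed

lemma obtain_blinfun:
  assumes "bounded_linear f"
  obtains T where "\<And>x. blinfun_apply T x = f x"
  using bounded_linear_Blinfun_apply [OF assms] by metis

lemma clinear_bounded_imp_bounded_linear:
  fixes f :: "'a::chilbert_space \<Rightarrow> 'b::chilbert_space"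
  assumes "clinear f" "\<And>x. norm (f x) \<le> norm x * K"
  shows "bounded_linear f"
  using assms by (intro bounded_linear_intro) (auto simp: clinear_iff scaleR_scaleC)

section \<open>The Fredholm alternative\<close>

text \<open>Otherwise there are unit vectors with \<open>u n - C (u n)\<close> tending to 0; along a
  subsequence \<open>C (u n)\<close> converges, hence so does \<open>u n\<close>, and the limit is a
  unit vector fixed by \<open>C\<close>.\<close>

lemma compact_perturbation_bounded_below:
  fixes C :: "'a::chilbert_space \<Rightarrow>\<^sub>L 'a"
  assumes C: "compact_operator C" and inj: "\<And>u. C u = u \<Longrightarrow> u = 0"
  obtains c where "c > 0" "\<And>u. c * norm u \<le> norm (u - C u)"
proof (rule ccontr)
  assume no: "\<not> thesis"
  have "\<exists>u. norm u = 1 \<and> norm (u - C u) < 1 / real (Suc n)" for n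
  proof -
    have "\<not> (\<forall>u. 1 / real (Suc n) * norm u \<le> norm (u - C u))"
    proof
      assume "\<forall>u. 1 / real (Suc n) * norm u \<le> norm (u - C u)"
      then show False using no that [of "1 / real (Suc n)"] by simp
    qed
    then obtain u where u: "norm (u - C u) < 1 / real (Suc n) * norm u" by (meson not_le)
    then have n0: "norm u > 0" by (cases "u = 0") auto
    have "norm (u /\<^sub>R norm u - C (u /\<^sub>R norm u)) = norm (u - C u) / norm u"
      by (simp add: blinfun.scaleR_right scaleR_diff_right [symmetric] divide_inverse mult.commute)
    also have "\<dots> < 1 / real (Suc n)" using u n0 by (simp add: pos_divide_less_eq)
    finally show ?thesis using n0 by (intro exI [of _ "u /\<^sub>R norm u"]) auto
  qed
  then obtain u where u: "\<And>n. norm (u n) = 1" "\<And>n. norm (u n - C (u n)) < 1 / real (Suc n)" by metis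
  obtain l r where r: "strict_mono (r :: nat \<Rightarrow> nat)" "(\<lambda>n. C (u (r n))) \<longlonglongrightarrow> l"
    by (rule compact_operator_subseq [OF C, of u]) (use u in auto)
  have inv: "(\<lambda>n. 1 / real (Suc n)) \<longlonglongrightarrow> 0"
    using LIMSEQ_inverse_real_of_nat by (simp add: inverse_eq_divide)
  have "(\<lambda>n. u n - C (u n)) \<longlonglongrightarrow> 0"
    using u(2) by (intro tendsto_norm_zero_cancel [OF tendsto_sandwich [OF _ _ tendsto_const inv]])
       (auto intro!: always_eventually less_imp_le)
  then have "(\<lambda>n. u (r n) - C (u (r n))) \<longlonglongrightarrow> 0"
    using LIMSEQ_subseq_LIMSEQ [OF _ r(1)] by (fastforce simp: o_def)
  from tendsto_add [OF this r(2)] have ul: "(\<lambda>n. u (r n)) \<longlonglongrightarrow> l" by simp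
  then have "(\<lambda>n. C (u (r n))) \<longlonglongrightarrow> C l" by (intro tendsto_intros)
  then have "C l = l" using r(2) LIMSEQ_unique by blast
  then have "l = 0" by (rule inj)
  moreover have "norm l = 1"
    using tendsto_norm [OF ul] u(1) by (simp add: LIMSEQ_const_iff)
  ultimately show False by simp
qed

lemma norm_ge_if_orthogonal:
  fixes x y :: "'a::chilbert_space"
  assumes "cinner y x = 0"
  shows "norm x \<le> norm (x - y)"
proof -
  have "(norm x)\<^sup>2 \<le> (norm (x - y))\<^sup>2"
    using norm_add_sq [of x "- y"] assms cinner_commute [of x y] by (simp add: cinner_minus_right)
  then show ?thesis by simp
qed

text \<open>Riesz's lemma with the sharp constant 1: the vector is the normalized component of
  \<open>w\<close> orthogonal to \<open>N\<close>.\<close>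

lemma unit_vector_orthogonal_to_closed_subspace:
  fixes M N :: "'a::chilbert_space set"
  assumes M: "csubspace M" and N: "csubspace N" "closed N" "N \<subseteq> M"
    and w: "w \<in> M" "w \<notin> N"
  obtains v where "v \<in> M" "norm v = 1" "\<And>y. y \<in> N \<Longrightarrow> norm (v - y) \<ge> 1"
proof -
  obtain p where p: "p \<in> N" "\<And>v. v \<in> N \<Longrightarrow> cinner v (w - p) = 0"
    using orthogonal_projection [OF N(1,2)] by blast
  define v where "v = complex_of_real (inverse (norm (w - p))) *\<^sub>C (w - p)"
  have "w \<noteq> p" using p w by auto
  then have nv: "norm v = 1" by (simp add: v_def norm_inverse)
  have "v \<in> M"
    unfolding v_def using p w N M by (intro complex_vector.subspace_scale complex_vector.subspace_diff) auto
  moreover have "norm (v - y) \<ge> 1" if "y \<in> N" for y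
    using norm_ge_if_orthogonal [of y v] p(2) [OF that] nv by (simp add: v_def cinner_scaleC_right)
  ultimately show thesis using nv that by blast
qed

text \<open>Injectivity bounds \<open>D = 1 - C\<close> below, so the ranges of all its powers are
  closed. If \<open>D\<close> missed a vector, these ranges would decrease strictly, and unit
  vectors orthogonal to the next range would have images under \<open>C\<close> at distance at least
  1.\<close>

theorem Fredholm_alternative:
  fixes C :: "'a::chilbert_space \<Rightarrow>\<^sub>L 'a"
  assumes C: "compact_operator C" and lin: "clinear (blinfun_apply C)" and inj: "\<And>u. C u = u \<Longrightarrow> u = 0"
  obtains G :: "'a \<Rightarrow>\<^sub>L 'a" where "clinear (blinfun_apply G)" "\<And>u. G (u - C u) = u" "\<And>u. G u - C (G u) = u"
proof -
  obtain c where c: "c > 0" "\<And>u. c * norm u \<le> norm (u - C u)"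
    using compact_perturbation_bounded_below [OF C inj] by blast
  define D where "D = (\<lambda>u. u - C u)"
  have D: "clinear D" unfolding D_def by (intro clinear_diff clinear_ident lin)
  have Dk: "clinear (D ^^ k)" for k using D by (rule clinear_funpow)
  have D_bl: "bounded_linear D"
    unfolding D_def by (intro bounded_linear_sub bounded_linear_ident blinfun.bounded_linear_right)
  have Dk_bl: "bounded_linear (D ^^ k)" for k
    by (induction k) (auto simp: o_def id_def intro: bounded_linear_compose [OF D_bl])
  have Dk_below: "c ^ k * norm u \<le> norm ((D ^^ k) u)" for k u
  proof (induction k)
    case (Suc k)
    have "c ^ Suc k * norm u \<le> c * norm ((D ^^ k) u)" using Suc c by simp
    also have "\<dots> \<le> norm ((D ^^ Suc k) u)" using c(2) by (simp add: D_def)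
    finally show ?case .
  qed simp
  have closed_range: "closed (range (D ^^ k))" for k
    using complete_isometric_image [of "c ^ k" UNIV "D ^^ k"] Dk_bl Dk_below c(1)
    by (simp add: complete_eq_closed)
  have sub_range: "csubspace (range (D ^^ k))" for k
    using cpair.linear_subspace_image [OF Dk complex_vector.subspace_UNIV] .
  have D_inj: "u = v" if "D u = D v" for u v
  proof -
    have "c * norm (u - v) \<le> norm (D (u - v))" using c(2) by (simp add: D_def)
    also have "D (u - v) = 0" using that by (simp add: clinear_simps(3) [OF D])
    finally show ?thesis using c(1) by (simp add: mult_le_0_iff)
  qed
  have surj: "\<exists>u. D u = w" for w
  proof (rule ccontr)
    assume w: "\<not> (\<exists>u. D u = w)"
    have Dkw: "(D ^^ k) w \<notin> range (D ^^ Suc k)" for k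
    proof (induction k)
      case 0 then show ?case using w by auto
    next
      case (Suc k)
      show ?case
      proof
        assume "(D ^^ Suc k) w \<in> range (D ^^ Suc (Suc k))"
        then obtain u where "D ((D ^^ k) w) = D ((D ^^ Suc k) u)" by auto
        then have "(D ^^ k) w = (D ^^ Suc k) u" by (rule D_inj)
        with Suc show False by blast
      qed
    qed
    have mono: "range (D ^^ Suc k) \<subseteq> range (D ^^ k)" for k
      by (auto simp: funpow_swap1)
    then have mono': "range (D ^^ m) \<subseteq> range (D ^^ k)" if "k \<le> m" for k m
      using that lift_Suc_antimono_le [of "\<lambda>k. range (D ^^ k)"] by blast
    have "\<exists>v. v \<in> range (D ^^ k) \<and> norm v = 1 \<and> (\<forall>y\<in>range (D ^^ Suc k). norm (v - y) \<ge> 1)" for k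
      by (rule unit_vector_orthogonal_to_closed_subspace
          [OF sub_range sub_range closed_range mono rangeI Dkw]) blast
    then obtain v where v: "\<And>k. v k \<in> range (D ^^ k)" "\<And>k. norm (v k) = 1"
      "\<And>k y. y \<in> range (D ^^ Suc k) \<Longrightarrow> norm (v k - y) \<ge> 1" by metis
    obtain k m where km: "k < m" "norm (C (v k) - C (v m)) < 1"
      by (rule compact_operator_not_separated [OF C, of v 1]) (use v in auto)
    have Dv: "D (v j) \<in> range (D ^^ Suc j)" for j
      using v(1) [of j] by auto
    \<comment> \<open>The vector to compare with \<open>v k\<close>, since
      \<open>C (v k) - C (v m) = v k - (D (v k) + v m - D (v m))\<close>.\<close>
    have "D (v k) + v m - D (v m) \<in> range (D ^^ Suc k)"
      using Dv [of k] Dv [of m] v(1) [of m] km(1) mono' [of "Suc k" m] mono' [of "Suc k" "Suc m"]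
      by (intro complex_vector.subspace_diff complex_vector.subspace_add sub_range) auto
    from v(3) [OF this] have "1 \<le> norm (C (v k) - C (v m))"
      by (simp add: D_def algebra_simps)
    with km show False by simp
  qed
  define g where "g w = (THE u. D u = w)" for w
  have g: "D (g w) = w" for w
  proof -
    have "\<exists>!u. D u = w" using surj [of w] D_inj by (metis)
    then show ?thesis unfolding g_def by (rule theI')
  qed
  have gD: "g (D u) = u" for u using g D_inj by blast
  have g_lin: "clinear g"
    unfolding clinear_iff
  proof (intro conjI allI; rule D_inj)
  qed (simp_all add: g clinear_simps(1,2) [OF D])
  have "norm (g w) \<le> norm w * inverse c" for w
  proof -
    have "c * norm (g w) \<le> norm w" using c(2) [of "g w"] g [of w] by (simp add: D_def)
    then show ?thesis using c(1) by (simp add: field_simps)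
  qed
  then have "bounded_linear g"
    using g_lin by (intro clinear_bounded_imp_bounded_linear)
  then obtain G where G: "\<And>x. blinfun_apply G x = g x"
    using obtain_blinfun by blast
  show thesis
    by (rule that [of G]) (use G g gD g_lin in \<open>auto simp: D_def clinear_iff\<close>)
qed

section \<open>Riesz decomposition at a non-zero eigenvalue\<close>

abbreviation shift :: "('a::complex_vector \<Rightarrow> 'a) \<Rightarrow> complex \<Rightarrow> 'a \<Rightarrow> 'a" where
  "shift f \<sigma> \<equiv> (\<lambda>v. f v - \<sigma> *\<^sub>C v)"

lemma clinear_shift: "clinear f \<Longrightarrow> clinear (shift f \<sigma>)"
  by (intro clinear_diff clinear_scale clinear_ident)

lemma bounded_linear_shift_funpow:
  fixes A :: "'k::chilbert_space \<Rightarrow>\<^sub>L 'k"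
  shows "bounded_linear (shift A \<sigma> ^^ k)"
proof (induction k)
  case (Suc k)
  have "bounded_linear (shift A \<sigma>)"
    by (intro bounded_linear_sub bounded_linear_scaleC blinfun.bounded_linear_right)
  from bounded_linear_compose [OF this Suc] show ?case by (simp add: o_def)
qed (simp add: id_def)

text \<open>\<open>C\<close> maps unit vectors of \<open>X\<close> to themselves, so they are
  covered by finitely many balls of radius 1/2. Orthonormal vectors are at least 1 apart and need
  different balls; this bounds the size of orthonormal systems, and a maximal one spans
  \<open>X\<close>.\<close>

lemma finite_orthonormal_basis_of_fixed_space:
  fixes C :: "'k::chilbert_space \<Rightarrow>\<^sub>L 'k"
  assumes C: "compact_operator C" and X: "csubspace X" "\<And>u. u \<in> X \<Longrightarrow> C u = u"
  obtains E where "finite E" "E \<subseteq> X" "\<And>u. u \<in> X \<Longrightarrow> u = (\<Sum>e\<in>E. cinner e u *\<^sub>C e)"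
    "\<And>u. (\<Sum>e\<in>E. cinner e u *\<^sub>C e) \<in> X"
proof -
  define on where "on E \<longleftrightarrow> finite E \<and> E \<subseteq> X \<and> (\<forall>e\<in>E. norm e = 1) \<and> (\<forall>e\<in>E. \<forall>f\<in>E. e \<noteq> f \<longrightarrow> cinner e f = 0)" for E
  have sep: "norm (e - f) \<ge> 1" if "norm e = 1" "cinner f e = 0" for e f :: 'k
    using norm_ge_if_orthogonal [OF that(2)] that(1) by simp
  obtain k where k: "finite k" "blinfun_apply C ` cball 0 1 \<subseteq> (\<Union>x\<in>k. ball x (1/2))"
    using C unfolding compact_operator_totally_bounded by (meson half_gt_zero zero_less_one)
  have card: "card E \<le> card k" if "on E" for E
  proof -
    have "\<exists>x\<in>k. dist x e < 1/2" if "e \<in> E" for e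
    proof -
      have "C e = e" "norm e = 1" using that \<open>on E\<close> X(2) by (auto simp: on_def)
      then have "e \<in> blinfun_apply C ` cball 0 1" by (intro image_eqI [of _ _ e]) auto
      then show ?thesis using k(2) by (meson UN_E mem_ball subsetD)
    qed
    then obtain x where x: "\<And>e. e \<in> E \<Longrightarrow> x e \<in> k \<and> dist (x e) e < 1/2" by metis
    have "inj_on x E"
    proof (rule inj_onI, rule ccontr)
      fix e f assume ef: "e \<in> E" "f \<in> E" "x e = x f" "e \<noteq> f"
      then have "norm (e - f) \<ge> 1" using that by (intro sep) (auto simp: on_def)
      moreover have "dist e f < 1"
        using x [OF ef(1)] x [OF ef(2)] ef(3) dist_triangle_half_r [of "x e" e 1 f] by simp
      ultimately show False by (simp add: dist_norm)
    qed
    then show ?thesis using x k(1) by (intro card_inj_on_le [of x]) auto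
  qed
  have "on {}" by (simp add: on_def)
  then obtain E where E: "on E" "\<And>E'. on E' \<Longrightarrow> card E' \<le> card E"
    using ex_has_greatest_nat [of on "{}" card "Suc (card k)"] card by (metis le_imp_less_Suc)
  have proj_in: "(\<Sum>e\<in>E. cinner e u *\<^sub>C e) \<in> X" for u
    using E(1) X(1) unfolding on_def
    by (intro complex_vector.subspace_sum complex_vector.subspace_scale) auto
  show thesis
  proof (rule that [of E])
    show "finite E" "E \<subseteq> X" using E by (auto simp: on_def)
    show "(\<Sum>e\<in>E. cinner e u *\<^sub>C e) \<in> X" for u by (rule proj_in)
    fix u assume u: "u \<in> X"
    define v where "v = u - (\<Sum>e\<in>E. cinner e u *\<^sub>C e)"
    have orth: "cinner f v = 0" if f: "f \<in> E" for f
    proof -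
      have "cinner f (\<Sum>e\<in>E. cinner e u *\<^sub>C e) = (\<Sum>e\<in>E. if e = f then cinner f u else 0)"
        unfolding cinner_sum_right using f E(1)
        by (intro sum.cong) (auto simp: cinner_scaleC_right on_def cinner_self)
      also have "\<dots> = cinner f u" using f E(1) by (simp add: on_def)
      finally show ?thesis by (simp add: v_def cinner_diff_right)
    qed
    have "v = 0"
    proof (rule ccontr)
      assume v0: "v \<noteq> 0"
      define w where "w = complex_of_real (inverse (norm v)) *\<^sub>C v"
      have w: "norm w = 1" using v0 by (simp add: w_def norm_inverse)
      have wX: "w \<in> X"
        using u X(1) proj_in [of u] unfolding w_def v_def
        by (intro complex_vector.subspace_scale complex_vector.subspace_diff)
      have orth_w: "cinner f w = 0" "cinner w f = 0" if "f \<in> E" for f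
        using orth [OF that] cinner_commute [of w f] by (auto simp: w_def cinner_scaleC_right)
      have "w \<notin> E" using orth_w(1) [of w] w by force
      moreover have "on (insert w E)"
        using E(1) w wX orth_w by (auto simp: on_def)
      ultimately show False using E(2) [of "insert w E"] E(1) by (simp add: on_def)
    qed
    then show "u = (\<Sum>e\<in>E. cinner e u *\<^sub>C e)" by (simp add: v_def)
  qed
qed

text \<open>\<open>P\<close> is the spectral (Riesz) projection of \<open>A\<close> at
  \<open>\<sigma>\<close> and \<open>S\<close> the reduced resolvent: it inverts
  \<open>A - \<sigma>\<close> on the kernel of \<open>P\<close> and vanishes on the range of
  \<open>P\<close>. The set \<open>E\<close> only records that this range is
  finite-dimensional.\<close>

locale riesz_decomposition =
  fixes A :: "'k::chilbert_space \<Rightarrow>\<^sub>L 'k" and \<sigma> :: complex and n :: nat and P S :: "'k \<Rightarrow>\<^sub>L 'k" and E :: "'k set"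
  assumes A_lin: "clinear (blinfun_apply A)"
    and P_lin: "clinear (blinfun_apply P)"
    and S_lin: "clinear (blinfun_apply S)"
    and E_finite: "finite E"
    and P_in_span: "P u \<in> cspan E"
    and P_idem: "P (P u) = P u"
    and P_commute: "P (A u) = A (P u)"
    and S_commute: "S (A u) = A (S u)"
    and nilpotent: "(shift A \<sigma> ^^ n) (P u) = 0"
    and S_shift: "S (shift A \<sigma> u) = u - P u"
    and P_S: "P (S u) = 0"

lemma compact_operator_zero: "compact_operator 0"
  by (rule compact_operatorI [of _ "{0}"]) auto

text \<open>Makes the kernel of a power of \<open>A - \<sigma>\<close> the fixed space of a compact
  operator, and that power itself accessible to the Fredholm alternative.\<close>

lemma compact_operator_id_minus_funpow:
  fixes A :: "'k::chilbert_space \<Rightarrow>\<^sub>L 'k"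
  assumes A: "compact_operator A" "clinear (blinfun_apply A)" and \<sigma>: "\<sigma> \<noteq> 0"
  shows "\<exists>C. compact_operator C \<and> clinear (blinfun_apply C) \<and>
    (\<forall>u. (shift A \<sigma> ^^ k) u = (- \<sigma>) ^ k *\<^sub>C (u - C u))"
proof (induction k)
  case 0
  show ?case
    by (intro exI [of _ 0]) (simp add: clinear_iff scaleC_one compact_operator_zero)
next
  case (Suc k)
  then obtain C where C: "compact_operator C" "clinear (blinfun_apply C)"
    "\<And>u. (shift A \<sigma> ^^ k) u = (- \<sigma>) ^ k *\<^sub>C (u - C u)" by blast
  obtain M where M: "\<And>u::'k. blinfun_apply M u = inverse \<sigma> *\<^sub>C u"
    using obtain_blinfun [OF bounded_linear_scaleC] by blast
  obtain Ng :: "'k \<Rightarrow>\<^sub>L 'k" where Ng: "\<And>u. blinfun_apply Ng u = - u"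
    using obtain_blinfun [OF bounded_linear_minus [OF bounded_linear_ident]] by blast
  \<comment> \<open>Obtained by multiplying out \<open>(A - \<sigma>) (1 - C) = - \<sigma> (1 - A /
    \<sigma>) (1 - C)\<close>.\<close>
  define C' where "C' = C + ((M o\<^sub>L A) + ((Ng o\<^sub>L M) o\<^sub>L (A o\<^sub>L C)))"
  have C': "C' u = C u + inverse \<sigma> *\<^sub>C (A u - A (C u))" for u
    by (simp add: C'_def blinfun.add_left M Ng complex_vector.scale_right_diff_distrib)
  have "compact_operator C'"
    unfolding C'_def using A C(1)
    by (intro compact_operator_add compact_operator_compose_left)
  moreover have "clinear (blinfun_apply C')"
    unfolding C' by (intro clinear_add clinear_scale clinear_diff A C clinear_compose [of C A])
  moreover have "(shift A \<sigma> ^^ Suc k) u = (- \<sigma>) ^ Suc k *\<^sub>C (u - C' u)" for u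
  proof -
    have "(shift A \<sigma> ^^ Suc k) u = (- \<sigma>) ^ k *\<^sub>C (A (u - C u) - \<sigma> *\<^sub>C (u - C u))"
      by (simp only: funpow.simps o_apply C(3) clinear_simps(2) [OF A(2)])
        (simp add: complex_vector.scale_right_diff_distrib scaleC_scaleC mult.commute)
    also have "A (u - C u) - \<sigma> *\<^sub>C (u - C u) = (- \<sigma>) *\<^sub>C (u - C' u)"
      using \<sigma> by (simp add: C' blinfun.diff_right complex_vector.scale_right_diff_distrib scaleC_add_right scaleC_scaleC scaleC_one)
    finally show ?thesis by (simp add: scaleC_scaleC mult.commute)
  qed
  ultimately show ?case by blast
qed

lemma funpow_kernel_mono:
  fixes f :: "'a::complex_vector \<Rightarrow> 'a"
  assumes "clinear f" "j \<le> k" "(f ^^ j) u = 0"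
  shows "(f ^^ k) u = 0"
proof -
  have "(f ^^ k) u = (f ^^ (k - j)) ((f ^^ j) u)"
    using assms(2) by (metis funpow_add le_add_diff_inverse2 o_apply)
  then show ?thesis
    using assms(3) clinear_simps(5) [OF clinear_funpow [OF assms(1)]] by simp
qed

text \<open>If the kernels of the powers kept growing, unit vectors in each kernel and orthogonal to
  the preceding one would have images under \<open>A\<close> at least \<open>cmod \<sigma>\<close>
  apart.\<close>

lemma finite_ascent:
  fixes A :: "'k::chilbert_space \<Rightarrow>\<^sub>L 'k"
  assumes A: "compact_operator A" "clinear (blinfun_apply A)" and \<sigma>: "\<sigma> \<noteq> 0"
  obtains n where "\<And>u. (shift A \<sigma> ^^ Suc n) u = 0 \<Longrightarrow> (shift A \<sigma> ^^ n) u = 0"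
proof (rule ccontr)
  assume no: "\<not> thesis"
  define W where "W = shift A \<sigma>"
  have W: "clinear W" unfolding W_def using A(2) by (rule clinear_shift)
  define N where "N k = {u. (W ^^ k) u = 0}" for k
  have sub: "csubspace (N k)" for k
    unfolding N_def by (rule cpair.linear_subspace_kernel [OF clinear_funpow [OF W]])
  have cl: "closed (N k)" for k
    unfolding N_def W_def
    by (intro closed_Collect_eq linear_continuous_on bounded_linear_shift_funpow continuous_intros)
  have mono: "N j \<subseteq> N k" if "j \<le> k" for j k
    using funpow_kernel_mono [OF W that] by (auto simp: N_def)
  have "\<exists>u. u \<in> N (Suc k) \<and> u \<notin> N k" for k
    using no that [of k] unfolding N_def W_def by blast
  then obtain w where w: "\<And>k. w k \<in> N (Suc k)" "\<And>k. w k \<notin> N k" by metis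
  have "\<exists>v. v \<in> N (Suc k) \<and> norm v = 1 \<and> (\<forall>y\<in>N k. norm (v - y) \<ge> 1)" for k
    by (rule unit_vector_orthogonal_to_closed_subspace
        [OF sub sub cl mono [OF le_SucI [OF order_refl]] w(1) w(2)]) blast
  then obtain v where v: "\<And>k. v k \<in> N (Suc k)" "\<And>k. norm (v k) = 1"
      "\<And>k y. y \<in> N k \<Longrightarrow> norm (v k - y) \<ge> 1" by metis
  obtain j k where jk: "j < k" "norm (A (v j) - A (v k)) < cmod \<sigma>"
    by (rule compact_operator_not_separated [OF A(1), of v "cmod \<sigma>"]) (use v \<sigma> in auto)
  have WN: "W u \<in> N k" if "u \<in> N (Suc k)" for u k
    using that by (simp add: N_def funpow_swap1)
  have Av: "A (v j) \<in> N k"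
  proof -
    have vj: "v j \<in> N k" using v(1) [of j] mono [of "Suc j" k] jk(1) by auto
    then have "W (v j) \<in> N k"
      using WN mono [of k "Suc k"] by auto
    with vj have "W (v j) + \<sigma> *\<^sub>C v j \<in> N k"
      by (intro complex_vector.subspace_add [OF sub] complex_vector.subspace_scale [OF sub])
    then show ?thesis by (simp add: W_def)
  qed
  \<comment> \<open>Collects what lies in the smaller kernel \<open>N k\<close>:
    \<open>A (v j) - A (v k)\<close> is \<open>q\<close> minus \<open>\<sigma>\<close> times
    \<open>v k\<close>.\<close>
  define q where "q = A (v j) - W (v k)"
  have q: "q \<in> N k"
    unfolding q_def using Av WN [OF v(1)] by (rule complex_vector.subspace_diff [OF sub])
  have "A (v j) - A (v k) = (- \<sigma>) *\<^sub>C (v k - inverse \<sigma> *\<^sub>C q)"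
    using \<sigma> by (simp add: q_def W_def complex_vector.scale_right_diff_distrib scaleC_scaleC scaleC_one)
  then have "norm (A (v j) - A (v k)) = cmod \<sigma> * norm (v k - inverse \<sigma> *\<^sub>C q)"
    by simp
  moreover have "norm (v k - inverse \<sigma> *\<^sub>C q) \<ge> 1"
    using q by (intro v(3) complex_vector.subspace_scale [OF sub])
  ultimately have "cmod \<sigma> \<le> norm (A (v j) - A (v k))"
    using \<sigma> by (simp add: mult_left_mono [of 1 "norm (v k - inverse \<sigma> *\<^sub>C q)" "cmod \<sigma>", simplified])
  with jk(2) show False by simp
qed

text \<open>An algebraic replacement for the contour integral. With \<open>X\<close> the kernel of
  \<open>W ^^ n\<close> and \<open>Q\<close> the orthogonal projection onto \<open>X\<close>, the
  operator \<open>R = W ^^ n + Q\<close> is invertible by the Fredholm alternative; then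
  \<open>P\<close> is \<open>Q\<close> composed with the inverse of \<open>R\<close>, and
  \<open>S\<close> is \<open>W ^^ (n - 1)\<close> composed with that inverse, cut down by
  \<open>1 - P\<close> on both sides.\<close>

theorem riesz_decomposition_exists:
  fixes A :: "'k::chilbert_space \<Rightarrow>\<^sub>L 'k"
  assumes A: "compact_operator A" "clinear (blinfun_apply A)" and \<sigma>: "\<sigma> \<noteq> 0"
  obtains n P S E where "riesz_decomposition A \<sigma> n P S E" "n > 0"
proof -
  define W where "W = shift A \<sigma>"
  have W: "clinear W" unfolding W_def using A(2) by (rule clinear_shift)
  have Wk: "clinear (W ^^ k)" for k using W by (rule clinear_funpow)
  obtain m where m: "\<And>u. (W ^^ Suc m) u = 0 \<Longrightarrow> (W ^^ m) u = 0"
    using finite_ascent [OF A \<sigma>] unfolding W_def by blast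
  \<comment> \<open>One more than a stable exponent, so that \<open>W ^^ n\<close> splits off a
    factor \<open>W\<close>; the remaining \<open>W ^^ m\<close> is what \<open>S\<close> is made
    of.\<close>
  define n where "n = Suc m"
  have ascent: "(W ^^ n) u = 0" if "(W ^^ (n + j)) u = 0" for u j
    using that
  proof (induction j)
    case (Suc j)
    have "(W ^^ Suc m) ((W ^^ Suc j) u) = 0"
      using Suc.prems by (simp only: n_def funpow_add o_apply)
    from m [OF this] have "(W ^^ (m + Suc j)) u = 0"
      by (simp only: funpow_add o_apply)
    then have "(W ^^ (n + j)) u = 0"
      by (simp add: n_def)
    then show ?case by (rule Suc.IH)
  qed simp
  define X where "X = {u. (W ^^ n) u = 0}"
  have X: "csubspace X"
    unfolding X_def by (rule cpair.linear_subspace_kernel [OF Wk])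
  have range_X: "(W ^^ n) u = 0" if "(W ^^ n) u \<in> X" for u
    using ascent [of n u] that by (simp add: X_def funpow_add)
  obtain C where C: "compact_operator C" "clinear (blinfun_apply C)"
    "\<And>u. (W ^^ n) u = (- \<sigma>) ^ n *\<^sub>C (u - C u)"
    using compact_operator_id_minus_funpow [OF A \<sigma>, of n] unfolding W_def by blast
  have CX: "C u = u" if "u \<in> X" for u
    using that \<sigma> by (simp add: X_def C(3))
  obtain E where E: "finite E" "E \<subseteq> X" "\<And>u. u \<in> X \<Longrightarrow> u = (\<Sum>e\<in>E. cinner e u *\<^sub>C e)"
    "\<And>u. (\<Sum>e\<in>E. cinner e u *\<^sub>C e) \<in> X"
    by (rule finite_orthonormal_basis_of_fixed_space [OF C(1) X CX], assumption) (rule that; assumption)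
  have "\<exists>Q. compact_operator Q \<and> clinear (blinfun_apply Q) \<and> (\<forall>u. Q u = (\<Sum>e\<in>E. cinner e u *\<^sub>C e))"
    using E(1)
  proof (induction E)
    case empty
    show ?case by (intro exI [of _ 0]) (simp add: clinear_iff compact_operator_zero)
  next
    case (insert e E)
    then obtain Q where Q: "compact_operator Q" "clinear (blinfun_apply Q)" "\<And>u. Q u = (\<Sum>e\<in>E. cinner e u *\<^sub>C e)" by blast
    obtain T where T: "compact_operator T" "clinear (blinfun_apply T)" "\<And>u. T u = cinner e u *\<^sub>C e"
      using compact_operator_rank_one by blast
    have "clinear (blinfun_apply (T + Q))"
      unfolding plus_blinfun.rep_eq by (intro clinear_add T Q)
    moreover have "(T + Q) u = (\<Sum>e\<in>insert e E. cinner e u *\<^sub>C e)" for u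
      using insert.hyps by (simp add: blinfun.add_left T(3) Q(3))
    ultimately show ?case using compact_operator_add [OF T(1) Q(1)] by blast
  qed
  then obtain Q where Q: "compact_operator Q" "clinear (blinfun_apply Q)" "\<And>u. Q u = (\<Sum>e\<in>E. cinner e u *\<^sub>C e)" by blast
  have QX: "Q u \<in> X" for u using E(4) by (simp add: Q(3))
  have Q_fix: "Q u = u" if "u \<in> X" for u using E(3) [OF that] by (simp add: Q(3))
  define c where "c = (- \<sigma>) ^ n"
  have c: "c \<noteq> 0" using \<sigma> by (simp add: c_def)
  obtain M where M: "\<And>u::'k. blinfun_apply M u = (- inverse c) *\<^sub>C u"
    using obtain_blinfun [OF bounded_linear_scaleC] by blast
  \<comment> \<open>Chosen so that \<open>1 - K\<close> is \<open>W ^^ n + Q\<close> divided by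
    \<open>c\<close>. It is injective because the range of \<open>W ^^ n\<close> meets
    \<open>X\<close> only in 0.\<close>
  define K where "K = C + (M o\<^sub>L Q)"
  have K: "u - K u = inverse c *\<^sub>C ((W ^^ n) u + Q u)" for u
    using c by (simp add: K_def blinfun.add_left M C(3) c_def [symmetric] scaleC_add_right scaleC_scaleC scaleC_one)
  have K_comp: "compact_operator K"
    unfolding K_def by (intro compact_operator_add compact_operator_compose_left C Q)
  have K_lin: "clinear (blinfun_apply K)"
    unfolding clinear_blinfun_iff
    by (simp add: K_def blinfun.add_left M clinear_simps(2) [OF C(2)] clinear_simps(2) [OF Q(2)]
        complex_vector.scale_right_diff_distrib scaleC_add_right scaleC_scaleC mult.commute)
  have K_inj: "u = 0" if "K u = u" for u
  proof -
    have eq: "(W ^^ n) u + Q u = 0" using K [of u] that c by simp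
    then have "(W ^^ n) u = Q (- u)" by (simp add: blinfun.minus_right eq_neg_iff_add_eq_0)
    then have "(W ^^ n) u \<in> X" using QX by simp
    then have W0: "(W ^^ n) u = 0" by (rule range_X)
    then have "Q u = u" by (intro Q_fix) (simp add: X_def)
    with eq W0 show ?thesis by simp
  qed
  obtain G where G: "clinear (blinfun_apply G)" "\<And>u. G (u - K u) = u" "\<And>u. G u - K (G u) = u"
    using Fredholm_alternative [OF K_comp K_lin K_inj] by blast
  obtain M' where M': "\<And>u::'k. blinfun_apply M' u = inverse c *\<^sub>C u"
    using obtain_blinfun [OF bounded_linear_scaleC] by blast
  define P where "P = Q o\<^sub>L (M' o\<^sub>L G)"
  have P: "P u = inverse c *\<^sub>C Q (G u)" for u
    by (simp add: P_def M' clinear_simps(2) [OF Q(2)])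
  have split: "u - P u = inverse c *\<^sub>C (W ^^ n) (G u)" for u
  proof -
    have "u = inverse c *\<^sub>C (W ^^ n) (G u) + P u"
      using G(3) [of u] by (simp add: K P scaleC_add_right)
    then show ?thesis by (simp add: algebra_simps)
  qed
  have split': "u - P u = (W ^^ n) (inverse c *\<^sub>C G u)" for u
    unfolding split by (simp add: clinear_simps(2) [OF Wk])
  have P_X: "P u \<in> X" for u
    unfolding P by (intro complex_vector.subspace_scale [OF X] QX)
  have P_fix: "P u = u" if u: "u \<in> X" for u
  proof -
    have "(W ^^ n) (inverse c *\<^sub>C G u) \<in> X"
      unfolding split' [symmetric] by (rule complex_vector.subspace_diff [OF X u P_X])
    from range_X [OF this] show ?thesis using split' [of u] by simp
  qed
  have P_range: "P ((W ^^ n) v) = 0" for v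
  proof -
    let ?w = "(W ^^ n) v"
    have eq: "P ?w = (W ^^ n) (v - inverse c *\<^sub>C G ?w)"
      using split' [of ?w] by (simp add: clinear_simps(3) [OF Wk] algebra_simps)
    then show ?thesis using range_X [of "v - inverse c *\<^sub>C G ?w"] P_X [of ?w] by simp
  qed
  have P_lin: "clinear (blinfun_apply P)"
    unfolding P by (intro clinear_scale clinear_compose [OF G(1) Q(2)])
  have W_eq: "W u = A u - \<sigma> *\<^sub>C u" for u by (simp add: W_def)
  have A_eq: "A u = W u + \<sigma> *\<^sub>C u" for u by (simp add: W_eq)
  have WkA: "(W ^^ k) (A u) = A ((W ^^ k) u)" for k u
    by (simp add: A_eq clinear_simps(1,2) [OF Wk] funpow_swap1)
  have P_A: "P (A u) = A (P u)" for u
  proof -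
    have "A (P u) \<in> X" using P_X [of u] by (simp add: X_def WkA)
    then have 1: "P (A (P u)) = A (P u)" by (rule P_fix)
    have 2: "P (A (u - P u)) = 0"
      unfolding split' WkA [symmetric] by (rule P_range)
    have "A u = A (P u) + A (u - P u)" by (simp add: blinfun.diff_right)
    then show ?thesis by (metis 1 2 add.right_neutral blinfun.add_right)
  qed
  have P_W: "P (W u) = W (P u)" for u
    by (simp add: W_eq blinfun.diff_right P_A clinear_simps(2) [OF P_lin])
  have P_P: "P (P u) = P u" for u by (rule P_fix [OF P_X])
  obtain Wm where Wm: "\<And>u. blinfun_apply Wm u = (W ^^ m) u"
    using obtain_blinfun bounded_linear_shift_funpow unfolding W_def by blast
  define S0 where "S0 u = (W ^^ m) (inverse c *\<^sub>C G (u - P u))" for u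
  have W_S0: "W (S0 u) = u - P u" for u
  proof -
    have "W (S0 u) = (W ^^ n) (inverse c *\<^sub>C G (u - P u))" by (simp add: S0_def n_def)
    also have "\<dots> = (u - P u) - P (u - P u)" by (rule split' [symmetric])
    also have "\<dots> = u - P u" by (simp add: blinfun.diff_right P_P)
    finally show ?thesis .
  qed
  have S0_lin: "clinear S0"
    unfolding S0_def
    by (intro clinear_compose [OF _ Wk] clinear_scale clinear_compose [OF _ G(1)] clinear_diff clinear_ident P_lin)
  define S where "S = (id_blinfun - P) o\<^sub>L (Wm o\<^sub>L (M' o\<^sub>L (G o\<^sub>L (id_blinfun - P))))"
  have S: "S u = S0 u - P (S0 u)" for u
    by (simp add: S_def blinfun.diff_left S0_def Wm M')
  have S_lin: "clinear (blinfun_apply S)"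
    unfolding S by (intro clinear_diff S0_lin clinear_compose [OF S0_lin P_lin])
  have W_S: "W (S u) = u - P u" for u
    by (simp add: S clinear_simps(3) [OF W] P_W [symmetric] W_S0 blinfun.diff_right P_P)
  have P_S: "P (S u) = 0" for u by (simp add: S blinfun.diff_right P_P)
  have S_W: "S (W u) = u - P u" for u
  proof -
    define d where "d = S (W u) - (u - P u)"
    have "W d = 0"
      by (simp add: d_def clinear_simps(3) [OF W] W_S P_W)
    then have "d \<in> X"
      by (simp add: X_def n_def funpow_swap1 clinear_simps(5) [OF Wk])
    then have "d = P d" by (simp add: P_fix)
    also have "P d = 0" by (simp add: d_def blinfun.diff_right P_S P_P)
    finally show ?thesis by (simp add: d_def)
  qed
  have "riesz_decomposition A \<sigma> n P S E"
    unfolding riesz_decomposition_def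
  proof (intro conjI allI)
    show "P u \<in> cspan E" for u
      unfolding P Q(3)
      by (intro complex_vector.span_scale complex_vector.span_sum complex_vector.span_base)
    show "S (A u) = A (S u)" for u
      by (simp add: A_eq blinfun.add_right S_W W_S clinear_simps(2) [OF S_lin])
    show "(shift A \<sigma> ^^ n) (P u) = 0" for u
      using P_X [of u] by (simp add: X_def W_def)
    show "S (shift A \<sigma> u) = u - P u" for u using S_W [of u] by (simp add: W_def)
  qed (fact A(2) | fact P_lin | fact S_lin | fact E(1) | fact P_P | fact P_A | fact P_S)+
  then show thesis by (rule that) (simp add: n_def)
qed

context riesz_decomposition
begin

definition W :: "'k \<Rightarrow> 'k" where "W = shift A \<sigma>"

lemma W_apply: "W u = A u - \<sigma> *\<^sub>C u"
  by (simp add: W_def)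

lemma A_apply: "A u = W u + \<sigma> *\<^sub>C u"
  by (simp add: W_apply)

lemma W_lin: "clinear W"
  unfolding W_def using A_lin by (rule clinear_shift)

lemma W_P: "W (P u) = P (W u)"
  by (simp add: W_apply P_commute blinfun.diff_right clinear_simps(2) [OF P_lin])

lemma S_W: "S (W u) = u - P u"
  using S_shift by (simp add: W_def)

lemma W_S: "W (S u) = u - P u"
  using S_W [of u] by (simp add: W_apply S_commute blinfun.diff_right clinear_simps(2) [OF S_lin])

lemma W_nilpotent: "(W ^^ n) (P u) = 0"
  using nilpotent by (simp add: W_def)

lemma kernel_W: "W u = 0 \<Longrightarrow> P u = u"
  using S_W [of u] by simp

text \<open>\<open>S\<close> inverts \<open>W\<close> away from the Riesz space. This is the
  quantitative spectral gap that later keeps generalized eigenvectors of nearby operators inside the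
  perturbed Riesz space.\<close>

lemma norm_le_shift:
  assumes "P u = 0"
  shows "norm u \<le> norm S * norm (W u)"
  using S_W [of u] norm_blinfun [of S "W u"] assms by simp

end

section \<open>Generalized eigenspaces in finite dimension\<close>

text \<open>The set whose dimension \<open>alg_multiplicity\<close> takes.\<close>

definition gen :: "('a::complex_vector \<Rightarrow> 'a) \<Rightarrow> complex \<Rightarrow> 'a set" where
  "gen f \<sigma> = {u. \<exists>n. (shift f \<sigma> ^^ n) u = 0}"

lemma funpow_commutes:
  assumes "\<And>u. f (g u) = g (f u)"
  shows "(f ^^ j) (g u) = g ((f ^^ j) u)"
  by (induction j) (simp_all add: assms)

lemma shift_commute: "clinear f \<Longrightarrow> shift f \<sigma> (shift f \<tau> u) = shift f \<tau> (shift f \<sigma> u)"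
  by (simp add: clinear_simps(2,3) complex_vector.scale_right_diff_distrib algebra_simps)

lemma subspace_gen:
  assumes f: "clinear f"
  shows "csubspace (gen f \<sigma>)"
proof (rule complex_vector.subspaceI)
  note sh = clinear_funpow [OF clinear_shift [OF f]]
  have "(shift f \<sigma> ^^ 0) 0 = 0" by simp
  then show "0 \<in> gen f \<sigma>" unfolding gen_def by blast
  fix x assume "x \<in> gen f \<sigma>"
  then obtain m where m: "(shift f \<sigma> ^^ m) x = 0" by (auto simp: gen_def)
  then have "(shift f \<sigma> ^^ m) (c *\<^sub>C x) = 0" for c
    by (simp only: clinear_simps(2) [OF sh] complex_vector.scale_zero_right)
  then show "c *\<^sub>C x \<in> gen f \<sigma>" for c unfolding gen_def by blast
  fix y assume "y \<in> gen f \<sigma>"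
  then obtain n where n: "(shift f \<sigma> ^^ n) y = 0" by (auto simp: gen_def)
  have "(shift f \<sigma> ^^ max m n) x = 0" "(shift f \<sigma> ^^ max m n) y = 0"
    by (rule funpow_kernel_mono [OF clinear_shift [OF f] _ m] funpow_kernel_mono [OF clinear_shift [OF f] _ n]; simp)+
  then have "(shift f \<sigma> ^^ max m n) (x + y) = 0"
    by (simp only: clinear_simps(1) [OF sh] add_0)
  then show "x + y \<in> gen f \<sigma>" unfolding gen_def by blast
qed

lemma gen_shift:
  assumes f: "clinear f" and u: "u \<in> gen f \<sigma>"
  shows "shift f \<tau> u \<in> gen f \<sigma>"
proof -
  obtain n where n: "(shift f \<sigma> ^^ n) u = 0" using u by (auto simp: gen_def)
  have "(shift f \<sigma> ^^ n) (shift f \<tau> u) = shift f \<tau> ((shift f \<sigma> ^^ n) u)"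
    by (rule funpow_commutes) (rule shift_commute [OF f])
  then show ?thesis
    using n clinear_simps(5) [OF f] by (auto simp: gen_def)
qed

lemma gen_shift_funpow:
  assumes f: "clinear f" and u: "u \<in> gen f \<sigma>"
  shows "(shift f \<tau> ^^ k) u \<in> gen f \<sigma>"
  using u by (induction k) (auto intro: gen_shift [OF f])

lemma shift_funpow_in_subspace:
  assumes "csubspace X" "\<And>u. u \<in> X \<Longrightarrow> f u \<in> X" "u \<in> X"
  shows "(shift f \<tau> ^^ k) u \<in> X"
proof (induction k)
  case (Suc k)
  then show ?case
    by (simp add: complex_vector.subspace_diff complex_vector.subspace_scale assms(1,2))
qed (simp add: assms(3))

lemma eigenvector_funpow:
  assumes f: "clinear f" and "f u = \<tau> *\<^sub>C u"
  shows "(shift f \<sigma> ^^ k) u = (\<tau> - \<sigma>) ^ k *\<^sub>C u"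
proof (induction k)
  case (Suc k)
  have "(shift f \<sigma> ^^ Suc k) u = ((\<tau> - \<sigma>) ^ k * \<tau>) *\<^sub>C u - (\<sigma> * (\<tau> - \<sigma>) ^ k) *\<^sub>C u"
    by (simp add: Suc clinear_simps(2) [OF f] assms(2) scaleC_scaleC)
  also have "\<dots> = ((\<tau> - \<sigma>) ^ k * \<tau> - \<sigma> * (\<tau> - \<sigma>) ^ k) *\<^sub>C u"
    by (simp only: complex_vector.scale_left_diff_distrib)
  also have "(\<tau> - \<sigma>) ^ k * \<tau> - \<sigma> * (\<tau> - \<sigma>) ^ k = (\<tau> - \<sigma>) ^ Suc k"
    by (simp add: algebra_simps)
  finally show ?case .
qed (simp add: scaleC_one)

lemma shift_injective_on_gen:
  assumes f: "clinear f" and u: "u \<in> gen f \<sigma>" and "\<tau> \<noteq> \<sigma>" and "shift f \<tau> u = 0"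
  shows "u = 0"
proof -
  obtain n where n: "(shift f \<sigma> ^^ n) u = 0" using u by (auto simp: gen_def)
  then show ?thesis
    using eigenvector_funpow [OF f, where u = u and \<tau> = \<tau> and \<sigma> = \<sigma> and k = n] assms(3,4) by simp
qed

text \<open>On \<open>gen f \<sigma>\<close> the operator \<open>shift f \<tau>\<close> is the
  non-zero scalar \<open>\<sigma> - \<tau>\<close> plus the locally nilpotent
  \<open>shift f \<sigma>\<close>; the induction on the nilpotency exponent is its terminating
  Neumann series. Membership in \<open>X\<close> is tracked along the way.\<close>

lemma shift_surjective_on_gen:
  assumes f: "clinear f" and "\<tau> \<noteq> \<sigma>" and X: "csubspace X" "\<And>u. u \<in> X \<Longrightarrow> f u \<in> X"
  shows "u \<in> X \<Longrightarrow> (shift f \<sigma> ^^ k) u = 0 \<Longrightarrow> \<exists>v\<in>gen f \<sigma> \<inter> X. shift f \<tau> v = u"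
proof (induction k arbitrary: u)
  case 0
  then show ?case
    by (intro bexI [of _ 0]) (auto simp: clinear_simps(5) [OF f] complex_vector.subspace_0 [OF X(1)] complex_vector.subspace_0 [OF subspace_gen [OF f]])
next
  case (Suc k)
  define d where "d = \<sigma> - \<tau>"
  have d: "d \<noteq> 0" using assms(2) by (simp add: d_def)
  have sX: "shift f \<sigma> u \<in> X"
    using Suc.prems(1) by (intro complex_vector.subspace_diff complex_vector.subspace_scale X)
  have "(shift f \<sigma> ^^ k) (shift f \<sigma> u) = 0"
    using Suc.prems(2) by (simp only: funpow_Suc_right o_apply)
  from Suc.IH [OF sX this] obtain v where v: "v \<in> gen f \<sigma> \<inter> X" "shift f \<tau> v = shift f \<sigma> u" by blast
  have uG: "u \<in> gen f \<sigma>" using Suc.prems(2) unfolding gen_def by blast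
  let ?w = "inverse d *\<^sub>C (u - v)"
  have "?w \<in> gen f \<sigma> \<inter> X"
    using v(1) uG Suc.prems(1) X(1) subspace_gen [OF f]
    by (auto intro!: complex_vector.subspace_scale complex_vector.subspace_diff)
  moreover have "shift f \<tau> ?w = u"
  proof -
    have "shift f \<tau> ?w = inverse d *\<^sub>C (shift f \<tau> u - shift f \<tau> v)"
      by (simp add: clinear_simps(2,3) [OF f] complex_vector.scale_right_diff_distrib scaleC_scaleC mult.commute)
    also have "shift f \<tau> u - shift f \<tau> v = d *\<^sub>C u"
      unfolding v(2) by (simp add: d_def complex_vector.scale_left_diff_distrib)
    finally show ?thesis using d by (simp add: scaleC_scaleC scaleC_one)
  qed
  ultimately show ?case by blast
qed

section \<open>Splitting an invariant subspace into generalized eigenspaces\<close>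

definition poly_act :: "('a::complex_vector \<Rightarrow> 'a) \<Rightarrow> complex poly \<Rightarrow> 'a \<Rightarrow> 'a" where
  "poly_act f q u = (\<Sum>i\<le>degree q. coeff q i *\<^sub>C (f ^^ i) u)"

lemma poly_act_bound: "degree q \<le> N \<Longrightarrow> poly_act f q u = (\<Sum>i\<le>N. coeff q i *\<^sub>C (f ^^ i) u)"
  unfolding poly_act_def
  by (rule sum.mono_neutral_left) (auto simp: coeff_eq_0)

lemma poly_act_linear_factor:
  assumes f: "clinear f"
  shows "poly_act f ([:- \<sigma>, 1:] * q) u = poly_act f q (shift f \<sigma> u)"
proof -
  let ?d = "degree q"
  have "degree ([:- \<sigma>, 1:] * q) \<le> Suc ?d"
    using degree_mult_le [of "[:- \<sigma>, 1:]" q] by simp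
  then have "poly_act f ([:- \<sigma>, 1:] * q) u = (\<Sum>i\<le>Suc ?d. coeff ([:- \<sigma>, 1:] * q) i *\<^sub>C (f ^^ i) u)"
    by (rule poly_act_bound)
  also have "\<dots> = (\<Sum>i\<le>Suc ?d. (case i of 0 \<Rightarrow> 0 | Suc j \<Rightarrow> coeff q j) *\<^sub>C (f ^^ i) u)
      - (\<Sum>i\<le>Suc ?d. (\<sigma> * coeff q i) *\<^sub>C (f ^^ i) u)"
    unfolding sum_subtractf [symmetric]
    by (intro sum.cong refl) (simp add: coeff_pCons complex_vector.scale_left_diff_distrib algebra_simps split: nat.split)
  also have "(\<Sum>i\<le>Suc ?d. (case i of 0 \<Rightarrow> 0 | Suc j \<Rightarrow> coeff q j) *\<^sub>C (f ^^ i) u) = (\<Sum>i\<le>?d. coeff q i *\<^sub>C (f ^^ i) (f u))"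
    by (subst sum.atMost_Suc_shift) (simp add: funpow_swap1)
  also have "(\<Sum>i\<le>Suc ?d. (\<sigma> * coeff q i) *\<^sub>C (f ^^ i) u) = (\<Sum>i\<le>?d. coeff q i *\<^sub>C (f ^^ i) (\<sigma> *\<^sub>C u))"
    by (simp add: coeff_eq_0 clinear_simps(2) [OF clinear_funpow [OF f]] scaleC_scaleC mult.commute)
  finally show ?thesis
    by (simp add: poly_act_def clinear_simps(3) [OF clinear_funpow [OF f]] complex_vector.scale_right_diff_distrib sum_subtractf)
qed

text \<open>The \<open>card B + 1\<close> iterates of \<open>u\<close> up to exponent
  \<open>card B\<close> lie in the span of \<open>card B\<close> vectors, so they satisfy a linear
  relation.\<close>

lemma annihilating_polynomial:
  assumes B: "finite B" "\<And>i. (f ^^ i) u \<in> cspan B"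
  obtains q where "q \<noteq> 0" "poly_act f q u = 0"
proof (cases "inj_on (\<lambda>i. (f ^^ i) u) {..card B}")
  \<comment> \<open>Coinciding iterates collapse the set of vectors to which the dependence argument
    of the other case applies; here a difference of two monomials annihilates
    \<open>u\<close>.\<close>
  case False
  then obtain i j where ij: "i < j" "(f ^^ i) u = (f ^^ j) u"
    unfolding inj_on_def by (metis nat_neq_iff)
  define q :: "complex poly" where "q = monom 1 j - monom 1 i"
  have "coeff q j = 1" using ij(1) by (simp add: q_def)
  then have "q \<noteq> 0" by force
  have "degree q \<le> j"
    unfolding q_def using ij(1) by (intro degree_diff_le) (auto simp: degree_monom_eq)
  then have "poly_act f q u = (\<Sum>k\<le>j. coeff q k *\<^sub>C (f ^^ k) u)" by (rule poly_act_bound)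
  also have "\<dots> = (\<Sum>k\<le>j. if k = j then (f ^^ j) u else 0) - (\<Sum>k\<le>j. if k = i then (f ^^ i) u else 0)"
    unfolding sum_subtractf [symmetric] using ij(1)
    by (intro sum.cong refl) (auto simp: q_def scaleC_one)
  also have "\<dots> = 0" using ij by (simp add: sum.delta)
  finally show thesis using \<open>q \<noteq> 0\<close> that by blast
next
  case True
  define S where "S = (\<lambda>i. (f ^^ i) u) ` {..card B}"
  have "card S = Suc (card B)" unfolding S_def using card_image [OF True] by simp
  moreover have "S \<subseteq> cspan B" using B(2) by (auto simp: S_def)
  ultimately have "complex_vector.dependent S"
    using complex_vector.independent_span_bound [OF B(1), of S] by (auto simp: not_le)
  then obtain c where c: "\<exists>v\<in>S. c v \<noteq> 0" "(\<Sum>v\<in>S. c v *\<^sub>C v) = 0"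
    using complex_vector.dependent_finite [of S] by (auto simp: S_def)
  define q where "q = (\<Sum>i\<le>card B. monom (c ((f ^^ i) u)) i)"
  have co: "coeff q i = c ((f ^^ i) u)" if "i \<le> card B" for i
    using that by (simp add: q_def coeff_sum)
  have "degree q \<le> card B"
    unfolding q_def by (intro degree_sum_le) (auto intro: order_trans [OF degree_monom_le])
  then have "poly_act f q u = (\<Sum>i\<le>card B. coeff q i *\<^sub>C (f ^^ i) u)" by (rule poly_act_bound)
  also have "\<dots> = (\<Sum>i\<le>card B. c ((f ^^ i) u) *\<^sub>C (f ^^ i) u)"
    by (intro sum.cong refl) (simp add: co)
  also have "\<dots> = (\<Sum>v\<in>S. c v *\<^sub>C v)"
    unfolding S_def sum.reindex [OF True] by simp
  finally have "poly_act f q u = 0" using c(2) by simp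
  moreover have "q \<noteq> 0" using c(1) co by (force simp: S_def)
  ultimately show thesis using that by blast
qed

text \<open>A root \<open>\<sigma>\<close> of the annihilating polynomial is split off, so the
  induction hypothesis applies to \<open>shift f \<sigma> u\<close>. Pulling that vector back
  through \<open>shift f \<sigma>\<close> changes \<open>u\<close> only by an element of
  \<open>gen f \<sigma>\<close>.\<close>

lemma annihilated_in_span_gen:
  assumes f: "clinear f" and X: "csubspace X" "\<And>u. u \<in> X \<Longrightarrow> f u \<in> X"
  shows "q \<noteq> 0 \<Longrightarrow> poly_act f q u = 0 \<Longrightarrow> u \<in> X \<Longrightarrow> u \<in> cspan (\<Union>\<sigma>. gen f \<sigma> \<inter> X)"
proof (induction "degree q" arbitrary: q u)
  case 0
  then obtain a where "q = [:a:]" "a \<noteq> 0" by (metis degree_eq_zeroE pCons_0_0)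
  then have "u = 0" using 0 by (simp add: poly_act_def)
  then show ?case by (simp add: complex_vector.span_zero)
next
  case (Suc d)
  let ?G = "\<Union>\<sigma>. gen f \<sigma> \<inter> X"
  have "\<not> constant (poly q)" using Suc.hyps(2) by (simp add: constant_degree)
  then obtain \<sigma> where "poly q \<sigma> = 0" using fundamental_theorem_of_algebra by blast
  then obtain q' where q': "q = [:- \<sigma>, 1:] * q'" by (auto simp: poly_eq_0_iff_dvd)
  with Suc.prems(1) have q'0: "q' \<noteq> 0" by auto
  then have "degree q = Suc (degree q')" unfolding q' by (subst degree_mult_eq) auto
  then have d: "d = degree q'" using Suc.hyps(2) by simp
  have sX: "shift f \<sigma> u \<in> X"
    using Suc.prems(3) by (intro complex_vector.subspace_diff complex_vector.subspace_scale X)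
  have "shift f \<sigma> u \<in> cspan ?G"
    by (rule Suc.hyps(1) [OF d q'0 _ sX]) (use Suc.prems(2) poly_act_linear_factor [OF f] q' in auto)
  \<comment> \<open>\<open>shift f \<sigma>\<close> maps every other generalized eigenspace onto
    itself; the part in \<open>gen f \<sigma>\<close> need not be hit, so the equation is solved
    modulo that part.\<close>
  moreover have "\<exists>v\<in>cspan ?G. shift f \<sigma> v - w \<in> gen f \<sigma> \<inter> X"
    if "w \<in> cspan ?G" for w
    using that
  proof (induction rule: complex_vector.span_induct_alt)
    case base
    show ?case
      using complex_vector.subspace_0 [OF X(1)] complex_vector.subspace_0 [OF subspace_gen [OF f]]
      by (intro bexI [of _ 0]) (auto simp: clinear_simps(5) [OF f] complex_vector.span_zero)
  next
    case (step c x y)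
    obtain v where v: "v \<in> cspan ?G" "shift f \<sigma> v - y \<in> gen f \<sigma> \<inter> X" using step by blast
    obtain \<tau> where x: "x \<in> gen f \<tau> \<inter> X" using step by blast
    have "\<exists>v'\<in>cspan ?G. shift f \<sigma> v' - x \<in> gen f \<sigma> \<inter> X"
    proof (cases "\<tau> = \<sigma>")
      case True
      then show ?thesis
        using x complex_vector.subspace_neg [OF X(1)] complex_vector.subspace_neg [OF subspace_gen [OF f]]
        by (intro bexI [of _ 0]) (auto simp: clinear_simps(5) [OF f] complex_vector.span_zero)
    next
      case False
      obtain k where "(shift f \<tau> ^^ k) x = 0" using x by (auto simp: gen_def)
      then obtain v' where "v' \<in> gen f \<tau> \<inter> X" "shift f \<sigma> v' = x"
        using shift_surjective_on_gen [OF f _ X, of \<sigma> \<tau> x k] False x by auto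
      then show ?thesis
        using complex_vector.subspace_0 [OF X(1)] complex_vector.subspace_0 [OF subspace_gen [OF f]]
        by (intro bexI [of _ v']) (auto intro!: complex_vector.span_base)
    qed
    then obtain v' where v': "v' \<in> cspan ?G" "shift f \<sigma> v' - x \<in> gen f \<sigma> \<inter> X" by blast
    have "shift f \<sigma> (c *\<^sub>C v' + v) - (c *\<^sub>C x + y) = c *\<^sub>C (shift f \<sigma> v' - x) + (shift f \<sigma> v - y)"
      by (simp add: clinear_simps(1,2) [OF f] scaleC_add_right complex_vector.scale_right_diff_distrib scaleC_scaleC algebra_simps)
    also have "\<dots> \<in> gen f \<sigma> \<inter> X"
      using v(2) v'(2) X(1) subspace_gen [OF f]
      by (auto intro!: complex_vector.subspace_add complex_vector.subspace_scale)
    finally show ?case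
      using v(1) v'(1) by (intro bexI [of _ "c *\<^sub>C v' + v"] complex_vector.span_add complex_vector.span_scale)
  qed
  ultimately obtain v where v: "v \<in> cspan ?G" "shift f \<sigma> v - shift f \<sigma> u \<in> gen f \<sigma> \<inter> X" by blast
  have vX: "v \<in> X"
    using v(1) complex_vector.span_minimal [OF _ X(1), of ?G] by auto
  have "shift f \<sigma> (v - u) = shift f \<sigma> v - shift f \<sigma> u"
    by (simp add: clinear_simps(3) [OF f] complex_vector.scale_right_diff_distrib)
  with v(2) obtain k where "(shift f \<sigma> ^^ k) (shift f \<sigma> (v - u)) = 0" by (auto simp: gen_def)
  then have "(shift f \<sigma> ^^ Suc k) (v - u) = 0" by (simp only: funpow_Suc_right o_apply)
  then have "v - u \<in> gen f \<sigma>" unfolding gen_def by blast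
  then have "v - u \<in> cspan ?G"
    using vX Suc.prems(3) X(1) by (intro complex_vector.span_base) (auto intro: complex_vector.subspace_diff)
  from complex_vector.span_diff [OF v(1) this] show ?case by simp
qed

text \<open>A power of \<open>shift f \<tau>\<close> kills one summand and leaves the others in
  their own generalized eigenspaces, where \<open>shift f \<tau>\<close> is injective.\<close>

lemma gen_sum_eq_0:
  assumes f: "clinear f"
  shows "finite T \<Longrightarrow> (\<And>\<sigma>. \<sigma> \<in> T \<Longrightarrow> u \<sigma> \<in> gen f \<sigma>) \<Longrightarrow> (\<Sum>\<sigma>\<in>T. u \<sigma>) = 0 \<Longrightarrow> \<sigma> \<in> T \<Longrightarrow> u \<sigma> = 0"
proof (induction T arbitrary: u \<sigma> rule: finite_induct)
  case (insert \<tau> T)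
  obtain k where k: "(shift f \<tau> ^^ k) (u \<tau>) = 0" using insert.prems(1) [of \<tau>] by (auto simp: gen_def)
  have sh: "clinear (shift f \<tau> ^^ k)" by (intro clinear_funpow clinear_shift f)
  have "(shift f \<tau> ^^ k) (\<Sum>\<sigma>\<in>insert \<tau> T. u \<sigma>) = 0"
    using insert.prems(2) by (simp add: clinear_simps(5) [OF sh])
  then have sum0: "(\<Sum>\<sigma>\<in>T. (shift f \<tau> ^^ k) (u \<sigma>)) = 0"
    using insert.hyps k by (simp add: clinear_simps(1,6) [OF sh])
  have T0: "u \<sigma> = 0" if "\<sigma> \<in> T" for \<sigma>
  proof -
    have k0: "(shift f \<tau> ^^ k) (u \<sigma>) = 0"
      by (rule insert.IH [OF _ sum0 that], rule gen_shift_funpow [OF f], rule insert.prems) simp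
    have inj: "x = 0" if "(shift f \<tau> ^^ j) x = 0" "x \<in> gen f \<sigma>" for j x
      using that
    proof (induction j arbitrary: x)
      case (Suc j)
      have "(shift f \<tau> ^^ j) (shift f \<tau> x) = 0" using Suc.prems(1) by (simp only: funpow_Suc_right o_apply)
      then have "shift f \<tau> x = 0" by (rule Suc.IH [OF _ gen_shift [OF f Suc.prems(2)]])
      moreover have "\<tau> \<noteq> \<sigma>" using \<open>\<sigma> \<in> T\<close> insert.hyps(2) by blast
      ultimately show ?case
        by (intro shift_injective_on_gen [OF f Suc.prems(2)])
    qed simp
    have "u \<sigma> \<in> gen f \<sigma>" using that by (intro insert.prems(1)) simp
    with k0 show ?thesis by (rule inj)
  qed
  then have "u \<tau> = 0" using insert.prems(2) insert.hyps by simp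
  with T0 insert.prems(3) show ?case by blast
qed simp

text \<open>Bases of the single generalized eigenspaces are put together, and \<open>ev\<close>
  remembers the eigenvalue of each vector. The last clause lets algebraic multiplicities be read off
  by counting basis vectors with a given label.\<close>

theorem gen_basis:
  assumes f: "clinear f" and X: "csubspace X" "\<And>u. u \<in> X \<Longrightarrow> f u \<in> X"
    and B0: "finite B0" "X \<subseteq> cspan B0"
  obtains B ev where "finite B" "cindependent B" "cspan B = X"
    "\<And>v. v \<in> B \<Longrightarrow> v \<in> gen f (ev v)"
    "\<And>\<sigma>. gen f \<sigma> \<inter> X \<subseteq> cspan {v \<in> B. ev v = \<sigma>}"
proof -
  have "\<exists>B. B \<subseteq> gen f \<sigma> \<inter> X \<and> cindependent B \<and> gen f \<sigma> \<inter> X \<subseteq> cspan B" for \<sigma>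
    by (meson complex_vector.basis_exists)
  then obtain b where b: "\<And>\<sigma>. b \<sigma> \<subseteq> gen f \<sigma> \<inter> X" "\<And>\<sigma>. cindependent (b \<sigma>)"
    "\<And>\<sigma>. gen f \<sigma> \<inter> X \<subseteq> cspan (b \<sigma>)" by metis
  define B where "B = (\<Union>\<sigma>. b \<sigma>)"
  define ev where "ev v = (SOME \<sigma>. v \<in> b \<sigma>)" for v
  have ev: "v \<in> b (ev v)" if "v \<in> B" for v
    using that someI_ex [of "\<lambda>\<sigma>. v \<in> b \<sigma>"] by (auto simp: B_def ev_def)
  have gen0: "v = 0" if "v \<in> gen f \<sigma>" "v \<in> gen f \<tau>" "\<sigma> \<noteq> \<tau>" for v \<sigma> \<tau>
  proof -
    have "(if \<sigma> = \<sigma> then v else - v) = 0"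
      by (rule gen_sum_eq_0 [OF f, of "{\<sigma>, \<tau>}" "\<lambda>x. if x = \<sigma> then v else - v"])
         (use that complex_vector.subspace_neg [OF subspace_gen [OF f]] in auto)
    then show ?thesis by simp
  qed
  have b_eq: "b \<sigma> = {v \<in> B. ev v = \<sigma>}" for \<sigma>
  proof (intro equalityI subsetI CollectI conjI)
    fix v assume v: "v \<in> b \<sigma>"
    then show vB: "v \<in> B" by (auto simp: B_def)
    have "v \<noteq> 0" using v b(2) [of \<sigma>] complex_vector.dependent_zero by blast
    then show "ev v = \<sigma>"
      using gen0 [of v "ev v" \<sigma>] ev [OF vB] v b(1) [of \<sigma>] b(1) [of "ev v"] by blast
  qed (use ev in auto)
  have indep: "cindependent B"
    unfolding complex_vector.independent_explicit_finite_subsets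
  proof (intro allI impI ballI)
    fix S c v assume S: "S \<subseteq> B" "finite S" and sum: "(\<Sum>v\<in>S. c v *\<^sub>C v) = 0" and v: "v \<in> S"
    define u where "u \<sigma> = (\<Sum>v\<in>{v \<in> S. ev v = \<sigma>}. c v *\<^sub>C v)" for \<sigma>
    have "(\<Sum>\<sigma>\<in>ev ` S. u \<sigma>) = (\<Sum>v\<in>S. c v *\<^sub>C v)"
      unfolding u_def using S(2) by (rule sum.image_gen [symmetric])
    then have sum0: "(\<Sum>\<sigma>\<in>ev ` S. u \<sigma>) = 0" using sum by simp
    have uG: "u \<sigma> \<in> gen f \<sigma>" for \<sigma>
      unfolding u_def
    proof (intro complex_vector.subspace_sum complex_vector.subspace_scale subspace_gen [OF f])
      fix x assume "x \<in> {v \<in> S. ev v = \<sigma>}"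
      then have "x \<in> b \<sigma>" using S(1) unfolding b_eq by auto
      then show "x \<in> gen f \<sigma>" using b(1) by auto
    qed
    have "u (ev v) = 0"
      by (rule gen_sum_eq_0 [OF f _ uG sum0]) (use S v in auto)
    moreover have "{x \<in> S. ev x = ev v} \<subseteq> b (ev v)" using S(1) unfolding b_eq by auto
    ultimately show "c v = 0"
      using complex_vector.independentD [OF b(2), of "{x \<in> S. ev x = ev v}" "ev v" c v] S(2) v
      by (simp add: u_def)
  qed
  have BX: "B \<subseteq> X" using b(1) by (auto simp: B_def)
  have fin: "finite B"
    using complex_vector.independent_span_bound [OF B0(1) indep] BX B0(2) by auto
  have "X \<subseteq> cspan B"
  proof
    fix u assume u: "u \<in> X"
    have "(f ^^ i) u \<in> X" for i using u by (induction i) (auto intro: X(2))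
    then have "(f ^^ i) u \<in> cspan B0" for i using B0(2) by (meson subsetD)
    then obtain q where "q \<noteq> 0" "poly_act f q u = 0"
      by (rule annihilating_polynomial [OF B0(1)])
    then have "u \<in> cspan (\<Union>\<sigma>. gen f \<sigma> \<inter> X)"
      using annihilated_in_span_gen [OF f X] u by blast
    moreover have "(\<Union>\<sigma>. gen f \<sigma> \<inter> X) \<subseteq> cspan B"
      using b(3) complex_vector.span_mono [of "b _" B] by (fastforce simp: B_def)
    ultimately show "u \<in> cspan B"
      using complex_vector.span_minimal [OF _ complex_vector.subspace_span] by blast
  qed
  then have "cspan B = X"
    using BX X(1) by (intro complex_vector.span_subspace)
  moreover have "v \<in> gen f (ev v)" if "v \<in> B" for v
    using ev [OF that] b(1) by blast
  ultimately show thesis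
    using fin indep b(3) unfolding b_eq by (intro that [of B ev])
qed

section \<open>Dimension counting\<close>

lemma span_finite_sum:
  assumes "finite E" "u \<in> cspan E"
  obtains c where "u = (\<Sum>e\<in>E. c e *\<^sub>C e)"
  using assms complex_vector.span_finite [OF assms(1)] by auto

text \<open>The finite spanning set is essential to the meaning of \<open>dim\<close> here: an
  infinite basis would have \<open>card\<close> 0.\<close>

lemma independent_le_dim:
  assumes "cindependent C" "C \<subseteq> X" "finite B" "X \<subseteq> cspan B"
  shows "finite C" "card C \<le> complex_vector.dim X"
proof -
  obtain B' where B': "B' \<subseteq> X" "cindependent B'" "X \<subseteq> cspan B'" "card B' = complex_vector.dim X"
    using complex_vector.basis_exists by blast
  have "finite B'"
    using complex_vector.independent_span_bound [OF assms(3) B'(2)] B'(1) assms(4) by blast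
  then show "finite C" "card C \<le> complex_vector.dim X"
    using complex_vector.independent_span_bound [of B' C] assms(1,2) B'(3,4) by auto
qed

text \<open>The counting device of the whole argument: it is applied to a definite subspace against
  an isotropic one, and to a definite subspace against one of the opposite sign.\<close>

lemma card_add_le_dim:
  assumes "cindependent B1" "cindependent B2"
    and X: "B1 \<subseteq> X" "B2 \<subseteq> X" "finite B" "X \<subseteq> cspan B"
    and disj: "cspan B1 \<inter> cspan B2 \<subseteq> {0}"
  shows "card B1 + card B2 \<le> complex_vector.dim X"
proof -
  have fin: "finite B1" "finite B2"
    by (rule independent_le_dim(1) [OF assms(1) X(1,3,4)], rule independent_le_dim(1) [OF assms(2) X(2,3,4)])
  have B12: "B1 \<inter> B2 = {}"
    using disj assms(1) complex_vector.span_superset [of B1] complex_vector.span_superset [of B2]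
      complex_vector.dependent_zero [of B1] by blast
  have "cindependent (B1 \<union> B2)"
  proof (rule complex_vector.independent_if_scalars_zero)
    show "finite (B1 \<union> B2)" using fin by simp
    fix c x assume sum: "(\<Sum>x\<in>B1 \<union> B2. c x *\<^sub>C x) = 0" and x: "x \<in> B1 \<union> B2"
    define u where "u = (\<Sum>x\<in>B1. c x *\<^sub>C x)"
    have u': "u = (\<Sum>x\<in>B2. (- c x) *\<^sub>C x)"
      using sum fin B12 by (simp add: u_def sum.union_disjoint sum_negf eq_neg_iff_add_eq_0)
    have "u \<in> cspan B1"
      unfolding u_def by (intro complex_vector.span_sum complex_vector.span_scale complex_vector.span_base)
    moreover have "u \<in> cspan B2"
      unfolding u' by (intro complex_vector.span_sum complex_vector.span_scale complex_vector.span_base)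
    ultimately have "u = 0" using disj by blast
    then show "c x = 0"
      using x complex_vector.independentD [OF assms(1) fin(1) order_refl, of c x]
        complex_vector.independentD [OF assms(2) fin(2) order_refl, of "\<lambda>x. - c x" x] u'
      by (auto simp: u_def)
  qed
  then have "card (B1 \<union> B2) \<le> complex_vector.dim X"
    using X by (intro independent_le_dim(2)) auto
  then show ?thesis using B12 fin by (simp add: card_Un_disjoint)
qed

text \<open>One half of rank-nullity: vectors completing a basis of the kernel to a basis of
  \<open>X\<close> have independent images.\<close>

lemma dim_le_kernel_plus_image:
  assumes g: "clinear g" and X: "csubspace X" "finite B" "X \<subseteq> cspan B"
    and C: "finite C" "\<And>u. u \<in> X \<Longrightarrow> g u \<in> cspan C"
  shows "complex_vector.dim X \<le> complex_vector.dim {u \<in> X. g u = 0} + card C"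
proof -
  obtain K where K: "K \<subseteq> {u \<in> X. g u = 0}" "cindependent K"
    "{u \<in> X. g u = 0} \<subseteq> cspan K" "card K = complex_vector.dim {u \<in> X. g u = 0}"
    using complex_vector.basis_exists by blast
  obtain B' where B': "K \<subseteq> B'" "B' \<subseteq> X" "cindependent B'" "X \<subseteq> cspan B'"
    using complex_vector.maximal_independent_subset_extend [OF _ K(2), of X] K(1) by blast
  have fB: "finite B'" by (rule independent_le_dim(1) [OF B'(3,2) X(2,3)])
  define D where "D = B' - K"
  have fin: "finite D" "finite K" using fB B'(1) finite_subset by (auto simp: D_def)
  have "inj_on g (cspan D)"
    unfolding cpair.linear_inj_on_iff_eq_0 [OF g complex_vector.subspace_span]
  proof (intro ballI impI)
    fix u assume u: "u \<in> cspan D" "g u = 0"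
    have "cspan D \<subseteq> X"
      using B'(2) by (intro complex_vector.span_minimal X) (auto simp: D_def)
    then have "u \<in> cspan K" using u K(3) by auto
    then obtain c where c: "u = (\<Sum>e\<in>K. c e *\<^sub>C e)" using span_finite_sum fin by metis
    obtain a where a: "u = (\<Sum>e\<in>D. a e *\<^sub>C e)" using span_finite_sum [OF fin(1) u(1)] by metis
    have "(\<Sum>e\<in>K. (if e \<in> K then - c e else a e) *\<^sub>C e) = - u"
      unfolding c by (simp add: sum_negf)
    moreover have "(\<Sum>e\<in>D. (if e \<in> K then - c e else a e) *\<^sub>C e) = u"
      unfolding a by (intro sum.cong) (auto simp: D_def)
    moreover have "B' = K \<union> D" "K \<inter> D = {}" using B'(1) by (auto simp: D_def)
    ultimately have "(\<Sum>e\<in>B'. (if e \<in> K then - c e else a e) *\<^sub>C e) = 0"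
      using fin by (simp add: sum.union_disjoint)
    then have "a e = 0" if "e \<in> D" for e
      using complex_vector.independentD [OF B'(3) fB order_refl, of "\<lambda>e. if e \<in> K then - c e else a e" e] that
      by (auto simp: D_def)
    then show "u = 0" unfolding a by simp
  qed
  then have inj: "inj_on g (cspan D)" .
  have indD: "cindependent D"
    unfolding D_def by (rule complex_vector.independent_mono [OF B'(3) Diff_subset])
  have "cindependent (g ` D)"
    using cpair.linear_independent_injective_image [OF g indD inj] .
  moreover have "g ` D \<subseteq> cspan C" using B'(2) C(2) by (auto simp: D_def)
  ultimately have "card (g ` D) \<le> card C"
    using complex_vector.independent_span_bound [OF C(1)] by blast
  moreover have "card (g ` D) = card D"
    using inj_on_subset [OF inj complex_vector.span_superset] by (rule card_image)
  moreover have "card B' = card K + card D"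
    using fB B'(1) by (simp add: D_def card_Diff_subset finite_subset card_mono)
  moreover have "complex_vector.dim X = card B'"
    using complex_vector.basis_card_eq_dim [OF B'(2,4,3)] by simp
  ultimately show ?thesis using K(4) by simp
qed

section \<open>Hermitian forms and dissipative operators\<close>

locale hermitian_form =
  fixes b :: "'a::complex_vector \<Rightarrow> 'a \<Rightarrow> complex"
  assumes b_commute: "b u v = cnj (b v u)"
    and b_add_right: "b u (v + w) = b u v + b u w"
    and b_scale_right: "b u (c *\<^sub>C v) = c * b u v"
begin

lemma b_add_left: "b (u + v) w = b u w + b v w"
  by (metis b_commute b_add_right complex_cnj_add)

lemma b_scale_left: "b (c *\<^sub>C u) v = cnj c * b u v"
  by (metis b_commute b_scale_right complex_cnj_mult)

lemma b_zero_right [simp]: "b u 0 = 0"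
  using b_scale_right [of u 0 0] by simp

lemma b_zero_left [simp]: "b 0 u = 0"
  using b_scale_left [of 0 0 u] by simp

lemma b_diff_right: "b u (v - w) = b u v - b u w"
  using b_add_right [of u "v - w" w] by simp

lemma b_diff_left: "b (u - v) w = b u w - b v w"
  using b_add_left [of "u - v" v w] by simp

lemma b_sum_right: "b u (\<Sum>i\<in>I. f i) = (\<Sum>i\<in>I. b u (f i))"
  by (induction I rule: infinite_finite_induct) (auto simp: b_add_right)

lemma b_sum_left: "b (\<Sum>i\<in>I. f i) u = (\<Sum>i\<in>I. b (f i) u)"
  by (induction I rule: infinite_finite_induct) (auto simp: b_add_left)

lemmas b_simps = b_add_left b_add_right b_diff_left b_diff_right b_scale_left b_scale_right

lemma b_self_real: "b u u = complex_of_real (Re (b u u))"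
  using b_commute [of u u] by (simp add: complex_eq_iff)

lemma b_eq_0_commute: "b u v = 0 \<Longrightarrow> b v u = 0"
  using b_commute [of v u] by simp

lemma subspace_orthogonal: "csubspace {u. b v u = 0}"
  by (rule complex_vector.subspaceI) (auto simp: b_simps)

lemma orthogonal_span:
  assumes "\<And>e. e \<in> E \<Longrightarrow> b u e = 0" "x \<in> cspan E"
  shows "b u x = 0"
  using complex_vector.span_minimal [OF _ subspace_orthogonal, of E u] assms by blast

lemma quadratic_nonneg_imp_linear_0:
  fixes p q :: real
  assumes "\<And>t. 0 \<le> t * p + t\<^sup>2 * q"
  shows "p = 0"
proof (rule ccontr)
  assume p: "p \<noteq> 0"
  \<comment> \<open>As \<open>a\<close> exceeds \<open>\<bar>q\<bar>\<close>, at
    \<open>t = - p / a\<close> the negative linear term beats the quadratic one whatever the sign of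
    \<open>q\<close>.\<close>
  define a where "a = \<bar>q\<bar> + 1"
  have a: "a > 0" "\<bar>q\<bar> < a" by (auto simp: a_def)
  define t where "t = - p / a"
  have "t * p + t\<^sup>2 * q \<le> t * p + t\<^sup>2 * \<bar>q\<bar>" by (simp add: mult_left_mono)
  also have "\<dots> = (p\<^sup>2 / a) * (\<bar>q\<bar> / a - 1)"
    by (simp add: t_def power2_eq_square right_diff_distrib)
  also have "\<dots> < 0"
    using p a by (intro mult_pos_neg) (auto simp: field_simps)
  finally show False using assms [of t] by simp
qed

text \<open>The form \<open>Im (b u (f u))\<close> is positive semidefinite, so its null vectors lie in its radical
  (the Cauchy--Schwarz argument).\<close>

lemma dissipative_null_vector:
  assumes f: "clinear f" and X: "csubspace X" and psd: "\<And>u. u \<in> X \<Longrightarrow> 0 \<le> Im (b u (f u))"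
    and u: "u \<in> X" "Im (b u (f u)) = 0" and v: "v \<in> X"
  shows "b v (f u) = b (f v) u"
proof -
  define d where "d = b v (f u) - b (f v) u"
  have "Im (cnj c * d) = 0" for c
  proof (rule quadratic_nonneg_imp_linear_0)
    fix t :: real
    let ?w = "u + (complex_of_real t * c) *\<^sub>C v"
    have "?w \<in> X" using X u(1) v by (intro complex_vector.subspace_add complex_vector.subspace_scale)
    from psd [OF this] have "0 \<le> Im (b ?w (f ?w))" .
    also have "b ?w (f ?w) = b u (f u) + complex_of_real t * (cnj c * b v (f u) + c * b u (f v))
        + complex_of_real (t\<^sup>2 * (cmod c)\<^sup>2) * b v (f v)"
      by (simp add: clinear_simps(1,2) [OF f] b_simps algebra_simps power2_eq_square)
         (use complex_norm_square [of c] in \<open>simp add: power2_eq_square\<close>)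
    also have "Im \<dots> = t * Im (cnj c * b v (f u) + c * b u (f v)) + t\<^sup>2 * ((cmod c)\<^sup>2 * Im (b v (f v)))"
      using u(2) by (simp add: algebra_simps)
    also have "Im (cnj c * b v (f u) + c * b u (f v)) = Im (cnj c * d)"
      using b_commute [of u "f v"] by (simp add: d_def algebra_simps)
    finally show "0 \<le> t * Im (cnj c * d) + t\<^sup>2 * ((cmod c)\<^sup>2 * Im (b v (f v)))" .
  qed
  \<comment> \<open>The scalar 1 yields the imaginary part of \<open>d\<close> and the scalar
    \<open>\<i>\<close> its real part.\<close>
  from this [of 1] this [of \<i>] have "d = 0" by (simp add: complex_eq_iff)
  then show ?thesis by (simp add: d_def)
qed

section \<open>Orthogonal systems for an indefinite form\<close>

definition orthogonal_system :: "'a set \<Rightarrow> bool" where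
  "orthogonal_system E \<longleftrightarrow> finite E \<and> (\<forall>e\<in>E. b e e \<noteq> 0) \<and> (\<forall>e\<in>E. \<forall>e'\<in>E. e \<noteq> e' \<longrightarrow> b e e' = 0)"

lemma orthogonal_system_coeff:
  assumes E: "orthogonal_system E" and e: "e \<in> E"
  shows "b e (\<Sum>x\<in>E. c x *\<^sub>C x) = c e * b e e"
proof -
  have "b e (\<Sum>x\<in>E. c x *\<^sub>C x) = (\<Sum>x\<in>E. if x = e then c e * b e e else 0)"
    unfolding b_sum_right using E e
    by (intro sum.cong refl) (auto simp: b_scale_right orthogonal_system_def)
  also have "\<dots> = c e * b e e"
    using E e by (simp add: orthogonal_system_def)
  finally show ?thesis .
qed

lemma orthogonal_system_independent:
  assumes E: "orthogonal_system E"
  shows "cindependent E"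
proof (rule complex_vector.independent_if_scalars_zero)
  show "finite E" using E by (simp add: orthogonal_system_def)
  fix c e assume "(\<Sum>x\<in>E. c x *\<^sub>C x) = 0" "e \<in> E"
  then show "c e = 0"
    using orthogonal_system_coeff [OF E, of e c] E by (simp add: orthogonal_system_def)
qed

lemma orthogonal_system_form:
  assumes E: "orthogonal_system E"
  shows "b (\<Sum>x\<in>E. c x *\<^sub>C x) (\<Sum>x\<in>E. c x *\<^sub>C x) = (\<Sum>x\<in>E. complex_of_real ((cmod (c x))\<^sup>2) * b x x)"
  unfolding b_sum_left [of _ E]
  by (intro sum.cong refl) (simp add: b_scale_left orthogonal_system_coeff [OF E] complex_norm_square mult_ac del: of_real_power)

lemma orthogonal_system_definite:
  assumes E: "orthogonal_system E" and pos: "\<And>e. e \<in> E \<Longrightarrow> 0 < s * Re (b e e)"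
    and u: "u \<in> cspan E" "u \<noteq> 0"
  shows "0 < s * Re (b u u)"
proof -
  have fin: "finite E" using E by (simp add: orthogonal_system_def)
  obtain c where c: "u = (\<Sum>x\<in>E. c x *\<^sub>C x)" by (rule span_finite_sum [OF fin u(1)])
  have eq: "s * Re (b u u) = (\<Sum>x\<in>E. (cmod (c x))\<^sup>2 * (s * Re (b x x)))"
    unfolding c orthogonal_system_form [OF E] by (simp add: sum_distrib_left mult_ac)
  have "\<exists>e\<in>E. c e \<noteq> 0"
    using u(2) c by (metis (no_types, lifting) complex_vector.scale_zero_left sum.neutral)
  then obtain e where e: "e \<in> E" "c e \<noteq> 0" by blast
  have "0 < (\<Sum>x\<in>E. (cmod (c x))\<^sup>2 * (s * Re (b x x)))"
  proof (rule sum_pos2 [OF fin e(1)])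
    show "0 < (cmod (c e))\<^sup>2 * (s * Re (b e e))" using e pos by simp
    show "0 \<le> (cmod (c x))\<^sup>2 * (s * Re (b x x))" if "x \<in> E" for x
      using pos [OF that] by (intro mult_nonneg_nonneg [OF zero_le_power2 less_imp_le])
  qed
  then show ?thesis unfolding eq .
qed

text \<open>The Gram-Schmidt coefficients make sense although \<open>b\<close> may be indefinite,
  because \<open>b e e\<close> never vanishes on the system.\<close>

lemma orthogonal_system_project:
  assumes E: "orthogonal_system E"
  obtains p where "p \<in> cspan E" "\<And>x. x \<in> cspan E \<Longrightarrow> b x (u - p) = 0"
    "\<And>x. x \<in> cspan E \<Longrightarrow> b (u - p) x = 0"
proof -
  define p where "p = (\<Sum>e\<in>E. (b e u / b e e) *\<^sub>C e)"
  have pE: "p \<in> cspan E"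
    unfolding p_def by (intro complex_vector.span_sum complex_vector.span_scale complex_vector.span_base)
  have e: "b (u - p) e = 0" if "e \<in> E" for e
  proof (rule b_eq_0_commute)
    show "b e (u - p) = 0"
      using E that orthogonal_system_coeff [OF E that, of "\<lambda>e. b e u / b e e"]
      by (simp add: b_diff_right p_def orthogonal_system_def)
  qed
  have l: "b (u - p) x = 0" if "x \<in> cspan E" for x
    using orthogonal_span [OF e that] .
  show thesis
    by (rule that [OF pE b_eq_0_commute [OF l] l])
qed

lemma orthogonal_system_insert:
  assumes E: "orthogonal_system E" and "b v v \<noteq> 0" "\<And>x. x \<in> cspan E \<Longrightarrow> b x v = 0"
  shows "orthogonal_system (insert v E)" "v \<notin> E"
proof -
  have x: "b e v = 0" "b v e = 0" if "e \<in> E" for e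
    using assms(3) [OF complex_vector.span_base [OF that]] b_eq_0_commute by auto
  then show "orthogonal_system (insert v E)"
    using E assms(2) by (auto simp: orthogonal_system_def)
  show "v \<notin> E" using x assms(2) by auto
qed

lemma maximal_orthogonal_system:
  assumes X: "finite B" "X \<subseteq> cspan B"
    and Q: "\<And>E. Q E \<Longrightarrow> orthogonal_system E \<and> E \<subseteq> X" and Q0: "Q {}"
  obtains E where "Q E" "\<And>E'. Q E' \<Longrightarrow> card E' \<le> card E"
proof -
  have "card E < Suc (complex_vector.dim X)" if "Q E" for E
    using independent_le_dim(2) [OF orthogonal_system_independent _ X] Q [OF that] by (simp add: less_Suc_eq_le)
  then show thesis
    using ex_has_greatest_nat [of Q "{}" card] Q0 that by metis
qed

text \<open>In the orthogonal complement of a maximal system every vector is isotropic, so by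
  polarization \<open>b\<close> vanishes there identically. The complement then lies in the radical
  of \<open>b\<close> on \<open>X\<close>, which is trivial.\<close>

theorem orthogonal_basis:
  assumes X: "csubspace X" "finite B" "X \<subseteq> cspan B"
    and nondeg: "\<And>u. u \<in> X \<Longrightarrow> (\<And>v. v \<in> X \<Longrightarrow> b v u = 0) \<Longrightarrow> u = 0"
  obtains E where "orthogonal_system E" "cspan E = X"
proof -
  obtain E where E: "orthogonal_system E \<and> E \<subseteq> X"
    and max: "\<And>E'. orthogonal_system E' \<and> E' \<subseteq> X \<Longrightarrow> card E' \<le> card E"
    by (rule maximal_orthogonal_system [OF X(2,3), of "\<lambda>E. orthogonal_system E \<and> E \<subseteq> X"])
       (auto simp: orthogonal_system_def)
  have os: "orthogonal_system E" and EX: "E \<subseteq> X" using E by auto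
  have span: "cspan E \<subseteq> X"
    by (rule complex_vector.span_minimal [OF EX X(1)])
  define Y where "Y = {y \<in> X. \<forall>x\<in>cspan E. b x y = 0}"
  have Y: "csubspace Y"
    unfolding Y_def
    by (rule complex_vector.subspaceI)
       (auto simp: b_simps complex_vector.subspace_0 [OF X(1)] complex_vector.subspace_add [OF X(1)] complex_vector.subspace_scale [OF X(1)])
  have iso: "b y y = 0" if "y \<in> Y" for y
  proof (rule ccontr)
    assume "b y y \<noteq> 0"
    then have "orthogonal_system (insert y E)" "y \<notin> E"
      using orthogonal_system_insert [OF os, of y] that by (auto simp: Y_def)
    then show False
      using max [of "insert y E"] that EX os by (auto simp: Y_def orthogonal_system_def)
  qed
  \<comment> \<open>Polarization: the vector \<open>x + y\<close> gives the sum of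
    \<open>b x y\<close> and \<open>b y x\<close>, and \<open>x + \<i> *\<^sub>C y\<close> gives
    their difference.\<close>
  have YY: "b x y = 0" if "x \<in> Y" "y \<in> Y" for x y
  proof -
    have 1: "b x y + b y x = 0"
      using iso [of "x + y"] iso [of x] iso [of y] that complex_vector.subspace_add [OF Y] by (simp add: b_simps add_ac)
    have 2: "b x y - b y x = 0"
      using iso [of "x + \<i> *\<^sub>C y"] iso [of x] iso [of y] that
        complex_vector.subspace_add [OF Y] complex_vector.subspace_scale [OF Y]
      by (simp add: b_simps algebra_simps)
    from 1 2 show ?thesis by algebra
  qed
  have "X \<subseteq> cspan E"
  proof
    fix u assume u: "u \<in> X"
    obtain p where p: "p \<in> cspan E" "\<And>x. x \<in> cspan E \<Longrightarrow> b x (u - p) = 0"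
      by (rule orthogonal_system_project [OF os, of u]) blast
    have YI: "v - q \<in> Y" if "v \<in> X" "q \<in> cspan E" "\<And>x. x \<in> cspan E \<Longrightarrow> b x (v - q) = 0" for v q
      unfolding Y_def using that span X(1) by (auto intro: complex_vector.subspace_diff)
    have upY: "u - p \<in> Y" by (rule YI [OF u p])
    have "u - p = 0"
    proof (rule nondeg)
      show "u - p \<in> X" using upY by (simp add: Y_def)
      fix v assume v: "v \<in> X"
      obtain q where q: "q \<in> cspan E" "\<And>x. x \<in> cspan E \<Longrightarrow> b x (v - q) = 0"
        by (rule orthogonal_system_project [OF os, of v]) blast
      have "b (v - q) (u - p) = 0" by (rule YY [OF YI [OF v q] upY])
      moreover have "b q (u - p) = 0" using p(2) q(1) by blast
      ultimately show "b v (u - p) = 0" by (simp add: b_diff_left)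
    qed
    then show "u \<in> cspan E" using p(1) by simp
  qed
  with span os show thesis by (intro that) auto
qed

text \<open>An orthogonal system with invariant span is extended by one vector \<open>u\<close> with
  \<open>f u \<in> \<sigma> u + span E\<close>; then \<open>b u (f u) = \<sigma> b u u\<close>, so the sign of \<open>b u u\<close> is that of \<open>Im \<sigma>\<close>.\<close>

theorem dissipative_definite:
  fixes s :: real
  assumes f: "clinear f" and X: "csubspace X" "\<And>u. u \<in> X \<Longrightarrow> f u \<in> X"
    and B: "finite B" "X \<subseteq> cspan B"
    and Z: "\<And>\<sigma>. \<sigma> \<in> Z \<Longrightarrow> 0 < s * Im \<sigma>"
    and Y_def: "Y = cspan (\<Union>\<sigma>\<in>Z. gen f \<sigma> \<inter> X)"
    and diss: "\<And>u. u \<in> Y \<Longrightarrow> u \<noteq> 0 \<Longrightarrow> 0 < Im (b u (f u))"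
    and u: "u \<in> Y" "u \<noteq> 0"
  shows "0 < s * Re (b u u)"
proof -
  have Y: "csubspace Y" unfolding Y_def by simp
  have YX: "Y \<subseteq> X" unfolding Y_def by (intro complex_vector.span_minimal X) blast
  define Q where "Q E \<longleftrightarrow> orthogonal_system E \<and> E \<subseteq> Y \<and> (\<forall>e\<in>E. 0 < s * Re (b e e)) \<and>
    (\<forall>e\<in>E. f e \<in> cspan E)" for E
  have Q0: "Q {}" by (simp add: Q_def orthogonal_system_def)
  obtain E where E: "Q E" and max: "\<And>E'. Q E' \<Longrightarrow> card E' \<le> card E"
    by (rule maximal_orthogonal_system [of B Y Q]) (use B YX Q0 in \<open>auto simp: Q_def\<close>)
  have os: "orthogonal_system E" and EY: "E \<subseteq> Y" using E by (auto simp: Q_def)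
  have span_Y: "cspan E \<subseteq> Y" by (rule complex_vector.span_minimal [OF EY Y])
  have inv: "f x \<in> cspan E" if "x \<in> cspan E" for x
  proof -
    have "f ` cspan E = cspan (f ` E)"
      using cpair.linear_span_image [OF f] by simp
    also have "\<dots> \<subseteq> cspan E"
      using E by (intro complex_vector.span_minimal) (auto simp: Q_def)
    finally show ?thesis using that by blast
  qed
  have sub: "gen f \<sigma> \<inter> X \<subseteq> cspan E" if \<sigma>: "\<sigma> \<in> Z" for \<sigma>
  proof (rule ccontr)
    assume "\<not> gen f \<sigma> \<inter> X \<subseteq> cspan E"
    then obtain g where g: "g \<in> gen f \<sigma>" "g \<in> X" "g \<notin> cspan E" by blast
    define k where "k = (LEAST k. (shift f \<sigma> ^^ k) g \<in> cspan E)"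
    obtain n where "(shift f \<sigma> ^^ n) g = 0" using g(1) by (auto simp: gen_def)
    then have "(shift f \<sigma> ^^ n) g \<in> cspan E" by (simp only: complex_vector.span_zero)
    then have k: "(shift f \<sigma> ^^ k) g \<in> cspan E"
      unfolding k_def by (rule LeastI)
    have "k \<noteq> 0" using k g(3) by (intro notI) simp
    then obtain j where j: "k = Suc j" using not0_implies_Suc by blast
    \<comment> \<open>The last iterate of \<open>g\<close> outside \<open>cspan E\<close>, so that
      \<open>shift f \<sigma> u0\<close> is already inside.\<close>
    define u0 where "u0 = (shift f \<sigma> ^^ j) g"
    have u0: "u0 \<notin> cspan E"
      unfolding u0_def using not_less_Least [of j "\<lambda>k. (shift f \<sigma> ^^ k) g \<in> cspan E"] j
      unfolding k_def by simp
    have su0: "shift f \<sigma> u0 \<in> cspan E"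
      using k unfolding j u0_def by simp
    have "u0 \<in> gen f \<sigma> \<inter> X"
      unfolding u0_def using gen_shift_funpow [OF f g(1)] shift_funpow_in_subspace [where f = f, OF X g(2)] by blast
    then have u0Y: "u0 \<in> Y" unfolding Y_def using \<sigma> by (intro complex_vector.span_base) blast
    obtain p where p: "p \<in> cspan E" "\<And>x. x \<in> cspan E \<Longrightarrow> b x (u0 - p) = 0"
      "\<And>x. x \<in> cspan E \<Longrightarrow> b (u0 - p) x = 0"
      by (rule orthogonal_system_project [OF os, of u0]) blast
    define v where "v = u0 - p"
    have "f v - \<sigma> *\<^sub>C v = (f u0 - \<sigma> *\<^sub>C u0) - (f p - \<sigma> *\<^sub>C p)"
      by (simp add: v_def clinear_simps(3) [OF f] complex_vector.scale_right_diff_distrib)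
    also have "\<dots> \<in> cspan E"
      by (rule complex_vector.span_diff [OF su0]) (intro complex_vector.span_diff complex_vector.span_scale p(1) inv)
    finally have sv: "f v - \<sigma> *\<^sub>C v \<in> cspan E" .
    have vY: "v \<in> Y" unfolding v_def using u0Y p(1) span_Y by (intro complex_vector.subspace_diff Y) auto
    have v0: "v \<noteq> 0" using u0 p(1) by (auto simp: v_def)
    have "b v (f v) = b v (f v - \<sigma> *\<^sub>C v) + \<sigma> * b v v"
      by (simp add: b_simps)
    also have "b v (f v - \<sigma> *\<^sub>C v) = 0" using p(3) sv unfolding v_def by blast
    finally have "b v (f v) = \<sigma> * complex_of_real (Re (b v v))" using b_self_real [of v] by simp
    then have "0 < Im \<sigma> * Re (b v v)"
      using diss [OF vY v0] by simp
    then have pos: "0 < s * Re (b v v)"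
      using Z [OF \<sigma>] by (auto simp: zero_less_mult_iff)
    then have "b v v \<noteq> 0" by auto
    then have ins: "orthogonal_system (insert v E)" "v \<notin> E"
      using orthogonal_system_insert [OF os, of v] p(2) by (auto simp: v_def)
    have "f v \<in> cspan (insert v E)"
    proof -
      have "f v = (f v - \<sigma> *\<^sub>C v) + \<sigma> *\<^sub>C v" by simp
      also have "\<dots> \<in> cspan (insert v E)"
        by (intro complex_vector.span_add complex_vector.span_scale complex_vector.span_base insertI1
            subsetD [OF complex_vector.span_mono [OF subset_insertI] sv])
      finally show ?thesis .
    qed
    moreover have "f e \<in> cspan (insert v E)" if "e \<in> E" for e
      using inv [OF complex_vector.span_base [OF that]]
      by (rule subsetD [OF complex_vector.span_mono [OF subset_insertI]])
    ultimately have "Q (insert v E)"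
      using ins(1) E pos vY unfolding Q_def by blast
    from max [OF this] ins os show False by (simp add: orthogonal_system_def)
  qed
  have "Y \<subseteq> cspan E"
    unfolding Y_def
    by (intro complex_vector.span_minimal complex_vector.subspace_span UN_least sub)
  then have uE: "u \<in> cspan E" using u(1) by blast
  have "0 < s * Re (b e e)" if "e \<in> E" for e using E that by (simp add: Q_def)
  then show ?thesis by (rule orthogonal_system_definite [OF os _ uE u(2)])
qed

text \<open>A maximal invariant isotropic subspace \<open>C\<close> has invariant orthogonal complement, which the
  nilpotent operator maps into \<open>C\<close>.\<close>

theorem dissipative_isotropic:
  assumes W: "clinear W" and X: "csubspace X" "\<And>u. u \<in> X \<Longrightarrow> W u \<in> X"
    and B: "finite B" "X \<subseteq> cspan B"
    and nil: "\<And>u. u \<in> X \<Longrightarrow> (W ^^ n) u = 0"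
    and diss: "\<And>u. u \<in> X \<Longrightarrow> 0 \<le> Im (b u (W u))"
  obtains C where "finite C" "cindependent C" "C \<subseteq> X"
    "\<And>u. u \<in> cspan C \<Longrightarrow> b u u = 0"
    "complex_vector.dim X \<le> 2 * card C + complex_vector.dim {u \<in> X. W u = 0}"
proof -
  define Q where "Q C \<longleftrightarrow> cindependent C \<and> C \<subseteq> X \<and>
    (\<forall>u\<in>cspan C. \<forall>v\<in>cspan C. b u v = 0) \<and>
    (\<forall>u\<in>cspan C. W u \<in> cspan C)" for C
  have "card C < Suc (complex_vector.dim X)" if "Q C" for C
    using independent_le_dim(2) [OF _ _ B] that by (simp add: less_Suc_eq_le Q_def)
  moreover have "Q {}"
    by (simp add: Q_def clinear_simps(5) [OF W] complex_vector.independent_empty)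
  ultimately obtain C where C: "Q C" and max: "\<And>C'. Q C' \<Longrightarrow> card C' \<le> card C"
    using ex_has_greatest_nat [of Q "{}" card] by metis
  have ind: "cindependent C" and CX: "C \<subseteq> X"
    and iso: "\<And>u v. u \<in> cspan C \<Longrightarrow> v \<in> cspan C \<Longrightarrow> b u v = 0"
    and inv: "\<And>u. u \<in> cspan C \<Longrightarrow> W u \<in> cspan C"
    using C by (auto simp: Q_def)
  have fin: "finite C" by (rule independent_le_dim(1) [OF ind CX B])
  have RX: "cspan C \<subseteq> X" by (rule complex_vector.span_minimal [OF CX X(1)])
  define Y where "Y = {y \<in> X. \<forall>x\<in>cspan C. b x y = 0}"
  have Y: "csubspace Y"
    unfolding Y_def
    by (rule complex_vector.subspaceI)
       (auto simp: b_simps complex_vector.subspace_0 [OF X(1)] complex_vector.subspace_add [OF X(1)] complex_vector.subspace_scale [OF X(1)])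
  have YX: "Y \<subseteq> X" by (auto simp: Y_def)
  have RY: "cspan C \<subseteq> Y" using RX iso by (auto simp: Y_def)
  have WY: "W y \<in> Y" if y: "y \<in> Y" for y
  proof -
    have "b x (W y) = 0" if x: "x \<in> cspan C" for x
    proof (rule b_eq_0_commute)
      \<comment> \<open>So \<open>x\<close> is a null vector of the semidefinite form
        \<open>Im b(u, W u)\<close>, and \<open>W\<close> may be moved across \<open>b\<close> as if
        it were symmetric.\<close>
      have "b x (W x) = 0" using x inv iso by blast
      then have "b y (W x) = b (W y) x"
        using x RX y YX by (intro dissipative_null_vector [OF W X(1) diss]) auto
      moreover have "b (W x) y = 0" using y inv [OF x] by (auto simp: Y_def)
      then have "b y (W x) = 0" by (rule b_eq_0_commute)
      ultimately show "b (W y) x = 0" by simp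
    qed
    then show ?thesis using X(2) y by (auto simp: Y_def)
  qed
  have W_in: "W y \<in> cspan C" if y: "y \<in> Y" for y
  proof (rule ccontr)
    assume no: "W y \<notin> cspan C"
    have "(W ^^ n) (W y) = 0" using y WY YX nil by blast
    then have "(W ^^ n) (W y) \<in> cspan C" by (simp only: complex_vector.span_zero)
    moreover define k where "k = (LEAST k. (W ^^ k) (W y) \<in> cspan C)"
    ultimately have k: "(W ^^ k) (W y) \<in> cspan C"
      unfolding k_def by (intro LeastI)
    have "k \<noteq> 0" using k no by (intro notI) simp
    then obtain j where j: "k = Suc j" using not0_implies_Suc by blast
    \<comment> \<open>\<open>u = W w\<close> is the last iterate outside \<open>cspan C\<close>.
      That it is an image of a vector \<open>w\<close> of \<open>Y\<close> makes it isotropic: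
      \<open>b u u = b w (W u) = 0\<close>. Hence \<open>C\<close> could be enlarged by
      \<open>u\<close>.\<close>
    define w where "w = (W ^^ j) y"
    define u where "u = W w"
    have wY: "w \<in> Y" unfolding w_def using y WY by (induction j) auto
    then have uY: "u \<in> Y" unfolding u_def by (rule WY)
    have u_eq: "u = (W ^^ j) (W y)" by (simp add: u_def w_def funpow_swap1)
    have u: "u \<notin> cspan C"
      unfolding u_eq using not_less_Least [of j "\<lambda>k. (W ^^ k) (W y) \<in> cspan C"] j
      unfolding k_def by simp
    have Wu: "W u \<in> cspan C" using k unfolding j u_eq by simp
    have 0: "b u (W u) = 0"
      by (rule b_eq_0_commute) (use uY Wu in \<open>auto simp: Y_def\<close>)
    have "b w (W u) = b (W w) u"
      using 0 uY wY YX by (intro dissipative_null_vector [OF W X(1) diss]) auto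
    moreover have "b w (W u) = 0"
      by (rule b_eq_0_commute) (use wY Wu in \<open>auto simp: Y_def\<close>)
    ultimately have uu: "b u u = 0" by (simp add: u_def)
    have ux: "b x u = 0" "b u x = 0" if "x \<in> cspan C" for x
      using uY that b_eq_0_commute by (auto simp: Y_def)
    have "Q (insert u C)"
      unfolding Q_def
    proof (intro conjI ballI)
      show "cindependent (insert u C)"
        using u ind by (rule complex_vector.independent_insertI)
      show "insert u C \<subseteq> X" using CX uY YX by auto
      fix x assume "x \<in> cspan (insert u C)"
      then obtain c where c: "x - c *\<^sub>C u \<in> cspan C"
        by (auto simp: complex_vector.span_breakdown_eq)
      have x_eq: "x = (x - c *\<^sub>C u) + c *\<^sub>C u" by simp
      have "W x = W (x - c *\<^sub>C u) + c *\<^sub>C W u"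
        by (simp add: clinear_simps(2,3) [OF W])
      also have "\<dots> \<in> cspan C"
        using c Wu inv by (intro complex_vector.span_add complex_vector.span_scale) auto
      finally show "W x \<in> cspan (insert u C)"
        using complex_vector.span_mono [of C "insert u C"] by auto
      fix z assume "z \<in> cspan (insert u C)"
      then obtain d where d: "z - d *\<^sub>C u \<in> cspan C"
        by (auto simp: complex_vector.span_breakdown_eq)
      have "b x z = b (x - c *\<^sub>C u) (z - d *\<^sub>C u) + d * b (x - c *\<^sub>C u) u + cnj c * b u (z - d *\<^sub>C u) + cnj c * d * b u u"
        by (simp add: b_simps algebra_simps)
      then show "b x z = 0"
        using iso [OF c d] ux(1) [OF c] ux(2) [OF d] uu by simp
    qed
    from max [OF this] show False
      using fin u complex_vector.span_base [of u C] by (cases "u \<in> C") auto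
  qed
  have BY: "Y \<subseteq> cspan B" using YX B(2) by auto
  \<comment> \<open>A linear map into \<open>cspan C\<close> whose kernel in \<open>X\<close> is
    \<open>Y\<close>, so \<open>Y\<close> has codimension at most \<open>card C\<close>. Since
    \<open>W\<close> maps \<open>Y\<close> into \<open>cspan C\<close>, its kernel in
    \<open>Y\<close> costs at most another \<open>card C\<close>.\<close>
  define g where "g u = (\<Sum>e\<in>C. b e u *\<^sub>C e)" for u
  have g: "clinear g"
    unfolding g_def
    by (intro clinear_sum) (simp add: clinear_iff b_simps scaleC_add_left scaleC_scaleC)
  have ker: "{u \<in> X. g u = 0} = Y"
  proof (intro equalityI subsetI)
    fix u assume u: "u \<in> {u \<in> X. g u = 0}"
    then have "b e u = 0" if "e \<in> C" for e
      using complex_vector.independentD [OF ind fin order_refl, of "\<lambda>e. b e u" e] that by (simp add: g_def)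
    then have "b u e = 0" if "e \<in> C" for e using that b_eq_0_commute by blast
    then have "b u x = 0" if "x \<in> cspan C" for x using orthogonal_span that by blast
    then show "u \<in> Y" using u b_eq_0_commute by (auto simp: Y_def)
  next
    fix u assume "u \<in> Y"
    then show "u \<in> {u \<in> X. g u = 0}"
      using complex_vector.span_base [of _ C] by (auto simp: Y_def g_def)
  qed
  have gC: "g u \<in> cspan C" for u
    unfolding g_def by (intro complex_vector.span_sum complex_vector.span_scale complex_vector.span_base)
  have "complex_vector.dim X \<le> complex_vector.dim Y + card C"
    using dim_le_kernel_plus_image [OF g X(1) B fin gC] unfolding ker .
  also have "complex_vector.dim Y \<le> complex_vector.dim {u \<in> Y. W u = 0} + card C"
    using dim_le_kernel_plus_image [OF W Y B(1) BY fin W_in] .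
  also have "complex_vector.dim {u \<in> Y. W u = 0} \<le> complex_vector.dim {u \<in> X. W u = 0}"
  proof -
    obtain K where K: "K \<subseteq> {u \<in> Y. W u = 0}" "cindependent K"
      "{u \<in> Y. W u = 0} \<subseteq> cspan K" "card K = complex_vector.dim {u \<in> Y. W u = 0}"
      by (rule complex_vector.basis_exists)
    have kB: "{u \<in> X. W u = 0} \<subseteq> cspan B" using B(2) by auto
    have "K \<subseteq> {u \<in> X. W u = 0}" using K(1) YX by auto
    from independent_le_dim(2) [OF K(2) this B(1) kB] K(4) show ?thesis by simp
  qed
  finally have "complex_vector.dim X \<le> 2 * card C + complex_vector.dim {u \<in> X. W u = 0}" by simp
  then show thesis using fin ind CX iso by (intro that [of C]) auto
qed

end

section \<open>Stability of the Riesz subspace under perturbation\<close>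

definition riesz_space :: "('k::chilbert_space \<Rightarrow>\<^sub>L 'k) \<Rightarrow> 'k set" where
  "riesz_space P = {u. P u = u}"

context riesz_decomposition
begin

lemma subspace_riesz_space: "csubspace (riesz_space P)"
  by (rule complex_vector.subspaceI)
     (auto simp: riesz_space_def blinfun.add_right clinear_simps(2) [OF P_lin])

lemma riesz_space_in_span: "riesz_space P \<subseteq> cspan E"
proof
  fix u assume "u \<in> riesz_space P"
  then show "u \<in> cspan E" using P_in_span [of u] by (simp add: riesz_space_def)
qed

lemma riesz_space_P: "P u \<in> riesz_space P"
  by (simp add: riesz_space_def P_idem)

lemma riesz_space_A: "u \<in> riesz_space P \<Longrightarrow> A u \<in> riesz_space P"
  by (simp add: riesz_space_def P_commute)

lemma riesz_space_W: "u \<in> riesz_space P \<Longrightarrow> W u \<in> riesz_space P"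
  by (simp add: riesz_space_def W_P [symmetric])

end

text \<open>\<open>L\<close> sends the Riesz space into the kernel of \<open>P\<close> and is
  extended by \<open>L = L P\<close>. The vectors \<open>P u + L u\<close> form its graph, and the
  last assumption says that \<open>A'\<close> maps this graph into itself.\<close>

locale riesz_perturbation = riesz_decomposition +
  fixes A' L :: "'a \<Rightarrow>\<^sub>L 'a"
  assumes A'_lin: "clinear (blinfun_apply A')"
    and L_lin: "clinear (blinfun_apply L)"
    and L_P: "L (P u) = L u"
    and P_L: "P (L u) = 0"
    and graph_invariant: "A' (P u + L u) = P (A' (P u + L u)) + L (A' (P u + L u))"
begin

definition X' :: "'a set" where "X' = {u. u = P u + L u}"

lemma X'_iff: "u \<in> X' \<longleftrightarrow> u = P u + L u"
  by (simp add: X'_def)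

lemma L_L: "L (L u) = 0"
  using L_P [of "L u"] by (simp add: P_L)

lemma X'_I: "P u + L u \<in> X'"
  by (simp add: X'_iff blinfun.add_right P_idem P_L L_P L_L)

lemma subspace_X': "csubspace X'"
  by (rule complex_vector.subspaceI)
     (simp_all add: X'_iff blinfun.add_right clinear_simps(2) [OF P_lin] clinear_simps(2) [OF L_lin] scaleC_add_right [symmetric] algebra_simps)

lemma A'_X': "u \<in> X' \<Longrightarrow> A' u \<in> X'"
  using graph_invariant [of u] by (simp add: X'_iff)

lemma X'_eq_image: "X' = (\<lambda>u. u + L u) ` riesz_space P"
proof (intro equalityI subsetI)
  fix u assume "u \<in> X'"
  then have "u = P u + L (P u)" by (simp add: X'_iff L_P)
  then show "u \<in> (\<lambda>u. u + L u) ` riesz_space P"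
    using riesz_space_P by (rule image_eqI)
next
  fix u assume "u \<in> (\<lambda>u. u + L u) ` riesz_space P"
  then show "u \<in> X'" using X'_I by (auto simp: riesz_space_def) metis
qed

lemma graph_map_lin: "clinear (\<lambda>u. u + L u)"
  by (intro clinear_add clinear_ident L_lin)

lemma graph_map_inj: "inj_on (\<lambda>u. u + L u) (riesz_space P)"
proof (rule inj_onI)
  fix u v assume uv: "u \<in> riesz_space P" "v \<in> riesz_space P" "u + L u = v + L v"
  then have "P (u + L u) = P (v + L v)" by simp
  then show "u = v" using uv(1,2) by (simp add: blinfun.add_right P_L riesz_space_def)
qed

lemma independent_graph_image:
  assumes "cindependent B" "B \<subseteq> riesz_space P"
  shows "cindependent ((\<lambda>u. u + L u) ` B)" "card ((\<lambda>u. u + L u) ` B) = card B"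
proof -
  have "cspan B \<subseteq> riesz_space P"
    by (rule complex_vector.span_minimal [OF assms(2) subspace_riesz_space])
  then have "inj_on (\<lambda>u. u + L u) (cspan B)" by (rule inj_on_subset [OF graph_map_inj])
  then show "cindependent ((\<lambda>u. u + L u) ` B)"
    by (rule cpair.linear_independent_injective_image [OF graph_map_lin assms(1)])
  show "card ((\<lambda>u. u + L u) ` B) = card B"
    by (rule card_image [OF inj_on_subset [OF graph_map_inj assms(2)]])
qed

lemma X'_finite_dim:
  obtains B' where "finite B'" "X' \<subseteq> cspan B'"
    "complex_vector.dim X' = complex_vector.dim (riesz_space P)"
proof -
  obtain B where B: "B \<subseteq> riesz_space P" "cindependent B"
    "riesz_space P \<subseteq> cspan B" "card B = complex_vector.dim (riesz_space P)"
    by (rule complex_vector.basis_exists)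
  have fin: "finite B" by (rule independent_le_dim(1) [OF B(2,1) E_finite riesz_space_in_span])
  let ?B = "(\<lambda>u. u + L u) ` B"
  have span: "X' \<subseteq> cspan ?B"
    unfolding X'_eq_image using cpair.linear_spans_image [OF graph_map_lin B(3)] .
  have sub: "?B \<subseteq> X'" unfolding X'_eq_image using B(1) by blast
  have "card ?B = complex_vector.dim X'"
    by (rule complex_vector.basis_card_eq_dim [OF sub span independent_graph_image(1) [OF B(2,1)]])
  then have "complex_vector.dim X' = complex_vector.dim (riesz_space P)"
    using independent_graph_image(2) [OF B(2,1)] B(4) by simp
  with fin span show thesis by (intro that [of ?B]) auto
qed

text \<open>The part \<open>y\<close> of \<open>u\<close> off the graph has \<open>P y = 0\<close>,
  and \<open>shift A' \<tau> y\<close> lies on the graph. Its \<open>P\<close>-component comes only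
  from \<open>(A' - A) y\<close>, so all of it is small and hence \<open>W y\<close> is small
  compared with \<open>y\<close>; the spectral gap forces \<open>y = 0\<close>. The factor
  \<open>norm P + 2\<close> counts the terms \<open>P d\<close>, \<open>L d\<close> and
  \<open>d\<close>.\<close>

lemma shift_in_X'_imp:
  assumes small: "norm S * ((norm P + 2) * norm (A' - A) + cmod (\<tau> - \<sigma>)) < 1" and L1: "norm L \<le> 1"
    and u: "shift A' \<tau> u \<in> X'"
  shows "u \<in> X'"
proof -
  define y where "y = u - (P u + L u)"
  define d where "d = (A' - A) y"
  define w where "w = shift A' \<tau> y"
  have Py: "P y = 0" by (simp add: y_def blinfun.diff_right blinfun.add_right P_idem P_L)
  have "w = shift A' \<tau> u - shift A' \<tau> (P u + L u)"
    by (simp add: w_def y_def clinear_simps(3) [OF A'_lin] complex_vector.scale_right_diff_distrib)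
  also have "\<dots> \<in> X'"
    by (rule complex_vector.subspace_diff [OF subspace_X' u])
       (intro complex_vector.subspace_diff complex_vector.subspace_scale subspace_X' A'_X' X'_I)
  finally have wX: "w = P w + L w" by (simp add: X'_iff)
  have A'y: "A' y = A y + d" by (simp add: d_def blinfun.diff_left)
  have "P w = P d"
    by (simp add: w_def blinfun.diff_right clinear_simps(2) [OF P_lin] Py A'y blinfun.add_right P_commute)
  moreover have "L w = L d" using L_P [of w] L_P [of d] calculation by simp
  ultimately have w: "w = P d + L d" using wX by simp
  have "W y = w - d + (\<tau> - \<sigma>) *\<^sub>C y"
    by (simp add: w_def W_apply A'y complex_vector.scale_left_diff_distrib)
  then have "W y = P d + L d - d + (\<tau> - \<sigma>) *\<^sub>C y" by (simp add: w)
  then have "norm (W y) \<le> norm (P d) + norm (L d) + norm d + cmod (\<tau> - \<sigma>) * norm y"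
    using norm_triangle_ineq [of "P d + L d - d" "(\<tau> - \<sigma>) *\<^sub>C y"] norm_triangle_ineq4 [of "P d + L d" d]
      norm_triangle_ineq [of "P d" "L d"] by simp
  also have "norm (P d) \<le> norm P * norm d" by (rule norm_blinfun)
  also have "norm (L d) \<le> norm d"
    using norm_blinfun [of L d] L1 mult_right_mono [OF L1 norm_ge_zero [of d]] by linarith
  also have "norm P * norm d + norm d + norm d + cmod (\<tau> - \<sigma>) * norm y = (norm P + 2) * norm d + cmod (\<tau> - \<sigma>) * norm y"
    by (simp add: algebra_simps)
  also have "(norm P + 2) * norm d \<le> (norm P + 2) * (norm (A' - A) * norm y)"
    unfolding d_def by (intro mult_left_mono norm_blinfun) simp
  finally have Wy: "norm (W y) \<le> ((norm P + 2) * norm (A' - A) + cmod (\<tau> - \<sigma>)) * norm y"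
    by (simp add: algebra_simps)
  have "y = 0"
  proof (rule ccontr)
    assume y0: "y \<noteq> 0"
    have "norm y \<le> norm S * norm (W y)" by (rule norm_le_shift [OF Py])
    also have "\<dots> \<le> (norm S * ((norm P + 2) * norm (A' - A) + cmod (\<tau> - \<sigma>))) * norm y"
      using mult_left_mono [OF Wy norm_ge_zero [of S]] by (simp add: mult.assoc)
    also have "\<dots> < 1 * norm y" using small y0 by (intro mult_strict_right_mono) auto
    finally show False by simp
  qed
  then show ?thesis by (simp add: y_def X'_iff)
qed

text \<open>Guarantees that multiplicities of eigenvalues near \<open>\<sigma>\<close> can be
  computed inside the finite-dimensional \<open>X'\<close>.\<close>

lemma gen_subset_X':
  assumes small: "norm S * ((norm P + 2) * norm (A' - A) + cmod (\<tau> - \<sigma>)) < 1" and L1: "norm L \<le> 1"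
  shows "gen (blinfun_apply A') \<tau> \<subseteq> X'"
proof
  fix u assume "u \<in> gen (blinfun_apply A') \<tau>"
  then obtain k where "(shift A' \<tau> ^^ k) u = 0" by (auto simp: gen_def)
  then show "u \<in> X'"
  proof (induction k arbitrary: u)
    case 0
    then show ?case using complex_vector.subspace_0 [OF subspace_X'] by simp
  next
    case (Suc k)
    have "(shift A' \<tau> ^^ k) (shift A' \<tau> u) = 0" using Suc.prems by (simp only: funpow_Suc_right o_apply)
    then have "shift A' \<tau> u \<in> X'" by (rule Suc.IH)
    then show ?case by (rule shift_in_X'_imp [OF small L1])
  qed
qed

text \<open>With \<open>\<theta> = \<tau> - \<sigma>\<close>, the projection \<open>x\<close> of the
  eigenvector solves \<open>\<theta> x = W x + e\<close> with \<open>e\<close> small. As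
  \<open>W\<close> is nilpotent on the Riesz space, solving for \<open>x\<close> gives a sum of
  \<open>n\<close> terms, too small for \<open>x\<close> if \<open>\<theta>\<close> is not. The
  factor 2 comes from \<open>norm u \<le> 2 * norm x\<close>.\<close>

lemma eigenvalue_near:
  assumes Wb: "\<And>k u. norm ((W ^^ k) (P u)) \<le> M k * norm u" and \<eta>: "\<eta> > 0"
    and small: "(\<Sum>k<n. inverse \<eta> ^ Suc k * M k) * (2 * norm (A' - A)) < 1" and L1: "norm L \<le> 1"
    and u: "u \<in> X'" "u \<noteq> 0" "A' u = \<tau> *\<^sub>C u"
  shows "cmod (\<tau> - \<sigma>) < \<eta>"
proof (rule ccontr)
  assume "\<not> cmod (\<tau> - \<sigma>) < \<eta>"
  then have \<theta>: "cmod (\<tau> - \<sigma>) \<ge> \<eta>" by simp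
  define \<theta> where "\<theta> = \<tau> - \<sigma>"
  have \<theta>0: "\<theta> \<noteq> 0" using \<theta> \<eta> by (auto simp: \<theta>_def)
  define x where "x = P u"
  have u_eq: "u = x + L x" using u(1) by (simp add: X'_iff x_def L_P)
  have x0: "x \<noteq> 0" using u_eq u(2) by auto
  define d where "d = (A' - A) u"
  define e where "e = P d"
  have "P (A' u) = P (A u) + e" by (simp add: d_def e_def blinfun.diff_left blinfun.diff_right)
  also have "P (A u) = A x" by (simp add: P_commute x_def)
  also have "A x = W x + \<sigma> *\<^sub>C x" by (rule A_apply)
  finally have "\<tau> *\<^sub>C x = W x + \<sigma> *\<^sub>C x + e"
    by (simp add: u(3) clinear_simps(2) [OF P_lin] x_def)
  then have Wx: "\<theta> *\<^sub>C x = W x + e"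
    by (simp add: \<theta>_def complex_vector.scale_left_diff_distrib)
  have step: "(W ^^ m) x = inverse \<theta> *\<^sub>C ((W ^^ Suc m) x + (W ^^ m) e)" for m
  proof -
    note Wm = clinear_funpow [OF W_lin, of m]
    have "\<theta> *\<^sub>C (W ^^ m) x = (W ^^ m) (W x + e)"
      unfolding Wx [symmetric] by (simp add: clinear_simps(2) [OF Wm])
    also have "\<dots> = (W ^^ Suc m) x + (W ^^ m) e"
      by (simp add: clinear_simps(1) [OF Wm] funpow_swap1)
    finally show ?thesis using \<theta>0 by (metis left_inverse scaleC_one scaleC_scaleC)
  qed
  have expand: "x = (\<Sum>k<m. inverse \<theta> ^ Suc k *\<^sub>C (W ^^ k) e) + inverse \<theta> ^ m *\<^sub>C (W ^^ m) x" for m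
  proof (induction m)
    case (Suc m)
    have "inverse \<theta> ^ m *\<^sub>C (W ^^ m) x = inverse \<theta> ^ Suc m *\<^sub>C (W ^^ m) e + inverse \<theta> ^ Suc m *\<^sub>C (W ^^ Suc m) x"
      by (subst step) (simp add: scaleC_scaleC scaleC_add_right mult.commute)
    then show ?case using Suc by (simp add: algebra_simps)
  qed (simp add: scaleC_one)
  have "(W ^^ n) x = 0" unfolding x_def by (rule W_nilpotent)
  then have x_eq: "x = (\<Sum>k<n. inverse \<theta> ^ Suc k *\<^sub>C (W ^^ k) e)" using expand [of n] by simp
  have "norm u \<le> 2 * norm x"
  proof -
    have "norm (L x) \<le> norm x"
      using norm_blinfun [of L x] mult_right_mono [OF L1 norm_ge_zero [of x]] by linarith
    then show ?thesis using norm_triangle_ineq [of x "L x"] u_eq by simp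
  qed
  then have "norm (A' - A) * norm u \<le> norm (A' - A) * (2 * norm x)" by (intro mult_left_mono) auto
  then have d: "norm d \<le> 2 * norm (A' - A) * norm x"
    using norm_blinfun [of "A' - A" u] by (simp add: d_def)
  have M0: "0 \<le> M k * norm u" for k and u :: 'a using Wb [of k u] norm_ge_zero order_trans by blast
  have Mk: "0 \<le> M k" for k using M0 [of k u] u(2) by (simp add: zero_le_mult_iff)
  have "norm x \<le> (\<Sum>k<n. norm (inverse \<theta> ^ Suc k *\<^sub>C (W ^^ k) e))"
    by (subst x_eq) (rule norm_sum)
  also have "\<dots> \<le> (\<Sum>k<n. (inverse \<eta> ^ Suc k * M k) * (2 * norm (A' - A) * norm x))"
  proof (rule sum_mono)
    fix k
    have "norm ((W ^^ k) e) \<le> M k * (2 * norm (A' - A) * norm x)"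
      using Wb [of k d] mult_left_mono [OF d Mk, of k] by (simp add: e_def)
    moreover have "cmod (inverse \<theta> ^ Suc k) \<le> inverse \<eta> ^ Suc k"
      unfolding norm_power norm_inverse using \<theta> \<eta>
      by (intro power_mono) (auto simp: \<theta>_def intro: le_imp_inverse_le)
    ultimately have "cmod (inverse \<theta> ^ Suc k) * norm ((W ^^ k) e) \<le> inverse \<eta> ^ Suc k * (M k * (2 * norm (A' - A) * norm x))"
      using \<eta> by (intro mult_mono) auto
    then show "norm (inverse \<theta> ^ Suc k *\<^sub>C (W ^^ k) e) \<le> (inverse \<eta> ^ Suc k * M k) * (2 * norm (A' - A) * norm x)"
      unfolding norm_scaleC by (simp only: mult.assoc)
  qed
  also have "\<dots> = ((\<Sum>k<n. inverse \<eta> ^ Suc k * M k) * (2 * norm (A' - A))) * norm x"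
    by (simp add: sum_distrib_right mult.assoc)
  also have "\<dots> < 1 * norm x" using small x0 by (intro mult_strict_right_mono) auto
  finally show False by simp
qed

end

context riesz_decomposition
begin

lemma nilpotent_bounds:
  obtains M where "\<And>k u. norm ((W ^^ k) (P u)) \<le> M k * norm u"
proof -
  have "bounded_linear (\<lambda>u. (W ^^ k) (P u))" for k
    unfolding W_def by (intro bounded_linear_compose [OF bounded_linear_shift_funpow] blinfun.bounded_linear_right)
  then have "\<exists>K. \<forall>u. norm ((W ^^ k) (P u)) \<le> norm u * K" for k
    by (rule bounded_linear.bounded)
  then show thesis using that by (metis mult.commute)
qed

text \<open>The Riccati equation \<open>WL - LW = -(1-P)(1-L)(A'-A)(1+L)P\<close> for an invariant graph is solved
  by contraction, since \<open>f \<mapsto> \<Sum> S\<^sup>k\<^sup>+\<^sup>1 f W\<^sup>k P\<close> inverts the Sylvester operator \<open>L \<mapsto> WL - LW\<close>.\<close>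

theorem perturbation_exists:
  assumes \<eta>: "0 < \<eta>" "\<eta> \<le> 1"
  obtains \<epsilon> where "\<epsilon> > 0" "\<And>A'. clinear (blinfun_apply A') \<Longrightarrow> norm (A' - A) < \<epsilon> \<Longrightarrow>
    \<exists>L. norm L \<le> \<eta> \<and> riesz_perturbation A \<sigma> n P S E A' L"
proof -
  have "\<exists>T. \<forall>u. blinfun_apply T u = (W ^^ k) (P u)" for k
  proof -
    have "bounded_linear (\<lambda>u. (W ^^ k) (P u))"
      unfolding W_def by (intro bounded_linear_compose [OF bounded_linear_shift_funpow] blinfun.bounded_linear_right)
    then show ?thesis by (metis obtain_blinfun)
  qed
  then obtain Wb :: "nat \<Rightarrow> 'k \<Rightarrow>\<^sub>L 'k" where Wb: "\<And>k u. Wb k u = (W ^^ k) (P u)" by metis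
  have "bounded_linear ((\<lambda>u. S u) ^^ k)" for k
  proof (induction k)
    case (Suc k)
    from bounded_linear_compose [OF blinfun.bounded_linear_right Suc] show ?case by (simp add: o_def)
  qed (simp add: id_def)
  then have "\<exists>T. \<forall>u. blinfun_apply T u = (blinfun_apply S ^^ k) u" for k
    by (metis obtain_blinfun)
  then obtain Sb :: "nat \<Rightarrow> 'k \<Rightarrow>\<^sub>L 'k" where Sb: "\<And>k u. Sb k u = (blinfun_apply S ^^ k) u" by metis
  have Sb_lin: "clinear (blinfun_apply (Sb k))" for k
    unfolding Sb by (rule clinear_funpow [OF S_lin])
  have Wb_lin: "clinear (blinfun_apply (Wb k))" for k
    unfolding Wb by (rule clinear_compose [OF P_lin clinear_funpow [OF W_lin]])
  \<comment> \<open>The series of the text above, finite because \<open>W ^^ n\<close> vanishes on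
    the range of \<open>P\<close>.\<close>
  define Sy where "Sy f = (\<Sum>k<n. Sb (Suc k) o\<^sub>L (f o\<^sub>L Wb k))" for f
  have Sy_apply: "Sy f u = (\<Sum>k<n. Sb (Suc k) (f (Wb k u)))" for f u
    by (simp add: Sy_def blinfun.sum_left)
  define \<kappa> where "\<kappa> = (\<Sum>k<n. norm (Sb (Suc k)) * norm (Wb k))"
  have \<kappa>0: "\<kappa> \<ge> 0" unfolding \<kappa>_def by (intro sum_nonneg) simp
  have Sy_norm: "norm (Sy f) \<le> \<kappa> * norm f" for f
  proof -
    have "norm (Sy f) \<le> (\<Sum>k<n. norm (Sb (Suc k) o\<^sub>L (f o\<^sub>L Wb k)))"
      unfolding Sy_def by (rule norm_sum)
    also have "\<dots> \<le> (\<Sum>k<n. norm (Sb (Suc k)) * norm (Wb k) * norm f)"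
    proof (rule sum_mono)
      fix k
      have "norm (Sb (Suc k) o\<^sub>L (f o\<^sub>L Wb k)) \<le> norm (Sb (Suc k)) * norm (f o\<^sub>L Wb k)"
        by (rule norm_blinfun_compose)
      also have "\<dots> \<le> norm (Sb (Suc k)) * (norm f * norm (Wb k))"
        by (intro mult_left_mono norm_blinfun_compose norm_ge_zero)
      finally show "norm (Sb (Suc k) o\<^sub>L (f o\<^sub>L Wb k)) \<le> norm (Sb (Suc k)) * norm (Wb k) * norm f"
        by (simp add: mult_ac)
    qed
    also have "\<dots> = \<kappa> * norm f" by (simp add: \<kappa>_def sum_distrib_right)
    finally show ?thesis .
  qed
  have Sy_diff: "Sy f - Sy g = Sy (f - g)" for f g
    by (rule blinfun_eqI) (simp add: Sy_apply blinfun.diff_left blinfun.diff_right sum_subtractf)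
  have P_Sy: "P (Sy f u) = 0" for f u
    by (simp add: Sy_apply blinfun.sum_right Sb P_S)
  have Sy_P: "Sy f (P u) = Sy f u" for f u
    by (simp add: Sy_apply Wb P_idem)
  \<comment> \<open>\<open>W S = 1 - P\<close> lowers the power of \<open>S\<close>, while feeding
    in \<open>W u\<close> raises the power of \<open>W\<close>, so the difference telescopes; the
    last term dies by nilpotency.\<close>
  have Sylvester: "W (Sy f u) - Sy f (W u) = f (P u) - P (f (P u))" for f u
  proof -
    define g where "g k = Sb k (f (Wb k u)) - P (Sb k (f (Wb k u)))" for k
    have "W (Sy f u) = (\<Sum>k<n. g k)"
      by (simp add: Sy_apply clinear_simps(6) [OF W_lin] Sb W_S g_def)
    moreover have "P ((blinfun_apply S ^^ k) (S v)) = 0" for k v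
      by (simp add: funpow_swap1 [symmetric] P_S)
    then have "Sy f (W u) = (\<Sum>k<n. g (Suc k))"
      by (simp add: Sy_apply g_def Sb P_S Wb W_P [symmetric] funpow_swap1)
    ultimately have "W (Sy f u) - Sy f (W u) = (\<Sum>k<n. g k - g (Suc k))"
      by (simp add: sum_subtractf)
    also have "\<dots> = g 0 - g n" by (rule sum_lessThan_telescope')
    also have "g n = 0" by (simp add: g_def Wb W_nilpotent)
    finally show ?thesis by (simp add: g_def Sb Wb)
  qed
  \<comment> \<open>Gives \<open>\<kappa> * norm \<Delta> \<le> \<eta> / 8\<close>. Both the size of
    \<open>\<Phi> L\<close> and its Lipschitz constant are at most
    \<open>4 * \<kappa> * norm \<Delta>\<close>, hence at most \<open>\<eta> / 2\<close>.\<close>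
  define \<epsilon> where "\<epsilon> = \<eta> / (8 * (\<kappa> + 1))"
  have \<epsilon>: "\<epsilon> > 0" using \<eta> \<kappa>0 by (simp add: \<epsilon>_def)
  show thesis
  proof (rule that [OF \<epsilon>])
    fix A' assume A'_lin: "clinear (blinfun_apply A')" and close: "norm (A' - A) < \<epsilon>"
    define \<Delta> where "\<Delta> = A' - A"
    have "\<kappa> * norm \<Delta> \<le> (\<kappa> + 1) * \<epsilon>"
      using close \<kappa>0 by (intro mult_mono) (auto simp: \<Delta>_def)
    also have "\<dots> = \<eta> / 8" using \<kappa>0 by (simp add: \<epsilon>_def field_simps)
    finally have \<kappa>\<Delta>: "\<kappa> * norm \<Delta> \<le> \<eta> / 8" .
    define q where "q L = (id_blinfun - L) o\<^sub>L (\<Delta> o\<^sub>L (id_blinfun + L))" for L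
    have q_apply: "q L u = \<Delta> (u + L u) - L (\<Delta> (u + L u))" for L u
      by (simp add: q_def blinfun.diff_left blinfun.add_left)
    define \<Phi> where "\<Phi> L = - Sy (q L)" for L
    \<comment> \<open>Complex linearity is built into the complete set, as a closed condition, so
      that the fixed point inherits it.\<close>
    define D where "D = {L :: 'k \<Rightarrow>\<^sub>L 'k. norm L \<le> \<eta> \<and> (\<forall>c x. blinfun_apply L (c *\<^sub>C x) = c *\<^sub>C blinfun_apply L x)}"
    have id1: "norm (id_blinfun :: 'k \<Rightarrow>\<^sub>L 'k) \<le> 1" by (rule norm_blinfun_id_le)
    have n2: "norm (id_blinfun - L) \<le> 2" "norm (id_blinfun + L) \<le> 2" if "norm L \<le> \<eta>" for L :: "'k \<Rightarrow>\<^sub>L 'k"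
      using norm_triangle_ineq4 [of id_blinfun L] norm_triangle_ineq [of id_blinfun L] id1 that \<eta>(2) by linarith+
    have comp3: "norm (a o\<^sub>L (\<Delta> o\<^sub>L c)) \<le> norm a * (norm \<Delta> * norm c)" for a c :: "'k \<Rightarrow>\<^sub>L 'k"
      by (intro order_trans [OF norm_blinfun_compose] mult_left_mono norm_blinfun_compose norm_ge_zero)
    have "closed D"
      unfolding D_def
      by (intro closed_Collect_conj closed_Collect_le closed_Collect_all closed_Collect_eq continuous_intros)
    then have complete: "complete D" by (simp add: complete_eq_closed)
    have D0: "D \<noteq> {}" using \<eta> by (auto simp: D_def intro!: exI [of _ 0])
    have maps: "\<Phi> ` D \<subseteq> D"
    proof safe
      fix L assume L: "L \<in> D"
      then have L_lin: "clinear (blinfun_apply L)" and Ln: "norm L \<le> \<eta>" by (auto simp: D_def clinear_blinfun_iff)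
      have "norm (q L) \<le> 2 * (norm \<Delta> * 2)"
        unfolding q_def using n2 [OF Ln]
        by (intro order_trans [OF comp3] mult_mono mult_left_mono) auto
      then have "norm (\<Phi> L) \<le> \<kappa> * (2 * (norm \<Delta> * 2))"
        unfolding \<Phi>_def norm_minus_cancel using Sy_norm [of "q L"] \<kappa>0
        by (meson mult_left_mono order_trans)
      also have "\<dots> \<le> \<eta>" using \<kappa>\<Delta> \<eta> by simp
      finally have 1: "norm (\<Phi> L) \<le> \<eta>" .
      have \<Delta>_lin: "clinear (blinfun_apply \<Delta>)"
        unfolding \<Delta>_def minus_blinfun.rep_eq by (intro clinear_diff A'_lin A_lin)
      have q_lin: "clinear (blinfun_apply (q L))"
        unfolding q_apply
        by (intro clinear_diff clinear_compose [OF clinear_add [OF clinear_ident L_lin] \<Delta>_lin] clinear_compose [OF _ L_lin])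
      have "clinear (blinfun_apply (Sy (q L)))"
        unfolding Sy_apply
        by (intro clinear_sum clinear_compose [OF clinear_compose [OF Wb_lin q_lin] Sb_lin])
      then have "\<Phi> L (c *\<^sub>C x) = c *\<^sub>C \<Phi> L x" for c x
        by (simp add: \<Phi>_def blinfun.minus_left clinear_simps(2))
      with 1 show "\<Phi> L \<in> D" by (simp add: D_def)
    qed
    have contr: "dist (\<Phi> L) (\<Phi> L') \<le> 1/2 * dist L L'" if "L \<in> D" "L' \<in> D" for L L'
    proof -
      have Ln: "norm L \<le> \<eta>" "norm L' \<le> \<eta>" using that by (auto simp: D_def)
      have "q L - q L' = ((id_blinfun - L) o\<^sub>L (\<Delta> o\<^sub>L (L - L'))) - ((L - L') o\<^sub>L (\<Delta> o\<^sub>L (id_blinfun + L')))"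
        by (rule blinfun_eqI) (simp add: q_def blinfun.diff_left blinfun.add_left blinfun.diff_right blinfun.add_right)
      also have "norm \<dots> \<le> 2 * (norm \<Delta> * norm (L - L')) + norm (L - L') * (norm \<Delta> * 2)"
      proof (rule order_trans [OF norm_triangle_ineq4 add_mono])
        show "norm ((id_blinfun - L) o\<^sub>L (\<Delta> o\<^sub>L (L - L'))) \<le> 2 * (norm \<Delta> * norm (L - L'))"
          by (rule order_trans [OF comp3 mult_right_mono [OF n2(1) [OF Ln(1)]]]) simp
        show "norm ((L - L') o\<^sub>L (\<Delta> o\<^sub>L (id_blinfun + L'))) \<le> norm (L - L') * (norm \<Delta> * 2)"
          by (rule order_trans [OF comp3 mult_left_mono [OF mult_left_mono [OF n2(2) [OF Ln(2)]]]]) simp_all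
      qed
      finally have "norm (q L - q L') \<le> 4 * norm \<Delta> * norm (L - L')" by simp
      then have "\<kappa> * norm (q L - q L') \<le> \<kappa> * (4 * norm \<Delta> * norm (L - L'))"
        using \<kappa>0 by (rule mult_left_mono)
      also have "\<dots> = (4 * (\<kappa> * norm \<Delta>)) * norm (L - L')" by simp
      also have "\<dots> \<le> (1/2) * norm (L - L')"
        using \<kappa>\<Delta> \<eta> by (intro mult_right_mono) auto
      finally have *: "\<kappa> * norm (q L - q L') \<le> 1/2 * norm (L - L')" .
      have "\<Phi> L - \<Phi> L' = - Sy (q L - q L')" by (simp add: \<Phi>_def Sy_diff [symmetric])
      then have "norm (\<Phi> L - \<Phi> L') \<le> \<kappa> * norm (q L - q L')" using Sy_norm by simp
      with * show ?thesis by (simp add: dist_norm)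
    qed
    obtain L where L: "L \<in> D" "\<Phi> L = L"
      using Banach_fix [OF complete D0 _ _ maps, of "1/2"] contr by auto
    then have L_lin: "clinear (blinfun_apply L)" and Ln: "norm L \<le> \<eta>" by (auto simp: D_def clinear_blinfun_iff)
    have L_eq: "L u = - Sy (q L) u" for u using L(2) by (metis \<Phi>_def uminus_blinfun.rep_eq)
    have L_P: "L (P u) = L u" for u by (simp add: L_eq Sy_P)
    have P_L: "P (L u) = 0" for u by (simp add: L_eq blinfun.minus_right P_Sy)
    have L_L: "L (L u) = 0" for u using L_P [of "L u"] by (simp add: P_L)
    have Ric: "W (L u) - L (W u) = - (q L (P u) - P (q L (P u)))" for u
      unfolding Sylvester [of "q L" u, symmetric] by (simp add: L_eq clinear_simps(4) [OF W_lin])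
    have "riesz_perturbation A \<sigma> n P S E A' L"
    proof (intro riesz_perturbation.intro riesz_perturbation_axioms.intro riesz_decomposition_axioms A'_lin L_lin L_P P_L)
      fix u
      define x where "x = P u"
      have Lx: "L x = L u" by (simp add: x_def L_P)
      define y where "y = \<Delta> (x + L x)"
      have z: "A' (P u + L u) = W x + W (L x) + \<sigma> *\<^sub>C (x + L x) + y"
        by (simp add: y_def \<Delta>_def blinfun.diff_left Lx [symmetric] x_def [symmetric] A_apply blinfun.add_right scaleC_add_right)
      have PWx: "P (W x) = W x" by (simp add: x_def W_P [symmetric] P_idem)
      have PWL: "P (W (L x)) = 0" by (simp add: W_P [symmetric] P_L clinear_simps(5) [OF W_lin])
      have Px: "P x = x" by (simp add: x_def P_idem)
      have P_z: "P (W x + W (L x) + \<sigma> *\<^sub>C (x + L x) + y) = W x + \<sigma> *\<^sub>C x + P y"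
        by (simp add: blinfun.add_right clinear_simps(2) [OF P_lin] P_L PWx PWL Px)
      have LWL: "L (W (L x)) = 0" using L_P [of "W (L x)"] by (simp add: PWL)
      have L_z: "L (W x + W (L x) + \<sigma> *\<^sub>C (x + L x) + y) = L (W x) + \<sigma> *\<^sub>C L x + L y"
        by (simp add: blinfun.add_right clinear_simps(2) [OF L_lin] L_L LWL)
      \<comment> \<open>The Riccati equation at \<open>x\<close> equates the two sides of the
        invariance condition: after the common terms cancel,
        \<open>W (L x) + y = P y + L (W x) + L y\<close> remains.\<close>
      have "W (L x) - L (W x) = - ((y - L y) - P (y - L y))"
        using Ric [of x] by (simp add: Px q_apply y_def)
      then have "W (L x) = L (W x) - y + L y + P y"
        by (simp add: blinfun.diff_right P_L algebra_simps)
      then show "A' (P u + L u) = P (A' (P u + L u)) + L (A' (P u + L u))"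
        unfolding z P_z L_z by (simp add: scaleC_add_right algebra_simps)
    qed
    with Ln show "\<exists>L. norm L \<le> \<eta> \<and> riesz_perturbation A \<sigma> n P S E A' L" by blast
  qed
qed

end

section \<open>Meromorphic continuation of the resolvent family\<close>

text \<open>Complex multiples of operators, whose type carries real scalar multiplication
  only.\<close>

definition csc :: "complex \<Rightarrow> ('a::real_normed_vector \<Rightarrow>\<^sub>L 'b::chilbert_space) \<Rightarrow> ('a \<Rightarrow>\<^sub>L 'b)" where
  "csc c T = Blinfun (\<lambda>u. c *\<^sub>C T u)"

lemma csc_apply [simp]: "blinfun_apply (csc c T) u = c *\<^sub>C T u"
proof -
  have "bounded_linear (\<lambda>u. c *\<^sub>C T u)"
    by (rule bounded_linear_compose [OF bounded_linear_scaleC blinfun.bounded_linear_right])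
  then show ?thesis by (simp add: csc_def bounded_linear_Blinfun_apply)
qed

lemma norm_csc_le: "norm (csc c T) \<le> norm c * norm T"
proof (rule norm_blinfun_bound)
  fix u
  show "norm (csc c T u) \<le> norm c * norm T * norm u"
    by (simp add: norm_blinfun mult_left_mono mult.assoc)
qed simp

lemma bounded_bilinear_csc: "bounded_bilinear csc"
proof
  show "\<exists>K. \<forall>a (b::'a \<Rightarrow>\<^sub>L 'b). norm (csc a b) \<le> norm a * norm b * K"
    by (rule exI [of _ 1]) (simp add: norm_csc_le)
qed (rule blinfun_eqI; simp add: scaleC_add_left scaleC_add_right blinfun.add_left blinfun.scaleR_left
      scaleR_scaleC scaleR_conv_of_real scaleC_scaleC mult.commute)+

section \<open>Calculus of holomorphic operator functions\<close>

lemma op_holomorphic_on_subset: "op_holomorphic_on M S \<Longrightarrow> T \<subseteq> S \<Longrightarrow> op_holomorphic_on M T"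
  unfolding op_holomorphic_on_def by blast

lemma op_holomorphic_on_const: "clinear (blinfun_apply T) \<Longrightarrow> op_holomorphic_on (\<lambda>z. T) S"
  unfolding op_holomorphic_on_def by (auto simp: clinear_simps(2) intro!: exI [of _ "\<lambda>h. 0"])

lemma op_holomorphic_on_add:
  assumes "op_holomorphic_on M S" "op_holomorphic_on N S"
  shows "op_holomorphic_on (\<lambda>z. M z + N z) S"
  unfolding op_holomorphic_on_def
proof (intro ballI conjI)
  fix z assume z: "z \<in> S"
  show "\<forall>c x. (M z + N z) (c *\<^sub>C x) = c *\<^sub>C (M z + N z) x"
    using assms z by (simp add: op_holomorphic_on_def blinfun.add_left scaleC_add_right)
  obtain M' where M': "(M has_derivative M') (at z)" "\<And>h x. M' h x = h *\<^sub>C M' 1 x"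
    using assms(1) z unfolding op_holomorphic_on_def by blast
  obtain N' where N': "(N has_derivative N') (at z)" "\<And>h x. N' h x = h *\<^sub>C N' 1 x"
    using assms(2) z unfolding op_holomorphic_on_def by blast
  have "(M' h + N' h) x = h *\<^sub>C (M' 1 + N' 1) x" for h x
    using M'(2) [of h x] N'(2) [of h x] by (simp add: blinfun.add_left scaleC_add_right)
  then show "\<exists>D. ((\<lambda>z. M z + N z) has_derivative D) (at z) \<and> (\<forall>h x. D h x = h *\<^sub>C D 1 x)"
    by (intro exI [of _ "\<lambda>h. M' h + N' h"] conjI allI has_derivative_add M'(1) N'(1))
qed

lemma op_holomorphic_on_sum:
  assumes "\<And>i. i \<in> I \<Longrightarrow> op_holomorphic_on (M i) S"
  shows "op_holomorphic_on (\<lambda>z. \<Sum>i\<in>I. M i z) S"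
  using assms
  by (induction I rule: infinite_finite_induct)
     (auto intro!: op_holomorphic_on_add op_holomorphic_on_const simp: cpair.module_hom_zero clinear_iff)

lemma op_holomorphic_on_csc:
  assumes f: "\<And>z. f field_differentiable at z" and "op_holomorphic_on M S"
  shows "op_holomorphic_on (\<lambda>z. csc (f z) (M z)) S"
  unfolding op_holomorphic_on_def
proof (intro ballI conjI)
  fix z assume z: "z \<in> S"
  show "\<forall>c x. csc (f z) (M z) (c *\<^sub>C x) = c *\<^sub>C csc (f z) (M z) x"
    using assms z by (simp add: op_holomorphic_on_def scaleC_scaleC mult.commute)
  obtain M' where M': "(M has_derivative M') (at z)" "\<And>h x. M' h x = h *\<^sub>C M' 1 x"
    using assms(2) z unfolding op_holomorphic_on_def by blast
  obtain f' where f': "(f has_field_derivative f') (at z)" using f field_differentiable_def by blast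
  let ?D = "\<lambda>h. csc (f z) (M' h) + csc (f' * h) (M z)"
  have "((\<lambda>z. csc (f z) (M z)) has_derivative ?D) (at z)"
    by (rule bounded_bilinear.FDERIV [OF bounded_bilinear_csc f' [unfolded has_field_derivative_def] M'(1)])
  moreover have "?D h x = h *\<^sub>C ?D 1 x" for h x
    using M'(2) [of h x] by (simp add: blinfun.add_left scaleC_add_right scaleC_scaleC mult_ac)
  ultimately show "\<exists>D. ((\<lambda>z. csc (f z) (M z)) has_derivative D) (at z) \<and> (\<forall>h x. D h x = h *\<^sub>C D 1 x)"
    by blast
qed

text \<open>Abstracts \<open>C = A_z(s0)\<close>. By the resolvent identity, \<open>A_z(t)\<close>
  is the inverse of \<open>1 + (t - s0) C\<close> applied to \<open>C\<close>, an expression that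
  makes sense for complex \<open>t\<close> wherever the pencil is injective.\<close>

locale compact_pencil =
  fixes C :: "'k::chilbert_space \<Rightarrow>\<^sub>L 'k" and s0 :: complex
  assumes C_compact: "compact_operator C" and C_lin: "clinear (blinfun_apply C)"
begin

definition singular :: "complex set" where
  "singular = {z. \<exists>u. u \<noteq> 0 \<and> u + (z - s0) *\<^sub>C C u = 0}"

text \<open>The candidate for the meromorphic continuation. Off \<open>singular\<close> the defining
  equation has exactly one solution; on \<open>singular\<close> the value is an arbitrary
  choice.\<close>

definition mres :: "complex \<Rightarrow> 'k \<Rightarrow>\<^sub>L 'k" where
  "mres z = (SOME T. \<forall>u. blinfun_apply T u + (z - s0) *\<^sub>C C (blinfun_apply T u) = C u)"

lemma pencil_cancel:
  assumes z: "z \<notin> singular" and eq: "u + (z - s0) *\<^sub>C C u = v + (z - s0) *\<^sub>C C v"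
  shows "u = v"
proof -
  have "(u - v) + (z - s0) *\<^sub>C C (u - v) = 0"
    using eq by (simp add: blinfun.diff_right complex_vector.scale_right_diff_distrib algebra_simps)
  then have "u - v = 0" using z unfolding singular_def by blast
  then show ?thesis by simp
qed

lemma mres_eq:
  assumes z: "z \<notin> singular"
  shows "mres z u + (z - s0) *\<^sub>C C (mres z u) = C u"
proof -
  define K where "K = csc (s0 - z) id_blinfun o\<^sub>L C"
  have K: "u - K u = u + (z - s0) *\<^sub>C C u" for u
    by (simp add: K_def complex_vector.scale_left_diff_distrib algebra_simps)
  have "compact_operator K" unfolding K_def by (rule compact_operator_compose_left [OF C_compact])
  moreover have "clinear (blinfun_apply K)"
    unfolding clinear_blinfun_iff by (simp add: K_def clinear_simps(2) [OF C_lin] scaleC_scaleC mult.commute)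
  moreover have "u = 0" if "K u = u" for u
  proof (rule pencil_cancel [OF z])
    show "u + (z - s0) *\<^sub>C C u = 0 + (z - s0) *\<^sub>C C 0" using K [of u] that by (simp add: blinfun.zero_right)
  qed
  ultimately obtain G :: "'k \<Rightarrow>\<^sub>L 'k" where "\<And>u. G u - K (G u) = u"
    using Fredholm_alternative [of K] by metis
  then have "\<forall>u. (G o\<^sub>L C) u + (z - s0) *\<^sub>C C ((G o\<^sub>L C) u) = C u" by (simp add: K [symmetric])
  then have "\<forall>u. mres z u + (z - s0) *\<^sub>C C (mres z u) = C u"
    unfolding mres_def by (rule someI)
  then show ?thesis by blast
qed

lemma mres_unique:
  assumes z: "z \<notin> singular" and "v + (z - s0) *\<^sub>C C v = C u"
  shows "mres z u = v"
  by (rule pencil_cancel [OF z]) (simp add: mres_eq [OF z] assms(2))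

lemma mres_lin:
  assumes z: "z \<notin> singular"
  shows "clinear (blinfun_apply (mres z))"
  unfolding clinear_blinfun_iff
proof (intro allI)
  fix c x
  have "c *\<^sub>C mres z x + (z - s0) *\<^sub>C C (c *\<^sub>C mres z x) = c *\<^sub>C (mres z x + (z - s0) *\<^sub>C C (mres z x))"
    by (simp add: clinear_simps(2) [OF C_lin] scaleC_add_right scaleC_scaleC mult.commute)
  then show "mres z (c *\<^sub>C x) = c *\<^sub>C mres z x"
    using z by (intro mres_unique) (simp_all add: mres_eq clinear_simps(2) [OF C_lin])
qed

text \<open>The resolvent identity of the pencil, from which openness, local boundedness and the
  derivative all follow.\<close>

lemma mres_diff:
  assumes z: "z \<notin> singular" and w: "w \<notin> singular"
  shows "mres w - mres z = csc (z - w) (mres z o\<^sub>L mres w)"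
proof (rule blinfun_eqI)
  fix u
  have alg: "(a - t *\<^sub>C d) + (z - s0) *\<^sub>C (ca - t *\<^sub>C cd) = (a + (z - t - s0) *\<^sub>C ca) + t *\<^sub>C ca - t *\<^sub>C (d + (z - s0) *\<^sub>C cd)"
    for a d ca cd :: 'k and t
    by (simp add: scaleC_add_right scaleC_scaleC complex_vector.scale_right_diff_distrib
        complex_vector.scale_left_diff_distrib algebra_simps)
  let ?v = "mres w u - (z - w) *\<^sub>C mres z (mres w u)"
  have "?v + (z - s0) *\<^sub>C C ?v = (mres w u + (w - s0) *\<^sub>C C (mres w u)) + (z - w) *\<^sub>C C (mres w u)
      - (z - w) *\<^sub>C (mres z (mres w u) + (z - s0) *\<^sub>C C (mres z (mres w u)))"
    using alg [of "mres w u" "z - w"] by (simp add: blinfun.diff_right clinear_simps(2) [OF C_lin])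
  also have "\<dots> = C u" by (simp add: mres_eq [OF z] mres_eq [OF w])
  finally have "mres z u = ?v" by (rule mres_unique [OF z])
  then show "(mres w - mres z) u = csc (z - w) (mres z o\<^sub>L mres w) u" by (simp add: blinfun.diff_left)
qed

text \<open>A kernel vector \<open>u\<close> at \<open>w\<close> satisfies
  \<open>u = (z - w) mres z u\<close> after cancelling the pencil at \<open>z\<close>, so it would
  be shorter than itself.\<close>

lemma not_singular_near:
  assumes z: "z \<notin> singular" and small: "cmod (w - z) * norm (mres z) < 1"
  shows "w \<notin> singular"
proof
  assume "w \<in> singular"
  then obtain u where u: "u \<noteq> 0" "u + (w - s0) *\<^sub>C C u = 0" by (auto simp: singular_def)
  have "u + (z - s0) *\<^sub>C C u = (u + (w - s0) *\<^sub>C C u) + (z - w) *\<^sub>C C u"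
    by (simp add: complex_vector.scale_left_diff_distrib algebra_simps)
  also have "\<dots> = (z - w) *\<^sub>C (mres z u + (z - s0) *\<^sub>C C (mres z u))" by (simp add: u mres_eq [OF z])
  also have "\<dots> = (z - w) *\<^sub>C mres z u + (z - s0) *\<^sub>C C ((z - w) *\<^sub>C mres z u)"
    by (simp add: clinear_simps(2) [OF C_lin] scaleC_add_right scaleC_scaleC mult.commute)
  finally have "u = (z - w) *\<^sub>C mres z u" by (rule pencil_cancel [OF z])
  then have "norm u = cmod (w - z) * norm (mres z u)" by (metis norm_scaleC norm_minus_commute)
  also have "\<dots> \<le> cmod (w - z) * (norm (mres z) * norm u)" by (intro mult_left_mono norm_blinfun) simp
  also have "\<dots> < 1 * norm u" using small u(1) by (simp only: mult.assoc [symmetric]) (intro mult_strict_right_mono, auto)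
  finally show False by simp
qed

lemma open_nonsingular:
  assumes z: "z \<notin> singular"
  obtains e where "e > 0" "ball z e \<subseteq> - singular" "\<And>w. w \<in> ball z e \<Longrightarrow> norm (mres w) \<le> 2 * norm (mres z)"
proof -
  \<comment> \<open>Makes \<open>cmod (w - z) * norm (mres z)\<close> at most 1/2; in the resolvent
    identity half of \<open>norm (mres w)\<close> is then absorbed, which gives the bound
    \<open>2 * norm (mres z)\<close>.\<close>
  define e where "e = 1 / (2 * (norm (mres z) + 1))"
  have e: "e > 0" by (simp add: e_def add_nonneg_pos)
  have half: "cmod (w - z) * norm (mres z) \<le> 1/2" if "w \<in> ball z e" for w
  proof -
    have "cmod (w - z) * norm (mres z) \<le> e * (norm (mres z) + 1)"
      using that e by (intro mult_mono) (auto simp: dist_norm norm_minus_commute)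
    also have "e * (norm (mres z) + 1) = 1/2"
    proof -
      have "2 * norm (mres z) + 2 \<noteq> 0" using norm_ge_zero [of "mres z"] by linarith
      then show ?thesis by (simp add: e_def)
    qed
    finally show ?thesis .
  qed
  have ns: "w \<notin> singular" if "w \<in> ball z e" for w
    using not_singular_near [OF z, of w] half [OF that] by linarith
  have "norm (mres w) \<le> 2 * norm (mres z)" if w: "w \<in> ball z e" for w
  proof -
    have "norm (mres w - mres z) \<le> cmod (z - w) * norm (mres z o\<^sub>L mres w)"
      unfolding mres_diff [OF z ns [OF w]] by (rule norm_csc_le)
    also have "\<dots> \<le> cmod (z - w) * (norm (mres z) * norm (mres w))"
      by (intro mult_left_mono norm_blinfun_compose) simp
    also have "\<dots> \<le> 1/2 * norm (mres w)"
      using mult_right_mono [OF half [OF w] norm_ge_zero [of "mres w"]] by (simp add: norm_minus_commute mult.assoc)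
    finally show ?thesis using norm_triangle_ineq2 [of "mres w" "mres z"] by linarith
  qed
  with e ns show thesis by (intro that [of e]) auto
qed

text \<open>Using the resolvent identity twice leaves the remainder \<open>(z - w)^2\<close> times
  \<open>mres z\<close> twice and \<open>mres w\<close>; the local bound on \<open>mres w\<close>
  makes it quadratic.\<close>

lemma op_holomorphic_on_mres: "op_holomorphic_on mres (- singular)"
  unfolding op_holomorphic_on_def
proof (intro ballI conjI)
  fix z assume "z \<in> - singular"
  then have z: "z \<notin> singular" by simp
  show "\<forall>c x. mres z (c *\<^sub>C x) = c *\<^sub>C mres z x"
    using mres_lin [OF z] by (simp add: clinear_blinfun_iff)
  obtain e where e: "e > 0" "ball z e \<subseteq> - singular" "\<And>w. w \<in> ball z e \<Longrightarrow> norm (mres w) \<le> 2 * norm (mres z)"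
    by (rule open_nonsingular [OF z]) (rule that; assumption)
  define D where "D h = csc (- h) (mres z o\<^sub>L mres z)" for h
  define K where "K = norm (mres z) * (norm (mres z) * (2 * norm (mres z)))"
  have K0: "K \<ge> 0" by (simp add: K_def)
  have D_lin: "bounded_linear D"
    unfolding D_def
    by (intro bounded_linear_compose [OF bounded_bilinear.bounded_linear_left [OF bounded_bilinear_csc]] bounded_linear_minus bounded_linear_ident)
  have bound: "norm (mres w - mres z - D (w - z)) \<le> K * (cmod (w - z) * cmod (w - z))" if w: "w \<in> ball z e" for w
  proof -
    have wns: "w \<notin> singular" using e(2) w by auto
    have 1: "mres w u - mres z u = (z - w) *\<^sub>C mres z (mres w u)" for u
      using mres_diff [OF z wns] by (metis blinfun.diff_left blinfun_apply_blinfun_compose csc_apply)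
    have "mres w - mres z - D (w - z) = csc ((z - w) * (z - w)) (mres z o\<^sub>L (mres z o\<^sub>L mres w))"
    proof (rule blinfun_eqI)
      fix u
      have "(mres w - mres z - D (w - z)) u = (z - w) *\<^sub>C (mres z (mres w u) - mres z (mres z u))"
        by (simp add: blinfun.diff_left D_def 1 complex_vector.scale_right_diff_distrib)
      also have "mres z (mres w u) - mres z (mres z u) = (z - w) *\<^sub>C mres z (mres z (mres w u))"
        by (simp add: blinfun.diff_right [symmetric] 1 clinear_simps(2) [OF mres_lin [OF z]])
      finally show "(mres w - mres z - D (w - z)) u = csc ((z - w) * (z - w)) (mres z o\<^sub>L (mres z o\<^sub>L mres w)) u"
        by (simp add: scaleC_scaleC)
    qed
    also have "norm \<dots> \<le> cmod ((z - w) * (z - w)) * (norm (mres z) * (norm (mres z) * norm (mres w)))"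
      by (intro order_trans [OF norm_csc_le] mult_left_mono order_trans [OF norm_blinfun_compose] norm_blinfun_compose norm_ge_zero)
    also have "\<dots> \<le> cmod ((z - w) * (z - w)) * K"
      unfolding K_def using e(3) [OF w] by (intro mult_left_mono) auto
    finally show ?thesis by (simp add: norm_mult norm_minus_commute mult.commute)
  qed
  have "(mres has_derivative D) (at z)"
  proof (rule has_derivativeI_sandwich [where e = e and H = "\<lambda>w. K * cmod (w - z)"])
    show "((\<lambda>w. K * cmod (w - z)) \<longlongrightarrow> 0) (at z)"
      by (auto intro!: tendsto_eq_intros)
    fix w assume w: "w \<noteq> z" "dist w z < e"
    then have "norm (mres w - mres z - D (w - z)) \<le> (K * cmod (w - z)) * cmod (w - z)"
      using bound [of w] by (simp add: dist_commute mult.assoc)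
    then show "norm (mres w - mres z - D (w - z)) / norm (w - z) \<le> K * cmod (w - z)"
      using w(1) by (simp add: divide_le_eq)
  qed (use e(1) D_lin in auto)
  moreover have "D h x = h *\<^sub>C D 1 x" for h x by (simp add: D_def)
  ultimately show "\<exists>M'. (mres has_derivative M') (at z) \<and> (\<forall>h x. M' h x = h *\<^sub>C M' 1 x)" by blast
qed

lemma singular_eigenvalue:
  "p \<in> singular \<longleftrightarrow> p \<noteq> s0 \<and> (\<exists>u. u \<noteq> 0 \<and> C u = inverse (s0 - p) *\<^sub>C u)"
proof
  assume "p \<in> singular"
  then obtain u where u: "u \<noteq> 0" "u + (p - s0) *\<^sub>C C u = 0" by (auto simp: singular_def)
  have ps: "p \<noteq> s0" using u by auto
  have "u = (s0 - p) *\<^sub>C C u" using u(2) by (simp add: complex_vector.scale_left_diff_distrib algebra_simps)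
  then have "inverse (s0 - p) *\<^sub>C u = C u" using ps by (metis eq_iff_diff_eq_0 left_inverse scaleC_one scaleC_scaleC)
  then show "p \<noteq> s0 \<and> (\<exists>u. u \<noteq> 0 \<and> C u = inverse (s0 - p) *\<^sub>C u)" using u(1) ps by metis
next
  assume "p \<noteq> s0 \<and> (\<exists>u. u \<noteq> 0 \<and> C u = inverse (s0 - p) *\<^sub>C u)"
  then obtain u where u: "p \<noteq> s0" "u \<noteq> 0" "C u = inverse (s0 - p) *\<^sub>C u" by blast
  have "(p - s0) * inverse (s0 - p) = - 1" using u(1) by (simp add: field_simps)
  then have "u + (p - s0) *\<^sub>C C u = 0" by (simp add: u(3) scaleC_scaleC scaleC_one)
  with u(2) show "p \<in> singular" by (auto simp: singular_def)
qed

text \<open>The Riesz decomposition of \<open>C\<close> at \<open>1/(s0 - p)\<close> splits the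
  pencil. The part \<open>C1\<close> on the complement is regular near \<open>p\<close>; on the
  finite-dimensional part the inverse is a polynomial of degree below \<open>n\<close> in the
  nilpotent \<open>W\<close>, with a pole of order at most \<open>n\<close>. Isolation of
  \<open>p\<close> follows because an eigenvector for another eigenvalue lies in the kernel of
  \<open>Q\<close>, so it is also singular for \<open>C1\<close>.\<close>

lemma mres_pole:
  assumes p: "p \<in> singular"
  shows "\<exists>n e G. e > 0 \<and> ball p e - {p} \<subseteq> - singular \<and> op_holomorphic_on G (ball p e) \<and>
    (\<forall>z\<in>ball p e - {p}. \<forall>u. blinfun_apply (G z) u = (z - p) ^ n *\<^sub>C mres z u)"
proof -
  have ps: "p \<noteq> s0" using p singular_eigenvalue [of p] by blast
  define \<sigma> where "\<sigma> = inverse (s0 - p)"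
  have \<sigma>0: "\<sigma> \<noteq> 0" using ps by (simp add: \<sigma>_def)
  obtain n Q S E where rd: "riesz_decomposition C \<sigma> n Q S E"
    by (rule riesz_decomposition_exists [OF C_compact C_lin \<sigma>0]) (rule that)
  interpret R: riesz_decomposition C \<sigma> n Q S E by (rule rd)
  define C1 where "C1 = C o\<^sub>L (id_blinfun - Q)"
  have C1: "C1 u = C (u - Q u)" for u by (simp add: C1_def blinfun.diff_left)
  interpret C1: compact_pencil C1 s0
  proof (rule compact_pencil.intro)
    show "compact_operator C1" unfolding C1_def by (rule compact_operator_compose_right [OF C_compact])
    show "clinear (blinfun_apply C1)"
      unfolding C1 by (rule clinear_compose [OF clinear_diff [OF clinear_ident R.P_lin] C_lin])
  qed
  have QC1: "Q (C1 u) = 0" for u by (simp add: C1 R.P_commute blinfun.diff_right R.P_idem)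
  have Q_pencil: "Q v = 0" if "v + (z - s0) *\<^sub>C C1 v = C1 u" for v z u
  proof -
    have "Q (v + (z - s0) *\<^sub>C C1 v) = 0" unfolding that by (rule QC1)
    then show ?thesis by (simp add: blinfun.add_right clinear_simps(2) [OF R.P_lin] QC1)
  qed
  \<comment> \<open>A kernel vector would be an eigenvector of \<open>C\<close> for
    \<open>\<sigma>\<close> annihilated by \<open>Q\<close>, while \<open>Q\<close> fixes all such
    eigenvectors.\<close>
  have "p \<notin> C1.singular"
  proof
    assume "p \<in> C1.singular"
    then obtain u where u: "u \<noteq> 0" "u + (p - s0) *\<^sub>C C1 u = 0" by (auto simp: C1.singular_def)
    have Qu: "Q u = 0" by (rule Q_pencil [of u p 0]) (simp add: u(2) blinfun.zero_right)
    have "u + (p - s0) *\<^sub>C C u = 0" using u(2) by (simp add: C1 Qu)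
    then have "u = (s0 - p) *\<^sub>C C u" by (simp add: complex_vector.scale_left_diff_distrib algebra_simps)
    then have "\<sigma> *\<^sub>C u = C u" using ps unfolding \<sigma>_def by (metis eq_iff_diff_eq_0 left_inverse scaleC_one scaleC_scaleC)
    then have "R.W u = 0" by (simp add: R.W_apply)
    with Qu u(1) R.kernel_W show False by force
  qed
  then obtain e where e: "e > 0" "ball p e \<subseteq> - C1.singular"
    by (rule C1.open_nonsingular)
  have W_sh: "shift C \<sigma> = R.W" by (simp add: R.W_def)
  have ns: "z \<notin> singular" if z: "z \<in> ball p e - {p}" for z
  proof
    assume "z \<in> singular"
    then obtain u where zs: "z \<noteq> s0" and u: "u \<noteq> 0" "C u = inverse (s0 - z) *\<^sub>C u"
      using singular_eigenvalue [of z] by blast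
    have "C (Q u) = inverse (s0 - z) *\<^sub>C Q u"
      by (metis R.P_commute u(2) clinear_simps(2) [OF R.P_lin])
    moreover have "Q u \<in> gen C \<sigma>" unfolding gen_def W_sh using R.W_nilpotent by blast
    moreover have "inverse (s0 - z) \<noteq> \<sigma>" using z unfolding \<sigma>_def by auto
    ultimately have Qu: "Q u = 0" using shift_injective_on_gen [OF C_lin] by simp
    have "u + (z - s0) *\<^sub>C C1 u = 0"
    proof -
      have "(z - s0) * inverse (s0 - z) = - 1" using zs by (simp add: field_simps)
      then show ?thesis by (simp add: C1 Qu u(2) scaleC_scaleC scaleC_one)
    qed
    then have "z \<in> C1.singular" using u(1) by (auto simp: C1.singular_def)
    with e(2) z show False by auto
  qed
  have "\<exists>T. \<forall>u. blinfun_apply T u = (R.W ^^ k) (C (Q u))" for k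
  proof -
    have "bounded_linear (\<lambda>u. (R.W ^^ k) (C (Q u)))"
      unfolding R.W_def
      by (intro bounded_linear_compose [OF bounded_linear_shift_funpow]
          bounded_linear_compose [OF blinfun.bounded_linear_right] blinfun.bounded_linear_right)
    then show ?thesis by (metis obtain_blinfun)
  qed
  then obtain Wb :: "nat \<Rightarrow> 'k \<Rightarrow>\<^sub>L 'k" where Wb: "\<And>k u. Wb k u = (R.W ^^ k) (C (Q u))" by metis
  have Wb_lin: "clinear (blinfun_apply (Wb k))" for k
    unfolding Wb by (intro clinear_compose [OF clinear_compose [OF R.P_lin C_lin] clinear_funpow [OF R.W_lin]])
  \<comment> \<open>On the range of \<open>Q\<close> the pencil is
    \<open>(z - p) \<sigma> - (s0 - z) W\<close>. These are the coefficients of the geometric series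
    of its inverse, multiplied by \<open>(z - p) ^ n\<close> and with \<open>s0 - p\<close> in place
    of \<open>1 / \<sigma>\<close>.\<close>
  define f where "f k z = (z - p) ^ (n - Suc k) * ((s0 - z) ^ k * (s0 - p) ^ Suc k)" for k z
  define G where "G z = csc ((z - p) ^ n) (C1.mres z) + (\<Sum>k<n. csc (f k z) (Wb k))" for z
  have "op_holomorphic_on G (ball p e)"
    unfolding G_def f_def
    by (intro op_holomorphic_on_add op_holomorphic_on_sum op_holomorphic_on_csc op_holomorphic_on_const Wb_lin
        op_holomorphic_on_subset [OF C1.op_holomorphic_on_mres e(2)] derivative_intros)
  moreover have "G z u = (z - p) ^ n *\<^sub>C mres z u" if z: "z \<in> ball p e - {p}" for z u
  proof (rule pencil_cancel [OF ns [OF z]])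
    define v where "v = C1.mres z u"
    have v: "v + (z - s0) *\<^sub>C C1 v = C1 u"
      unfolding v_def using z e(2) by (intro C1.mres_eq) auto
    then have "Q v = 0" by (rule Q_pencil)
    with v have v': "v + (z - s0) *\<^sub>C C v = C (u - Q u)" by (simp add: C1)
    define x where "x = C (Q u)"
    define g where "g k = ((z - p) ^ (n - k) * ((s0 - z) ^ k * (s0 - p) ^ k)) *\<^sub>C (R.W ^^ k) x" for k
    define F where "F = (\<Sum>k<n. f k z *\<^sub>C (R.W ^^ k) x)"
    have pencil_W: "y + (z - s0) *\<^sub>C C y = ((z - p) * \<sigma>) *\<^sub>C y - (s0 - z) *\<^sub>C R.W y" for y
    proof -
      have "(z - p) * \<sigma> = 1 + (z - s0) * \<sigma>" using ps by (simp add: \<sigma>_def field_simps)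
      then show ?thesis
        by (simp add: R.A_apply [of y] scaleC_add_left scaleC_add_right scaleC_scaleC scaleC_one
            complex_vector.scale_left_diff_distrib algebra_simps)
    qed
    have "F + (z - s0) *\<^sub>C C F = (\<Sum>k<n. f k z *\<^sub>C ((R.W ^^ k) x + (z - s0) *\<^sub>C C ((R.W ^^ k) x)))"
      by (simp add: F_def blinfun.sum_right clinear_simps(2) [OF C_lin] complex_vector.scale_sum_right
          sum.distrib scaleC_add_right scaleC_scaleC mult.commute)
    also have "\<dots> = (\<Sum>k<n. g k - g (Suc k))"
    proof (rule sum.cong [OF refl])
      fix k assume k: "k \<in> {..<n}"
      have 1: "f k z * ((z - p) * \<sigma>) = (z - p) ^ (n - k) * ((s0 - z) ^ k * (s0 - p) ^ k)"
      proof -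
        have "n - k = Suc (n - Suc k)" using k by auto
        then show ?thesis using ps by (simp add: f_def \<sigma>_def)
      qed
      have 2: "f k z * (s0 - z) = (z - p) ^ (n - Suc k) * ((s0 - z) ^ Suc k * (s0 - p) ^ Suc k)"
        by (simp add: f_def)
      show "f k z *\<^sub>C ((R.W ^^ k) x + (z - s0) *\<^sub>C C ((R.W ^^ k) x)) = g k - g (Suc k)"
        unfolding pencil_W g_def complex_vector.scale_right_diff_distrib scaleC_scaleC 1 2 by simp
    qed
    also have "\<dots> = g 0 - g n" by (rule sum_lessThan_telescope')
    also have "g n = 0"
    proof -
      have "x = Q (C u)" by (simp add: x_def R.P_commute)
      then show ?thesis by (simp add: g_def R.W_nilpotent)
    qed
    also have "g 0 = (z - p) ^ n *\<^sub>C x" by (simp add: g_def)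
    finally have F: "F + (z - s0) *\<^sub>C C F = (z - p) ^ n *\<^sub>C x" by simp
    have Gz: "G z u = (z - p) ^ n *\<^sub>C v + F"
      by (simp add: G_def blinfun.add_left blinfun.sum_left v_def F_def Wb x_def)
    have "G z u + (z - s0) *\<^sub>C C (G z u) = (z - p) ^ n *\<^sub>C (v + (z - s0) *\<^sub>C C v) + (F + (z - s0) *\<^sub>C C F)"
      by (simp add: Gz blinfun.add_right clinear_simps(2) [OF C_lin] scaleC_add_right scaleC_scaleC mult.commute algebra_simps)
    also have "\<dots> = (z - p) ^ n *\<^sub>C C u"
      unfolding v' F x_def by (simp add: scaleC_add_right [symmetric] blinfun.diff_right)
    also have "\<dots> = (z - p) ^ n *\<^sub>C (mres z u + (z - s0) *\<^sub>C C (mres z u))"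
      by (simp add: mres_eq [OF ns [OF z]])
    finally show "G z u + (z - s0) *\<^sub>C C (G z u) = (z - p) ^ n *\<^sub>C mres z u + (z - s0) *\<^sub>C C ((z - p) ^ n *\<^sub>C mres z u)"
      by (simp add: clinear_simps(2) [OF C_lin] scaleC_add_right scaleC_scaleC mult.commute)
  qed
  ultimately show ?thesis
    using e(1) ns by (intro exI [of _ n] exI [of _ e] exI [of _ G]) auto
qed

theorem op_meromorphic_mres: "op_meromorphic mres"
  unfolding op_meromorphic_def
proof (intro exI [of _ singular] conjI allI ballI)
  show "op_holomorphic_on mres (- singular)" by (rule op_holomorphic_on_mres)
  fix p
  show "\<not> p islimpt singular"
  proof (cases "p \<in> singular")
    case True
    obtain e where "e > 0" "ball p e - {p} \<subseteq> - singular" using mres_pole [OF True] by blast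
    then show ?thesis unfolding islimpt_def by (auto intro!: exI [of _ "ball p e"])
  next
    case False
    obtain e where "e > 0" "ball p e \<subseteq> - singular" by (rule open_nonsingular [OF False])
    then show ?thesis unfolding islimpt_def by (auto intro!: exI [of _ "ball p e"])
  qed
next
  fix p assume p: "p \<in> singular"
  show "\<exists>n e G. 0 < e \<and> op_holomorphic_on G (ball p e) \<and>
      (\<forall>s\<in>ball p e - {p}. \<forall>x. blinfun_apply (G s) x = (s - p) ^ n *\<^sub>C mres s x)"
    using mres_pole [OF p] by blast
qed

text \<open>On an eigenvector \<open>u\<close> the continuation is explicit,
  \<open>mres z u = u / (z - p)\<close>, so its norm blows up.\<close>

theorem is_pole_mres:
  assumes p: "p \<in> singular"
  shows "is_pole mres p"
proof -
  obtain e where e: "e > 0" "ball p e - {p} \<subseteq> - singular" using mres_pole [OF p] by blast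
  obtain u where ps: "p \<noteq> s0" and u: "u \<noteq> 0" "C u = inverse (s0 - p) *\<^sub>C u"
    using p singular_eigenvalue [of p] by blast
  have ev: "\<forall>\<^sub>F z in at p. z \<in> ball p e - {p}"
    using e(1) by (intro eventually_at_in_open) auto
  have low: "inverse (cmod (z - p)) \<le> norm (mres z)" if z: "z \<in> ball p e - {p}" for z
  proof -
    have "mres z u = inverse (z - p) *\<^sub>C u"
    proof (rule mres_unique)
      show "z \<notin> singular" using e(2) z by auto
      have "inverse (z - p) + (z - s0) * inverse (z - p) * inverse (s0 - p) = inverse (s0 - p)"
      proof -
        have "inverse a + (a - b) * inverse a * inverse b = inverse b" if "a \<noteq> 0" "b \<noteq> 0" for a b :: complex
          using that by (simp add: field_simps)
        from this [of "z - p" "s0 - p"] show ?thesis using z ps by simp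
      qed
      then show "inverse (z - p) *\<^sub>C u + (z - s0) *\<^sub>C C (inverse (z - p) *\<^sub>C u) = C u"
        by (simp add: clinear_simps(2) [OF C_lin] u(2) scaleC_scaleC scaleC_add_left [symmetric] mult.assoc)
    qed
    then have "inverse (cmod (z - p)) * norm u \<le> norm (mres z) * norm u"
      using norm_blinfun [of "mres z" u] by (simp add: norm_inverse)
    then show ?thesis using u(1) by simp
  qed
  have "filterlim (\<lambda>z. inverse (cmod (z - p))) at_top (at p)"
  proof (rule filterlim_inverse_at_top)
    show "((\<lambda>z. cmod (z - p)) \<longlongrightarrow> 0) (at p)" by (auto intro!: tendsto_eq_intros)
    show "\<forall>\<^sub>F z in at p. 0 < cmod (z - p)" using ev by eventually_elim auto
  qed
  then have "filterlim (\<lambda>z. norm (mres z)) at_top (at p)"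
    by (rule filterlim_at_top_mono) (use ev in \<open>eventually_elim, auto intro: low\<close>)
  then show ?thesis unfolding is_pole_def by (rule filterlim_norm_at_top_imp_at_infinity)
qed

end

text \<open>\<open>A_pole\<close> admits any meromorphic function that agrees with
  \<open>A_z\<close> on the real line, so the bound may refer to real points only.\<close>

lemma not_is_pole_if_bounded_on_reals:
  fixes M :: "complex \<Rightarrow> 'b::real_normed_vector"
  assumes "\<forall>\<^sub>F t in at x. norm (M (complex_of_real t)) \<le> K"
  shows "\<not> is_pole M (complex_of_real x)"
proof
  assume "is_pole M (complex_of_real x)"
  then have "filterlim M at_infinity (at (complex_of_real x))" by (simp add: is_pole_def)
  moreover have "filterlim complex_of_real (at (complex_of_real x)) (at x)"
    unfolding filterlim_at by (auto intro!: tendsto_intros simp: eventually_at_filter)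
  ultimately have "filterlim (\<lambda>t. M (complex_of_real t)) at_infinity (at x)"
    by (rule filterlim_compose)
  then have "filterlim (\<lambda>t. norm (M (complex_of_real t))) at_top (at x)"
    by (rule filterlim_at_infinity_imp_norm_at_top)
  then have "\<forall>\<^sub>F t in at x. norm (M (complex_of_real t)) > K"
    by (simp add: filterlim_at_top_dense)
  with assms have "\<forall>\<^sub>F t in at x. False" by eventually_elim simp
  then show False by (simp add: trivial_limit_at)
qed

section \<open>The sandwiched resolvent\<close>

lemma linear_operatorD:
  assumes "linear_operator A"
  shows "single_valued A" "(0, 0) \<in> A" "(x, y) \<in> A \<Longrightarrow> (x', y') \<in> A \<Longrightarrow> (x + x', y + y') \<in> A"
    "(x, y) \<in> A \<Longrightarrow> (c *\<^sub>C x, c *\<^sub>C y) \<in> A"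
  using assms by (auto simp: linear_operator_def)

lemma adjoint_op_iff: "(v, u) \<in> adjoint_op A \<longleftrightarrow> (\<forall>x y. (x, y) \<in> A \<longrightarrow> cinner v y = cinner u x)"
  by (auto simp: adjoint_op_def)

lemma adjoint_op_add: "(v, u) \<in> adjoint_op A \<Longrightarrow> (v', u') \<in> adjoint_op A \<Longrightarrow> (v + v', u + u') \<in> adjoint_op A"
  by (simp add: adjoint_op_iff cinner_simps)

lemma adjoint_op_scale: "(v, u) \<in> adjoint_op A \<Longrightarrow> (c *\<^sub>C v, c *\<^sub>C u) \<in> adjoint_op A"
  by (simp add: adjoint_op_iff cinner_simps)

lemma adjoint_op_zero: "(0, 0) \<in> adjoint_op A"
  by (simp add: adjoint_op_iff)

text \<open>If \<open>w\<close> is orthogonal to the domain of the adjoint, then so is \<open>(0, w)\<close> to the orthogonal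
  complement of the closed graph, hence \<open>(0, w)\<close> lies in the graph.\<close>

lemma adjoint_op_densely_defined:
  assumes F: "linear_operator F" "closed F"
  shows "closure (Domain (adjoint_op F)) = UNIV"
proof (rule dense_iff_orthogonal_trivial)
  show "csubspace (Domain (adjoint_op F))"
    by (rule complex_vector.subspaceI) (auto intro: adjoint_op_zero dest: adjoint_op_add adjoint_op_scale)
next
  fix w assume w: "\<And>v. v \<in> Domain (adjoint_op F) \<Longrightarrow> cinner v w = 0"
  have sub: "csubspace F"
    by (rule complex_vector.subspaceI)
       (auto simp: zero_prod_def scaleC_prod_def plus_prod_def intro!: linear_operatorD [OF F(1)])
  obtain q where q: "q \<in> F" "\<And>v. v \<in> F \<Longrightarrow> cinner v ((0, w) - q) = 0"
    using orthogonal_projection [OF sub F(2)] by blast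
  obtain x y where xy: "q = (x, y)" by (cases q)
  have orth: "cinner b (w - y) = cinner a x" if "(a, b) \<in> F" for a b
    using q(2) [OF that] by (simp add: xy cinner_prod_def cinner_minus_right)
  have "(w - y, x) \<in> adjoint_op F"
    unfolding adjoint_op_iff using orth by (metis cinner_commute)
  then have 1: "cinner (w - y) w = 0" by (intro w) auto
  have "cinner y (w - y) = cinner x x" using orth q(1) xy by blast
  then have "cinner (w - y) y = cinner x x" by (metis cinner_commute)
  with 1 have "cinner (w - y) (w - y) = - cinner x x" by (simp add: cinner_diff_right)
  then have "(norm (w - y))\<^sup>2 = - ((norm x)\<^sup>2)"
    unfolding cinner_self by (metis of_real_eq_iff of_real_minus)
  then have "norm (w - y) = 0" "norm x = 0"
    by (smt (verit) zero_le_power2 power2_eq_iff_nonneg zero_eq_power2)+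
  then have "(0, w) \<in> F" using q(1) xy by simp
  then show "w = 0" using linear_operatorD(1,2) [OF F(1)] by (auto dest: single_valuedD)
qed

section \<open>Resolvent identity and dissipativity for the line of operators\<close>

context resonance_setting
begin

abbreviation H :: "real \<Rightarrow> ('h \<times> 'h) set" where "H r \<equiv> op_line H0 V r"
abbreviation T :: "complex \<Rightarrow> real \<Rightarrow> 'k \<Rightarrow>\<^sub>L 'k" where "T z r \<equiv> sandwiched F (H r) z"
abbreviation A :: "complex \<Rightarrow> real \<Rightarrow> 'k \<Rightarrow>\<^sub>L 'k" where "A z r \<equiv> A_op F J H0 V z r"
abbreviation F_adj :: "('k \<times> 'h) set" where "F_adj \<equiv> adjoint_op F"

lemma J_lin: "clinear (blinfun_apply J)"
  unfolding clinear_blinfun_iff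
proof (intro allI)
  fix c x
  have "cinner z (J (c *\<^sub>C x)) = cinner z (c *\<^sub>C J x)" for z
    using J_selfadjoint [of z "c *\<^sub>C x"] J_selfadjoint [of z x] by (simp add: cinner_scaleC_right)
  then have "cinner (J (c *\<^sub>C x) - c *\<^sub>C J x) (J (c *\<^sub>C x) - c *\<^sub>C J x) = 0"
    by (simp add: cinner_diff_right)
  then show "J (c *\<^sub>C x) = c *\<^sub>C J x" by simp
qed

text \<open>The way identities for the bounded extensions are proved: they are checked on the dense
  domain of the adjoint, where \<open>T\<close> is given by actual resolvents.\<close>

lemma dense_induct:
  assumes "closed {v. Q v}" and "\<And>v u. (v, u) \<in> F_adj \<Longrightarrow> Q v"
  shows "Q v"
proof -
  have "closure (Domain F_adj) \<subseteq> {v. Q v}"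
    using assms by (intro closure_minimal) auto
  then show ?thesis using adjoint_op_densely_defined [OF F_linear F_closed] by blast
qed

text \<open>Surjectivity of \<open>H r - z\<close> is read off from relative compactness, whose
  formulation makes \<open>V\<close> after the resolvent an everywhere defined operator.\<close>

lemma resolvent_total:
  assumes "Im z \<noteq> 0"
  obtains x h where "(x, h) \<in> H r" "u = h - z *\<^sub>C x"
proof -
  obtain K where K: "resolvent (H r) z O V = graph_of (blinfun_apply K)"
    using V_relatively_compact [of r] assms unfolding relatively_compact_def by blast
  have "(u, K u) \<in> resolvent (H r) z O V" unfolding K by (auto simp: graph_of_def)
  then show thesis using that by (auto simp: resolvent_def)
qed

lemma sandwiched_triple:
  assumes z: "Im z \<noteq> 0" and v: "(v, u) \<in> F_adj"
  obtains x h w where "(x, h) \<in> H r" "u = h - z *\<^sub>C x" "(x, w) \<in> F"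
proof -
  obtain x h where xh: "(x, h) \<in> H r" "u = h - z *\<^sub>C x" by (rule resolvent_total [OF z])
  then have "x \<in> D" using H_domain by blast
  then obtain w where "(x, w) \<in> F" using D_subset by blast
  with xh show thesis by (rule that)
qed

text \<open>Justifies the definite description in \<open>sandwiched\<close>.\<close>

lemma sandwiched_extension_unique:
  assumes z: "Im z \<noteq> 0" and "sandwiched_extension F (H r) z T1" "sandwiched_extension F (H r) z T2"
  shows "T1 = T2"
proof (rule blinfun_eqI)
  fix v
  show "T1 v = T2 v"
  proof (rule dense_induct [where Q = "\<lambda>v. T1 v = T2 v"])
    show "closed {v. T1 v = T2 v}" by (intro closed_Collect_eq continuous_intros)
    fix v u assume v: "(v, u) \<in> F_adj"
    obtain x h w where "(x, h) \<in> H r" "u = h - z *\<^sub>C x" "(x, w) \<in> F"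
      by (rule sandwiched_triple [OF z v])
    then have "(v, w) \<in> F_adj O resolvent (H r) z O F" using v by (auto simp: resolvent_def)
    then show "T1 v = T2 v"
      using assms(2,3) by (force simp: sandwiched_extension_def graph_of_def)
  qed
qed

lemma sandwiched_props:
  assumes z: "Im z \<noteq> 0"
  shows "compact_operator (T z r)" "sandwiched_extension F (H r) z (T z r)"
proof -
  obtain T0 where T0: "compact_operator T0" "sandwiched_extension F (H r) z T0"
    using sandwiched_compact [OF z] by blast
  then have "T z r = T0"
    unfolding sandwiched_def using sandwiched_extension_unique [OF z] by blast
  with T0 show "compact_operator (T z r)" "sandwiched_extension F (H r) z (T z r)" by auto
qed

lemma sandwiched_apply:
  assumes z: "Im z \<noteq> 0" and "(v, u) \<in> F_adj" "(x, h) \<in> H r" "u = h - z *\<^sub>C x" "(x, w) \<in> F"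
  shows "T z r v = w"
proof -
  have "(v, w) \<in> F_adj O resolvent (H r) z O F" using assms by (auto simp: resolvent_def)
  then show ?thesis using sandwiched_props(2) [OF z, of r] by (force simp: sandwiched_extension_def graph_of_def)
qed

lemma sandwiched_lin:
  assumes z: "Im z \<noteq> 0"
  shows "clinear (blinfun_apply (T z r))"
  unfolding clinear_blinfun_iff
proof (intro allI)
  fix c v
  show "T z r (c *\<^sub>C v) = c *\<^sub>C T z r v"
  proof (rule dense_induct [where Q = "\<lambda>v. T z r (c *\<^sub>C v) = c *\<^sub>C T z r v"])
    show "closed {v. T z r (c *\<^sub>C v) = c *\<^sub>C T z r v}" by (intro closed_Collect_eq continuous_intros)
    fix v u assume v: "(v, u) \<in> F_adj"
    obtain x h w where x: "(x, h) \<in> H r" "u = h - z *\<^sub>C x" "(x, w) \<in> F"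
      by (rule sandwiched_triple [OF z v])
    have "linear_operator (H r)" using H_selfadjoint by (simp add: selfadjoint_op_def)
    then have "(c *\<^sub>C x, c *\<^sub>C h) \<in> H r" using x(1) by (rule linear_operatorD(4))
    moreover have "c *\<^sub>C u = c *\<^sub>C h - z *\<^sub>C c *\<^sub>C x"
      by (simp add: x(2) complex_vector.scale_right_diff_distrib scaleC_scaleC mult.commute)
    ultimately have "T z r (c *\<^sub>C v) = c *\<^sub>C w"
      using sandwiched_apply [OF z adjoint_op_scale [OF v]] linear_operatorD(4) [OF F_linear x(3)] by blast
    then show "T z r (c *\<^sub>C v) = c *\<^sub>C T z r v" using sandwiched_apply [OF z v x] by simp
  qed
qed

text \<open>If \<open>x\<close> solves \<open>(H s' - z) x = u\<close>, then because
  \<open>V\<close> is \<open>F\<close> followed by \<open>J\<close> and the adjoint of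
  \<open>F\<close>, the same \<open>x\<close> solves the equation for \<open>H s\<close> with
  \<open>v\<close> replaced by \<open>v + (s - s') J w\<close>, where \<open>w = F x\<close>. Both
  sides thus produce the same \<open>w\<close>.\<close>

lemma sandwiched_resolvent_identity:
  assumes z: "Im z \<noteq> 0"
  shows "T z s v = T z s' v + (s' - s) *\<^sub>R T z s (J (T z s' v))"
proof (rule dense_induct [where Q = "\<lambda>v. T z s v = T z s' v + (s' - s) *\<^sub>R T z s (J (T z s' v))"])
  show "closed {v. T z s v = T z s' v + (s' - s) *\<^sub>R T z s (J (T z s' v))}"
    by (intro closed_Collect_eq continuous_intros)
  fix v u assume v: "(v, u) \<in> F_adj"
  obtain x h where x: "(x, h) \<in> H s'" "u = h - z *\<^sub>C x" by (rule resolvent_total [OF z])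
  then obtain y0 v' where h: "h = y0 + s' *\<^sub>R v'" "(x, y0) \<in> H0" "(x, v') \<in> V"
    by (auto simp: op_line_def)
  then obtain w where w: "(x, w) \<in> F" "(J w, v') \<in> F_adj"
    unfolding V_eq by (auto simp: graph_of_def)
  have T': "T z s' v = w" by (rule sandwiched_apply [OF z v x w(1)])
  define c where "c = complex_of_real (s - s')"
  have "(v + c *\<^sub>C J w, u + c *\<^sub>C v') \<in> F_adj"
    by (intro adjoint_op_add v adjoint_op_scale w(2))
  moreover have "(x, y0 + s *\<^sub>R v') \<in> H s" using h by (auto simp: op_line_def)
  moreover have "u + c *\<^sub>C v' = y0 + s *\<^sub>R v' - z *\<^sub>C x"
    by (simp add: x(2) h(1) c_def scaleR_scaleC complex_vector.scale_left_diff_distrib)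
  ultimately have "T z s (v + c *\<^sub>C J w) = w"
    using w(1) by (intro sandwiched_apply [OF z])
  then have "w = T z s v + (s - s') *\<^sub>R T z s (J w)"
  proof -
    have "c *\<^sub>C J w = (s - s') *\<^sub>R J w" by (simp add: c_def scaleR_scaleC)
    then show ?thesis using \<open>T z s (v + c *\<^sub>C J w) = w\<close> by (simp add: blinfun.add_right blinfun.scaleR_right)
  qed
  then show "T z s v = T z s' v + (s' - s) *\<^sub>R T z s (J (T z s' v))"
    unfolding T' by (metis add_diff_cancel_right' diff_add_cancel minus_diff_eq scaleR_minus_left diff_conv_add_uminus)
qed

text \<open>Moving \<open>F\<close> to the other side gives \<open><(H - z) x, x>\<close>, where
  \<open><H x, x>\<close> is real.\<close>

lemma Im_cinner_triple:
  assumes v: "(v, u) \<in> F_adj" and x: "(x, h) \<in> H r" "u = h - z *\<^sub>C x" "(x, w) \<in> F"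
  shows "Im (cinner v w) = Im z * (norm x)\<^sup>2"
proof -
  have "(x, h) \<in> adjoint_op (H r)" using x(1) H_selfadjoint [of r] by (simp add: selfadjoint_op_def)
  then have "cinner x h = cinner h x" using x(1) by (simp add: adjoint_op_iff)
  then have "Im (cinner h x) = 0"
    by (metis cinner_commute complex_cnj_cancel_iff complex_cnj_zero_iff complex_eq_iff cnj.simps(2) neg_equal_zero)
  moreover have "cinner v w = cinner u x" using v x(3) by (simp add: adjoint_op_iff)
  ultimately show ?thesis
    unfolding x(2) by (simp add: cinner_diff_left cinner_scaleC_left cinner_self)
qed

text \<open>Approximating \<open>v\<close> from the domain of the adjoint gives vectors
  \<open>x n\<close> with \<open>F (x n)\<close> tending to \<open>T v\<close>. If the imaginary
  part vanishes, then \<open>x n\<close> tends to 0 because \<open>Im z > 0\<close>, and closedness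
  of \<open>F\<close> yields \<open>T v = 0\<close>.\<close>

lemma sandwiched_dissipative:
  assumes z: "0 < Im z"
  shows "0 \<le> Im (cinner v (T z r v))" "Im (cinner v (T z r v)) = 0 \<Longrightarrow> T z r v = 0"
proof -
  have z0: "Im z \<noteq> 0" using z by simp
  have "v \<in> closure (Domain F_adj)" using adjoint_op_densely_defined [OF F_linear F_closed] by simp
  then obtain vn where vn: "\<And>n. vn n \<in> Domain F_adj" "vn \<longlonglongrightarrow> v"
    unfolding closure_sequential by blast
  have "\<exists>x. (x, T z r (vn n)) \<in> F \<and> Im (cinner (vn n) (T z r (vn n))) = Im z * (norm x)\<^sup>2" for n
  proof -
    obtain u where u: "(vn n, u) \<in> F_adj" using vn(1) by blast
    obtain x h w where x: "(x, h) \<in> H r" "u = h - z *\<^sub>C x" "(x, w) \<in> F"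
      by (rule sandwiched_triple [OF z0 u])
    then show ?thesis using sandwiched_apply [OF z0 u x] Im_cinner_triple [OF u x] by auto
  qed
  then obtain x where x: "\<And>n. (x n, T z r (vn n)) \<in> F"
    "\<And>n. Im (cinner (vn n) (T z r (vn n))) = Im z * (norm (x n))\<^sup>2" by metis
  have Tv: "(\<lambda>n. T z r (vn n)) \<longlonglongrightarrow> T z r v" by (intro tendsto_intros vn)
  have lim: "(\<lambda>n. Im z * (norm (x n))\<^sup>2) \<longlonglongrightarrow> Im (cinner v (T z r v))"
    unfolding x(2) [symmetric] by (intro tendsto_Im tendsto_cinner vn Tv)
  show "0 \<le> Im (cinner v (T z r v))"
    by (rule LIMSEQ_le_const [OF lim]) (use z in auto)
  assume "Im (cinner v (T z r v)) = 0"
  with lim have "(\<lambda>n. inverse (Im z) * (Im z * (norm (x n))\<^sup>2)) \<longlonglongrightarrow> inverse (Im z) * 0"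
    by (intro tendsto_intros) simp
  then have "(\<lambda>n. (norm (x n))\<^sup>2) \<longlonglongrightarrow> 0" using z by (simp add: mult.assoc [symmetric])
  then have "(\<lambda>n. sqrt ((norm (x n))\<^sup>2)) \<longlonglongrightarrow> sqrt 0" by (intro tendsto_intros)
  then have "(\<lambda>n. x n) \<longlonglongrightarrow> 0" by (simp add: tendsto_norm_zero_iff)
  then have "(\<lambda>n. (x n, T z r (vn n))) \<longlonglongrightarrow> (0, T z r v)" by (intro tendsto_Pair Tv)
  then have "(0, T z r v) \<in> F" by (rule closed_sequentially [OF F_closed x(1)])
  then show "T z r v = 0" using linear_operatorD(1,2) [OF F_linear] by (auto dest: single_valuedD)
qed

section \<open>Poles of the continued operator and their multiplicities\<close>

lemma A_apply: "A z s u = T z s (J u)"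
  by (simp add: A_op_def)

lemma A_compact: "Im z \<noteq> 0 \<Longrightarrow> compact_operator (A z s)"
  unfolding A_op_def by (intro compact_operator_compose_right sandwiched_props)

lemma A_lin: "Im z \<noteq> 0 \<Longrightarrow> clinear (blinfun_apply (A z s))"
  unfolding A_apply by (intro clinear_compose [OF J_lin] sandwiched_lin)

lemma A_resolvent_identity:
  assumes z: "Im z \<noteq> 0"
  shows "A z s' u + complex_of_real (s' - s) *\<^sub>C A z s (A z s' u) = A z s u"
  using sandwiched_resolvent_identity [OF z, of s "J u" s'] by (simp add: A_apply scaleR_scaleC)

lemma A_commute:
  assumes z: "Im z \<noteq> 0"
  shows "A z s (A z s' u) = A z s' (A z s u)"
proof (cases "s = s'")
  case False
  have "complex_of_real (s' - s) *\<^sub>C A z s (A z s' u) = A z s u - A z s' u"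
    using A_resolvent_identity [OF z, of s' u s] by (simp add: algebra_simps)
  also have "\<dots> = complex_of_real (s' - s) *\<^sub>C A z s' (A z s u)"
    using A_resolvent_identity [OF z, of s u s'] by (simp add: complex_vector.scale_left_diff_distrib algebra_simps)
  finally show ?thesis using False by simp
qed simp

lemma pencil: "Im z \<noteq> 0 \<Longrightarrow> compact_pencil (A z s)"
  by (simp add: compact_pencil_def A_compact A_lin)

text \<open>For non-real \<open>z\<close> the operator \<open>A z t\<close> exists at every real
  \<open>t\<close>, and \<open>A z t\<close> composed with \<open>1 + (t - s) A z s\<close> is
  \<open>A z s\<close>. A kernel vector of the pencil is therefore killed by \<open>A z s\<close>,
  hence zero.\<close>

lemma real_not_singular:
  assumes z: "Im z \<noteq> 0"
  shows "complex_of_real t \<notin> compact_pencil.singular (A z s) (complex_of_real s)"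
proof
  interpret compact_pencil "A z s" "complex_of_real s" by (rule pencil [OF z])
  assume "complex_of_real t \<in> singular"
  then obtain u where u: "u \<noteq> 0" "u + complex_of_real (t - s) *\<^sub>C A z s u = 0" by (auto simp: singular_def)
  have "A z t (u + complex_of_real (t - s) *\<^sub>C A z s u) = A z s u"
    using A_resolvent_identity [OF z, of t u s] A_commute [OF z, of s t u]
    by (simp add: blinfun.add_right clinear_simps(2) [OF A_lin [OF z]])
  then have "A z s u = 0" unfolding u(2) by (simp add: blinfun.zero_right)
  with u show False by simp
qed

lemma mres_real:
  assumes z: "Im z \<noteq> 0"
  shows "compact_pencil.mres (A z s) (complex_of_real s) (complex_of_real t) = A z t"
proof (rule blinfun_eqI)
  interpret compact_pencil "A z s" "complex_of_real s" by (rule pencil [OF z])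
  fix u
  show "mres (complex_of_real t) u = A z t u"
    using A_resolvent_identity [OF z, of t u s]
    by (intro mres_unique real_not_singular [OF z]) simp
qed

lemma A_pole_singular:
  assumes z: "Im z \<noteq> 0" and p: "p \<in> compact_pencil.singular (A z s) (complex_of_real s)"
  shows "A_pole F J H0 V z p"
proof -
  interpret compact_pencil "A z s" "complex_of_real s" by (rule pencil [OF z])
  show ?thesis
    unfolding A_pole_def using op_meromorphic_mres is_pole_mres [OF p] mres_real [OF z] by blast
qed

text \<open>For real \<open>p\<close> the eigenvalue \<open>inverse (s - p)\<close> degenerates to 0
  at \<open>s = p\<close>, where a multiplicity would be meaningless; real points must therefore be
  excluded through \<open>A_pole\<close> itself.\<close>

lemma not_A_pole_real:
  assumes z: "Im z \<noteq> 0"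
  shows "\<not> A_pole F J H0 V z (complex_of_real x)"
proof
  assume "A_pole F J H0 V z (complex_of_real x)"
  then obtain M where M: "\<And>t::real. M (complex_of_real t) = A z t" "is_pole M (complex_of_real x)"
    by (auto simp: A_pole_def)
  interpret compact_pencil "A z x" "complex_of_real x" by (rule pencil [OF z])
  have ns: "complex_of_real x \<notin> singular" by (rule real_not_singular [OF z])
  obtain e where e: "e > 0" "\<And>w. w \<in> ball (complex_of_real x) e \<Longrightarrow> norm (mres w) \<le> 2 * norm (mres (complex_of_real x))"
    by (rule open_nonsingular [OF ns]) (rule that; assumption)
  have bd: "norm (M (complex_of_real t)) \<le> 2 * norm (A z x)" if "dist t x < e" for t
    using e(2) [of "complex_of_real t"] that M(1) mres_real [OF z]
    by (simp add: dist_norm norm_minus_commute of_real_diff [symmetric] del: of_real_diff)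
  have "\<forall>\<^sub>F t in at x. norm (M (complex_of_real t)) \<le> 2 * norm (A z x)"
    unfolding eventually_at using e(1) bd by blast
  then show False using M(2) not_is_pole_if_bounded_on_reals by blast
qed

text \<open>The resolvent identity factors the shift of \<open>A z s'\<close> as \<open>b\<close>
  after the shift \<open>W\<close> of \<open>A z s\<close>, where \<open>b\<close> commutes with
  \<open>W\<close>; so vectors killed by a power of \<open>W\<close> are killed by a power of the
  other shift. Exchanging \<open>s\<close> and \<open>s'\<close> gives equality, which is the
  independence of the multiplicity from \<open>s\<close>.\<close>

lemma gen_A_subset:
  assumes z: "Im z \<noteq> 0" and p: "Im p \<noteq> 0"
  shows "gen (A z s) (inverse (complex_of_real s - p)) \<subseteq> gen (A z s') (inverse (complex_of_real s' - p))"
proof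
  let ?\<sigma> = "inverse (complex_of_real s - p)" and ?\<sigma>' = "inverse (complex_of_real s' - p)"
  have nz: "complex_of_real s - p \<noteq> 0" "complex_of_real s' - p \<noteq> 0" using p by (auto simp: complex_eq_iff)
  define W where "W = shift (A z s) ?\<sigma>"
  have W: "clinear W" unfolding W_def by (intro clinear_shift A_lin z)
  note Al = A_lin [OF z]
  define d where "d = complex_of_real (s' - s)"
  \<comment> \<open>The quotient \<open>?\<sigma>' / ?\<sigma>\<close>, which matches the scalar
    terms of the two shifts.\<close>
  define \<kappa> where "\<kappa> = (complex_of_real s - p) * ?\<sigma>'"
  define b where "b u = \<kappa> *\<^sub>C (u - d *\<^sub>C A z s' u)" for u
  have b: "clinear b" unfolding b_def by (intro clinear_scale clinear_diff clinear_ident Al)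
  have bW: "W (b u) = b (W u)" for u
    by (simp add: W_def b_def clinear_simps(2,3) [OF Al] A_commute [OF z, of s s'] complex_vector.scale_right_diff_distrib
        scaleC_scaleC mult_ac)
  have sh: "shift (A z s') ?\<sigma>' u = b (W u)" for u
  proof -
    have id1: "A z s u = A z s' u + d *\<^sub>C A z s (A z s' u)"
      using A_resolvent_identity [OF z, of s' u s] by (simp add: d_def)
    have k1: "\<kappa> * ?\<sigma> = ?\<sigma>'" using nz by (simp add: \<kappa>_def)
    have k2: "\<kappa> + ?\<sigma>' * d = 1"
    proof -
      have "\<kappa> + ?\<sigma>' * d = ?\<sigma>' * (complex_of_real s' - p)" by (simp add: \<kappa>_def d_def algebra_simps)
      then show ?thesis using nz by simp
    qed
    have "b (W u) = \<kappa> *\<^sub>C (A z s u - d *\<^sub>C A z s' (A z s u)) - (\<kappa> * ?\<sigma>) *\<^sub>C (u - d *\<^sub>C A z s' u)"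
      by (simp add: b_def W_def clinear_simps(2,3) [OF Al] complex_vector.scale_right_diff_distrib scaleC_scaleC mult_ac algebra_simps)
    also have "A z s u - d *\<^sub>C A z s' (A z s u) = A z s' u"
      unfolding A_commute [OF z, of s' s u] using id1 by (metis add_diff_cancel_right')
    also have "\<kappa> *\<^sub>C A z s' u - (\<kappa> * ?\<sigma>) *\<^sub>C (u - d *\<^sub>C A z s' u) = (\<kappa> + ?\<sigma>' * d) *\<^sub>C A z s' u - ?\<sigma>' *\<^sub>C u"
      unfolding k1 by (simp add: complex_vector.scale_right_diff_distrib scaleC_add_left scaleC_scaleC)
    finally show ?thesis by (simp add: k2 scaleC_one)
  qed
  fix u assume "u \<in> gen (A z s) ?\<sigma>"
  then obtain n where "(W ^^ n) u = 0" by (auto simp: gen_def W_def)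
  then show "u \<in> gen (A z s') ?\<sigma>'"
  proof (induction n arbitrary: u)
    case 0
    then show ?case using complex_vector.subspace_0 [OF subspace_gen [OF Al]] by simp
  next
    case (Suc n)
    have "(W ^^ n) (b (W u)) = b ((W ^^ n) (W u))" by (rule funpow_commutes) (rule bW)
    also have "(W ^^ n) (W u) = 0" using Suc.prems by (simp only: funpow_Suc_right o_apply)
    finally have "(W ^^ n) (b (W u)) = 0" by (simp add: clinear_simps(5) [OF b])
    then have "b (W u) \<in> gen (A z s') ?\<sigma>'" by (rule Suc.IH)
    then have "shift (A z s') ?\<sigma>' u \<in> gen (A z s') ?\<sigma>'" by (simp only: sh)
    then obtain m where "(shift (A z s') ?\<sigma>' ^^ m) (shift (A z s') ?\<sigma>' u) = 0" by (auto simp: gen_def)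
    then have "(shift (A z s') ?\<sigma>' ^^ Suc m) u = 0" by (simp only: funpow_Suc_right o_apply)
    then show ?case unfolding gen_def by blast
  qed
qed

text \<open>Reduces pole counting to generalized eigenspaces of one operator with a fixed
  \<open>s\<close>, whatever \<open>s'\<close> is used in the definition.\<close>

theorem pole_multiplicity_eq:
  assumes z: "Im z \<noteq> 0"
  shows "pole_multiplicity F J H0 V z s' p =
    (if Im p = 0 then 0 else complex_vector.dim (gen (A z s) (inverse (complex_of_real s - p))))"
proof (cases "Im p = 0")
  case True
  then have "p = complex_of_real (Re p)" by (simp add: complex_eq_iff)
  then show ?thesis using True not_A_pole_real [OF z, of "Re p"] by (simp add: pole_multiplicity_def)
next
  case False
  have alg: "alg_multiplicity (A z s') (inverse (complex_of_real s' - p))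
      = complex_vector.dim (gen (A z s) (inverse (complex_of_real s - p)))"
    using gen_A_subset [OF z False, of s s'] gen_A_subset [OF z False, of s' s]
    by (simp add: alg_multiplicity_def gen_def [symmetric] equalityI)
  interpret compact_pencil "A z s" "complex_of_real s" by (rule pencil [OF z])
  show ?thesis
  proof (cases "p \<in> singular")
    case True
    then show ?thesis using A_pole_singular [OF z] False alg by (simp add: pole_multiplicity_def)
  next
    \<comment> \<open>The generalized eigenspace is trivial here, so the multiplicity is 0 whether
      or not \<open>A_pole\<close> holds.\<close>
    case ns: False
    have ps: "p \<noteq> complex_of_real s" using False by auto
    let ?\<sigma> = "inverse (complex_of_real s - p)"
    have "u = 0" if "(shift (A z s) ?\<sigma> ^^ n) u = 0" for n u
      using that
    proof (induction n arbitrary: u)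
      case (Suc n)
      have "(shift (A z s) ?\<sigma> ^^ n) (shift (A z s) ?\<sigma> u) = 0" using Suc.prems by (simp only: funpow_Suc_right o_apply)
      then have "shift (A z s) ?\<sigma> u = 0" by (rule Suc.IH)
      then have "A z s u = ?\<sigma> *\<^sub>C u" by simp
      then show ?case using ns ps singular_eigenvalue [of p] by metis
    qed simp
    then have "gen (A z s) ?\<sigma> \<subseteq> cspan {}" unfolding gen_def complex_vector.span_empty by blast
    then have "complex_vector.dim (gen (A z s) ?\<sigma>) = 0"
      using complex_vector.dim_le_card [of "gen (A z s) ?\<sigma>" "{}"] by simp
    then show ?thesis using False alg by (simp add: pole_multiplicity_def)
  qed
qed

section \<open>Boundary values\<close>

lemma sandwiched_plus_tendsto:
  assumes "s \<notin> resonance_points F H0 V lam"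
  shows "((\<lambda>y. T (Complex lam y) s) \<longlongrightarrow> sandwiched_plus F (H s) lam) (at_right 0)"
proof -
  obtain L where L: "((\<lambda>y. T (Complex lam y) s) \<longlongrightarrow> L) (at_right 0)"
    using assms by (auto simp: resonance_points_def regular_points_def)
  then have "sandwiched_plus F (H s) lam = L"
    unfolding sandwiched_plus_def by (intro tendsto_Lim) auto
  with L show ?thesis by simp
qed

lemma eventually_Im_pos: "\<forall>\<^sub>F y in at_right 0. 0 < Im (Complex lam y)"
  by (simp add: eventually_at_right_less)

text \<open>All three properties pass to the norm limit, but of dissipativity only the weak
  inequality is asserted there.\<close>

lemma sandwiched_plus_props:
  assumes s: "s \<notin> resonance_points F H0 V lam"
  shows "compact_operator (sandwiched_plus F (H s) lam)" "clinear (blinfun_apply (sandwiched_plus F (H s) lam))"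
    "0 \<le> Im (cinner v (sandwiched_plus F (H s) lam v))"
proof -
  note lim = sandwiched_plus_tendsto [OF s]
  have lim_v: "((\<lambda>y. T (Complex lam y) s v) \<longlongrightarrow> sandwiched_plus F (H s) lam v) (at_right 0)" for v
    by (intro tendsto_intros lim)
  show "compact_operator (sandwiched_plus F (H s) lam)"
  proof (rule compact_operator_limit [OF lim])
    show "\<forall>\<^sub>F y in at_right 0. compact_operator (T (Complex lam y) s)"
      using eventually_Im_pos [of lam] by eventually_elim (rule sandwiched_props(1), simp)
  qed simp
  show "clinear (blinfun_apply (sandwiched_plus F (H s) lam))"
    unfolding clinear_blinfun_iff
  proof (intro allI)
    fix c x
    have "\<forall>\<^sub>F y in at_right 0. c *\<^sub>C T (Complex lam y) s x = T (Complex lam y) s (c *\<^sub>C x)"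
      using eventually_Im_pos [of lam]
    proof eventually_elim
      case (elim y)
      then have "Im (Complex lam y) \<noteq> 0" by simp
      from clinear_simps(2) [OF sandwiched_lin [OF this]] show ?case by simp
    qed
    then have "((\<lambda>y. T (Complex lam y) s (c *\<^sub>C x)) \<longlongrightarrow> c *\<^sub>C sandwiched_plus F (H s) lam x) (at_right 0)"
      by (rule Lim_transform_eventually [rotated]) (intro tendsto_intros lim_v)
    then show "sandwiched_plus F (H s) lam (c *\<^sub>C x) = c *\<^sub>C sandwiched_plus F (H s) lam x"
      using tendsto_unique [OF _ lim_v] by (metis trivial_limit_at_right_real)
  qed
  have "((\<lambda>y. Im (cinner v (T (Complex lam y) s v))) \<longlongrightarrow> Im (cinner v (sandwiched_plus F (H s) lam v))) (at_right 0)"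
    by (intro tendsto_Im tendsto_cinner lim_v tendsto_const)
  then show "0 \<le> Im (cinner v (sandwiched_plus F (H s) lam v))"
  proof (rule tendsto_lowerbound)
    show "\<forall>\<^sub>F y in at_right 0. 0 \<le> Im (cinner v (T (Complex lam y) s v))"
      using eventually_Im_pos [of lam] by eventually_elim (rule sandwiched_dissipative(1))
  qed simp
qed

lemma A_plus_apply: "A_op_plus F J H0 V lam s u = sandwiched_plus F (H s) lam (J u)"
  by (simp add: A_op_plus_def)

lemma A_plus_compact:
  assumes s: "s \<notin> resonance_points F H0 V lam"
  shows "compact_operator (A_op_plus F J H0 V lam s)"
  unfolding A_op_plus_def by (intro compact_operator_compose_right sandwiched_plus_props s)

lemma A_plus_lin:
  assumes s: "s \<notin> resonance_points F H0 V lam"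
  shows "clinear (blinfun_apply (A_op_plus F J H0 V lam s))"
  unfolding A_plus_apply by (intro clinear_compose [OF J_lin] sandwiched_plus_props s)

lemma A_plus_tendsto:
  assumes s: "s \<notin> resonance_points F H0 V lam"
  shows "((\<lambda>y. A (Complex lam y) s) \<longlongrightarrow> A_op_plus F J H0 V lam s) (at_right 0)"
  unfolding A_op_def A_op_plus_def
  by (intro bounded_bilinear.tendsto [OF bounded_bilinear_blinfun_compose] sandwiched_plus_tendsto s tendsto_const)

end

section \<open>The resonance index as a signature\<close>

lemma hermitian_form_cinner: "hermitian_form (cinner :: 'a::chilbert_space \<Rightarrow> 'a \<Rightarrow> complex)"
  by unfold_locales (rule cinner_commute cinner_add_right cinner_scaleC_right)+

lemma gen_eigenvector:
  assumes f: "clinear f" and X: "csubspace X" "\<And>u. u \<in> X \<Longrightarrow> f u \<in> X"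
    and v: "v \<in> gen f \<tau>" "v \<in> X" "v \<noteq> 0"
  obtains w where "w \<in> X" "w \<noteq> 0" "f w = \<tau> *\<^sub>C w"
proof -
  define k where "k = (LEAST k. (shift f \<tau> ^^ k) v = 0)"
  obtain m where "(shift f \<tau> ^^ m) v = 0" using v(1) by (auto simp: gen_def)
  then have k: "(shift f \<tau> ^^ k) v = 0" unfolding k_def by (rule LeastI)
  have "k \<noteq> 0" using k v(3) by (intro notI) simp
  then obtain j where j: "k = Suc j" using not0_implies_Suc by blast
  have "(shift f \<tau> ^^ j) v \<in> X" by (rule shift_funpow_in_subspace [where f = f, OF X v(2)])
  moreover have "(shift f \<tau> ^^ j) v \<noteq> 0"
    using not_less_Least [of j "\<lambda>k. (shift f \<tau> ^^ k) v = 0"] j unfolding k_def by simp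
  moreover have "f ((shift f \<tau> ^^ j) v) = \<tau> *\<^sub>C (shift f \<tau> ^^ j) v" using k unfolding j by simp
  ultimately show thesis by (rule that)
qed

text \<open>Cauchy-Schwarz with the weights \<open>sqrt (q e)\<close> compares the norm with the
  diagonal form. The norm is a parameter because the forms live on plain complex vector spaces;
  \<open>K + 1\<close> avoids division by zero for an empty system.\<close>

lemma (in hermitian_form) orthogonal_system_coercive:
  fixes norm_a :: "'a \<Rightarrow> real" and s :: real
  assumes E: "orthogonal_system E" and pos: "\<And>e. e \<in> E \<Longrightarrow> 0 < s * Re (b e e)"
    and norm_a: "\<And>c. norm_a (\<Sum>e\<in>E. c e *\<^sub>C e) \<le> (\<Sum>e\<in>E. cmod (c e) * norm_a e)" "\<And>u. 0 \<le> norm_a u"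
  obtains c where "c > 0" "\<And>u. u \<in> cspan E \<Longrightarrow> c * (norm_a u)\<^sup>2 \<le> s * Re (b u u)"
proof -
  have fin: "finite E" using E by (simp add: orthogonal_system_def)
  define q where "q e = s * Re (b e e)" for e
  have q: "q e > 0" if "e \<in> E" for e using pos [OF that] by (simp add: q_def)
  define K where "K = (\<Sum>e\<in>E. (norm_a e / sqrt (q e))\<^sup>2)"
  have K0: "K \<ge> 0" unfolding K_def by (intro sum_nonneg) simp
  have main: "(norm_a u)\<^sup>2 \<le> K * (s * Re (b u u))" if u: "u \<in> cspan E" for u
  proof -
    obtain c where c: "u = (\<Sum>x\<in>E. c x *\<^sub>C x)" by (rule span_finite_sum [OF fin u])
    have "norm_a u \<le> (\<Sum>e\<in>E. (cmod (c e) * sqrt (q e)) * (norm_a e / sqrt (q e)))"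
    proof -
      have "norm_a u \<le> (\<Sum>e\<in>E. cmod (c e) * norm_a e)" unfolding c by (rule norm_a(1))
      also have "\<dots> = (\<Sum>e\<in>E. (cmod (c e) * sqrt (q e)) * (norm_a e / sqrt (q e)))"
        using q by (intro sum.cong refl) (simp add: less_imp_neq [symmetric] order_less_imp_not_eq2)
      finally show ?thesis .
    qed
    then have "(norm_a u)\<^sup>2 \<le> (\<Sum>e\<in>E. (cmod (c e) * sqrt (q e)) * (norm_a e / sqrt (q e)))\<^sup>2"
      using norm_a(2) by (intro power_mono)
    also have "\<dots> \<le> (\<Sum>e\<in>E. (cmod (c e) * sqrt (q e))\<^sup>2) * K"
      unfolding K_def by (rule Cauchy_Schwarz_ineq_sum)
    also have "(\<Sum>e\<in>E. (cmod (c e) * sqrt (q e))\<^sup>2) = s * Re (b u u)"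
      unfolding c orthogonal_system_form [OF E] using q
      by (simp add: sum_distrib_left power_mult_distrib less_imp_le q_def mult_ac)
    finally show ?thesis by (simp add: mult.commute)
  qed
  show thesis
  proof (rule that [of "inverse (K + 1)"])
    show "inverse (K + 1) > 0" using K0 by simp
    fix u assume u: "u \<in> cspan E"
    have "0 \<le> s * Re (b u u)"
      using orthogonal_system_definite [OF E pos u] by (cases "u = 0") (auto intro: less_imp_le)
    then have "(norm_a u)\<^sup>2 \<le> (K + 1) * (s * Re (b u u))" using main [OF u] by (simp add: distrib_right)
    then show "inverse (K + 1) * (norm_a u)\<^sup>2 \<le> s * Re (b u u)" using K0 by (simp add: field_simps)
  qed
qed

section \<open>The form \<open>b\<close> on the Riesz space of the boundary operator\<close>

locale resonance_point = resonance_setting F J H0 V D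
  for F :: "('h::{chilbert_space,second_countable_topology} \<times> 'k::{chilbert_space,second_countable_topology}) set"
    and J H0 V D +
  fixes lam s r :: real and n :: nat and P S :: "'k \<Rightarrow>\<^sub>L 'k" and E :: "'k set"
  assumes s_nonresonant: "s \<notin> resonance_points F H0 V lam"
    and r_neq_s: "r \<noteq> s"
    and riesz: "riesz_decomposition (A_op_plus F J H0 V lam s) (complex_of_real (inverse (s - r))) n P S E"
begin

abbreviation A0 :: "'k \<Rightarrow>\<^sub>L 'k" where "A0 \<equiv> A_op_plus F J H0 V lam s"
abbreviation T0 :: "'k \<Rightarrow>\<^sub>L 'k" where "T0 \<equiv> sandwiched_plus F (H s) lam"
definition \<sigma> :: complex where "\<sigma> = complex_of_real (inverse (s - r))"
abbreviation X :: "'k set" where "X \<equiv> riesz_space P"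
abbreviation Ay :: "real \<Rightarrow> 'k \<Rightarrow>\<^sub>L 'k" where "Ay y \<equiv> A (Complex lam y) s"

definition b :: "'k \<Rightarrow> 'k \<Rightarrow> complex" where "b u v = cinner u (J v)"

sublocale R: riesz_decomposition A0 \<sigma> n P S E
  unfolding \<sigma>_def by (rule riesz)

sublocale form: hermitian_form b
proof
  fix u v w :: 'k and c
  show "b u v = cnj (b v u)"
    using cinner_commute [of u "J v"] by (simp add: b_def J_selfadjoint)
  show "b u (v + w) = b u v + b u w" by (simp add: b_def blinfun.add_right cinner_add_right)
  show "b u (c *\<^sub>C v) = c * b u v" by (simp add: b_def clinear_simps(2) [OF J_lin] cinner_scaleC_right)
qed

sublocale cin: hermitian_form "cinner :: 'k \<Rightarrow> 'k \<Rightarrow> complex"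
  by (rule hermitian_form_cinner)

lemma \<sigma>_nonzero: "\<sigma> \<noteq> 0"
  using r_neq_s by (simp add: \<sigma>_def)

lemma \<sigma>_real [simp]: "Im \<sigma> = 0" "cnj \<sigma> = \<sigma>"
  by (simp_all add: \<sigma>_def)

lemma b_J: "b u v = cinner (J u) v"
  by (simp add: b_def J_selfadjoint)

lemma b_A0: "b u (A0 v) = cinner (J u) (T0 (J v))"
  by (simp add: b_J A_plus_apply)

lemma dissipative_A0: "0 \<le> Im (b u (A0 u))"
  unfolding b_A0 by (rule sandwiched_plus_props(3) [OF s_nonresonant])

lemma dissipative_W: "0 \<le> Im (b u (R.W u))"
proof -
  have "b u (R.W u) = b u (A0 u) - \<sigma> * complex_of_real (Re (b u u))"
    by (simp add: R.W_apply form.b_simps form.b_self_real [symmetric])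
  then show ?thesis using dissipative_A0 [of u] by simp
qed

text \<open>\<open>J u = 0\<close> makes \<open>u\<close> an eigenvector of \<open>A0\<close> for
  the eigenvalue 0, which cannot occur in the generalized eigenspace of the non-zero
  \<open>\<sigma>\<close>.\<close>

lemma J_eq_0_imp:
  assumes "u \<in> X" "J u = 0"
  shows "u = 0"
proof (rule shift_injective_on_gen [OF R.A_lin])
  show "u \<in> gen A0 \<sigma>"
    unfolding gen_def using R.W_nilpotent [of u] assms(1) by (auto simp: R.W_def riesz_space_def)
  show "shift A0 0 u = 0" using assms(2) by (simp add: A_plus_apply blinfun.zero_right)
qed (use \<sigma>_nonzero in simp)

text \<open>The radical of the form on the Riesz space is invariant, consists of null vectors of the
  imaginary part, and is therefore orthogonal to the whole space.\<close>

lemma nondegenerate: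
  assumes u: "u \<in> X" "\<And>v. v \<in> X \<Longrightarrow> b v u = 0"
  shows "u = 0"
proof -
  define Rad where "Rad = {u \<in> X. \<forall>v\<in>X. b v u = 0}"
  have sym: "b v (A0 u) = b (A0 v) u" if u: "u \<in> Rad" for u v
  proof -
    have "b (A0 u) u = 0" using u R.riesz_space_A by (auto simp: Rad_def)
    then have "b u (A0 u) = 0" by (rule form.b_eq_0_commute)
    then have "Im (cinner (J u) (T0 (J u))) = 0" by (simp add: b_A0)
    then have "cinner (J v) (T0 (J u)) = cinner (T0 (J v)) (J u)"
      using sandwiched_plus_props [OF s_nonresonant]
      by (intro cin.dissipative_null_vector [of "blinfun_apply T0" UNIV]) auto
    then show ?thesis by (simp add: b_A0) (simp add: b_def A_plus_apply)
  qed
  have symW: "b v (R.W u) = b (R.W v) u" if "u \<in> Rad" for u v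
    using sym [OF that, of v] by (simp add: R.W_apply form.b_simps)
  have RadW: "R.W u \<in> Rad" if "u \<in> Rad" for u
    using that R.riesz_space_W symW [OF that] by (auto simp: Rad_def)
  \<comment> \<open>On the complement \<open>y = W (S y)\<close>, and \<open>W\<close> can be moved
    onto \<open>u\<close> because \<open>u\<close> is in the radical; repeating this, nilpotency
    makes the form vanish.\<close>
  have orth: "b y u = 0" if "u \<in> Rad" "(R.W ^^ k) u = 0" "P y = 0" for k u y
    using that
  proof (induction k arbitrary: u y)
    case (Suc k)
    have "(R.W ^^ k) (R.W u) = 0" using Suc.prems(2) by (simp only: funpow_Suc_right o_apply)
    then have "b (S y) (R.W u) = 0"
      by (rule Suc.IH [OF RadW [OF Suc.prems(1)] _ R.P_S])
    then show ?case using symW [OF Suc.prems(1), of "S y"] Suc.prems(3) by (simp add: R.W_S)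
  qed simp
  have uR: "u \<in> Rad" using u by (auto simp: Rad_def)
  have "b w u = 0" for w
  proof -
    have "b (w - P w) u = 0"
    proof (rule orth [OF uR])
      show "(R.W ^^ n) u = 0" using R.W_nilpotent [of u] u(1) by (simp add: riesz_space_def)
      show "P (w - P w) = 0" by (simp add: blinfun.diff_right R.P_idem)
    qed
    moreover have "b (P w) u = 0" by (rule u(2) [OF R.riesz_space_P])
    ultimately show ?thesis by (simp add: form.b_diff_left)
  qed
  then have "cinner (J u) (J u) = 0" by (simp add: b_def)
  then have "J u = 0" by simp
  then show ?thesis by (rule J_eq_0_imp [OF u(1)])
qed

text \<open>Since \<open>(r - s) \<sigma> = - 1\<close>, the defining equation of
  \<open>\<Upsilon>\<close> is a non-zero multiple of \<open>W u = 0\<close>, and the kernel of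
  \<open>W\<close> lies in the Riesz space.\<close>

lemma Upsilon1_eq: "Upsilon1 F J H0 V lam s r = {u \<in> X. R.W u = 0}"
proof -
  have "u + (r - s) *\<^sub>R A0 u = complex_of_real (r - s) *\<^sub>C R.W u" for u
  proof -
    have "complex_of_real (r - s) * \<sigma> = - 1"
      using r_neq_s unfolding \<sigma>_def of_real_mult [symmetric] by (simp add: field_simps of_real_minus [symmetric] del: of_real_minus of_real_mult)
    then show ?thesis
      by (simp add: R.W_apply complex_vector.scale_right_diff_distrib scaleC_scaleC scaleR_scaleC scaleC_one del: of_real_diff)
  qed
  then have "u \<in> Upsilon1 F J H0 V lam s r \<longleftrightarrow> R.W u = 0" for u
    using r_neq_s by (simp add: Upsilon1_def)
  then show ?thesis using R.kernel_W by (auto simp: riesz_space_def)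
qed

definition sign_set :: "'k set \<Rightarrow> real \<Rightarrow> 'k set" where
  "sign_set Eb t = {e \<in> Eb. 0 < t * Re (b e e)}"

lemma sign_set_orthogonal:
  assumes "form.orthogonal_system Eb"
  shows "form.orthogonal_system (sign_set Eb t)"
  using assms by (auto simp: form.orthogonal_system_def sign_set_def)

lemma sign_set_card:
  assumes "form.orthogonal_system Eb"
  shows "card (sign_set Eb 1) + card (sign_set Eb (- 1)) = card Eb"
proof -
  have fin: "finite Eb" using assms by (simp add: form.orthogonal_system_def)
  have "Re (b e e) \<noteq> 0" if "e \<in> Eb" for e
    using form.b_self_real [of e] assms that by (auto simp: form.orthogonal_system_def)
  then have "Eb = sign_set Eb 1 \<union> sign_set Eb (- 1)" by (force simp: sign_set_def)
  moreover have "sign_set Eb 1 \<inter> sign_set Eb (- 1) = {}" by (auto simp: sign_set_def)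
  ultimately show ?thesis using fin by (metis card_Un_disjoint finite_Un)
qed

text \<open>A definite and an isotropic subspace meet only in 0, so each index of inertia is at most
  \<open>dim X - card C\<close>. As the two indices add up to \<open>dim X\<close>, they differ by
  at most \<open>dim X - 2 * card C\<close>.\<close>

lemma signature_bound:
  assumes Eb: "form.orthogonal_system Eb" "cspan Eb = X"
  shows "\<bar>int (card (sign_set Eb 1)) - int (card (sign_set Eb (- 1)))\<bar> \<le> int (complex_vector.dim (Upsilon1 F J H0 V lam s r))"
proof -
  have X: "csubspace X" by (rule R.subspace_riesz_space)
  have nil: "(R.W ^^ n) u = 0" if "u \<in> X" for u
    using R.W_nilpotent [of u] that by (simp add: riesz_space_def)
  obtain C where C: "finite C" "cindependent C" "C \<subseteq> X"
    "\<And>u. u \<in> cspan C \<Longrightarrow> b u u = 0"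
    "complex_vector.dim X \<le> 2 * card C + complex_vector.dim {u \<in> X. R.W u = 0}"
    by (rule form.dissipative_isotropic [OF R.W_lin X R.riesz_space_W R.E_finite R.riesz_space_in_span nil dissipative_W],
        assumption, assumption) (rule that; assumption)
  have N: "complex_vector.dim X = card Eb"
    using complex_vector.dim_span_eq_card_independent [OF form.orthogonal_system_independent [OF Eb(1)]] Eb(2) by simp
  have le: "card (sign_set Eb t) + card C \<le> complex_vector.dim X" for t
  proof (rule card_add_le_dim [OF _ C(2) _ C(3) R.E_finite R.riesz_space_in_span])
    note os = sign_set_orthogonal [OF Eb(1), of t]
    show "cindependent (sign_set Eb t)" by (rule form.orthogonal_system_independent [OF os])
    show "sign_set Eb t \<subseteq> X"
      using complex_vector.span_superset [of Eb] Eb(2) by (auto simp: sign_set_def)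
    show "cspan (sign_set Eb t) \<inter> cspan C \<subseteq> {0}"
    proof
      fix u assume u: "u \<in> cspan (sign_set Eb t) \<inter> cspan C"
      then have "b u u = 0" using C(4) by blast
      moreover have "0 < t * Re (b u u)" if "u \<noteq> 0"
        by (rule form.orthogonal_system_definite [OF os]) (use u that in \<open>auto simp: sign_set_def\<close>)
      ultimately show "u \<in> {0}" by auto
    qed
  qed
  show ?thesis
    using le [of 1] le [of "- 1"] C(5) sign_set_card [OF Eb(1)] N unfolding Upsilon1_eq by linarith
qed

text \<open>Expanding the form leaves three correction terms, each at most
  \<open>norm J * \<eta> * (norm u)^2\<close>; this is the constant 3.\<close>

lemma Re_b_perturb:
  assumes L: "norm L \<le> \<eta>" "\<eta> \<le> 1" and t: "\<bar>t\<bar> = 1"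
  shows "t * Re (b (u + blinfun_apply L u) (u + blinfun_apply L u)) \<ge> t * Re (b u u) - 3 * norm J * \<eta> * (norm u)\<^sup>2"
proof -
  have bb: "cmod (b v w) \<le> norm J * norm v * norm w" for v w
  proof -
    have "cmod (b v w) \<le> norm v * norm (J w)" unfolding b_def by (rule cinner_Cauchy_Schwarz)
    also have "\<dots> \<le> norm v * (norm J * norm w)" by (intro mult_left_mono norm_blinfun norm_ge_zero)
    finally show ?thesis by (simp add: mult_ac)
  qed
  have \<eta>0: "0 \<le> \<eta>" using L(1) norm_ge_zero order_trans by blast
  have Lu: "norm (L u) \<le> \<eta> * norm u"
    using norm_blinfun [of L u] mult_right_mono [OF L(1) norm_ge_zero [of u]] by linarith
  then have Lu1: "norm (L u) \<le> norm u"
    using mult_right_mono [OF L(2) norm_ge_zero [of u]] by simp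
  define d where "d = b u (L u) + b (L u) u + b (L u) (L u)"
  have "cmod d \<le> cmod (b u (L u)) + cmod (b (L u) u) + cmod (b (L u) (L u))"
    unfolding d_def by (meson norm_triangle_ineq norm_triangle_mono order_refl)
  also have "\<dots> \<le> norm J * norm u * (\<eta> * norm u) + norm J * (\<eta> * norm u) * norm u + norm J * (\<eta> * norm u) * norm u"
    using Lu Lu1 \<eta>0 by (intro add_mono order_trans [OF bb] mult_mono) auto
  also have "\<dots> = 3 * norm J * \<eta> * (norm u)\<^sup>2" by (simp add: power2_eq_square)
  finally have "\<bar>Re d\<bar> \<le> 3 * norm J * \<eta> * (norm u)\<^sup>2" using abs_Re_le_cmod [of d] by linarith
  moreover have "\<bar>t * Re d\<bar> = \<bar>Re d\<bar>" using t by (simp add: abs_mult)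
  moreover have "b (u + L u) (u + L u) = b u u + d" by (simp add: d_def form.b_simps)
  ultimately show ?thesis by (simp add: distrib_left)
qed

lemma Ay_definite:
  assumes y: "y > 0" and u: "Ay y u \<noteq> 0"
  shows "0 < Im (b u (Ay y u))"
proof -
  have "b u (Ay y u) = cinner (J u) (T (Complex lam y) s (J u))" by (simp add: b_J A_apply)
  moreover have "0 < Im (Complex lam y)" using y by simp
  ultimately show ?thesis
    using sandwiched_dissipative [of "Complex lam y" "J u" s] u by (fastforce simp: A_apply)
qed

text \<open>A non-zero real eigenvalue \<open>\<tau>\<close> would make the real point
  \<open>s - 1/\<tau>\<close> singular for the pencil.\<close>

lemma Ay_real_eigenvalue:
  assumes y: "y > 0" and w: "w \<noteq> 0" "Ay y w = \<tau> *\<^sub>C w" "\<tau> \<noteq> 0"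
  shows "Im \<tau> \<noteq> 0"
proof
  assume "Im \<tau> = 0"
  then obtain t where t: "\<tau> = complex_of_real t" "t \<noteq> 0" using w(3) by (metis complex_is_Real_iff Reals_cases of_real_0)
  have z: "Im (Complex lam y) \<noteq> 0" using y by simp
  interpret pen: compact_pencil "Ay y" "complex_of_real s" by (rule pencil [OF z])
  have "w + (complex_of_real (s - inverse t) - complex_of_real s) *\<^sub>C Ay y w = 0"
    using t(2) by (simp add: w(2) t(1) scaleC_scaleC scaleC_one)
  then have "complex_of_real (s - inverse t) \<in> pen.singular" using w(1) unfolding pen.singular_def by blast
  then show False using real_not_singular [OF z] by blast
qed

text \<open>A snapshot of \<open>pole_splits\<close> at a single \<open>y\<close>, with two radii:
  within \<open>e\<close> all poles are counted, while the listed points are confined to the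
  possibly smaller radius \<open>\<delta>\<close>.\<close>

definition splitting :: "real \<Rightarrow> real \<Rightarrow> real \<Rightarrow> nat \<Rightarrow> nat \<Rightarrow> (nat \<Rightarrow> complex) \<Rightarrow> bool" where
  "splitting e \<delta> y Np Nm \<rho> \<longleftrightarrow>
     (\<forall>p\<in>ball (complex_of_real r) e. \<forall>s'. card {j. j < Np + Nm \<and> \<rho> j = p} = pole_multiplicity F J H0 V (Complex lam y) s' p) \<and>
     (\<forall>j<Np + Nm. \<rho> j \<in> ball (complex_of_real r) \<delta> \<and> Im (\<rho> j) \<noteq> 0) \<and>
     card {j. j < Np + Nm \<and> Im (\<rho> j) > 0} = Np \<and> card {j. j < Np + Nm \<and> Im (\<rho> j) < 0} = Nm"

text \<open>The sign sets, moved into the perturbed Riesz space,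
  stay definite, while the eigenvectors in a half-plane span a definite subspace of the opposite
  sign; counting dimensions shows that the numbers of poles in the half-planes are the indices of
  inertia of the form.\<close>

lemma splitting_exists_aux:
  fixes \<theta> :: real
  assumes Eb: "form.orthogonal_system Eb" "cspan Eb = X"
    and pert: "riesz_perturbation A0 \<sigma> n P S E (Ay y) L"
    and L: "norm L \<le> 1" and y: "y > 0"
    and pos: "\<And>t u. \<bar>t\<bar> = 1 \<Longrightarrow> u \<in> cspan (sign_set Eb t) \<Longrightarrow> u \<noteq> 0 \<Longrightarrow> 0 < t * Re (b (u + L u) (u + L u))"
    and near: "\<And>p. p \<in> ball (complex_of_real r) e \<Longrightarrow>
      norm S * ((norm P + 2) * norm (Ay y - A0) + cmod (inverse (complex_of_real s - p) - \<sigma>)) < 1"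
    and M: "\<And>k u. norm ((R.W ^^ k) (P u)) \<le> M k * norm u"
    and \<theta>: "\<theta> > 0" "\<theta> \<le> cmod \<sigma>" "\<And>\<tau>. cmod (\<tau> - \<sigma>) < \<theta> \<Longrightarrow> complex_of_real s - inverse \<tau> \<in> ball (complex_of_real r) \<delta>"
    and small: "(\<Sum>k<n. inverse \<theta> ^ Suc k * M k) * (2 * norm (Ay y - A0)) < 1"
  obtains \<rho> where "splitting e \<delta> y (card (sign_set Eb 1)) (card (sign_set Eb (- 1))) \<rho>"
proof -
  define A' where "A' = Ay y"
  interpret Q: riesz_perturbation A0 \<sigma> n P S E A' L unfolding A'_def by (rule pert)
  define N where "N = card (sign_set Eb 1) + card (sign_set Eb (- 1))"
  have N: "N = complex_vector.dim X"
    using complex_vector.dim_span_eq_card_independent [OF form.orthogonal_system_independent [OF Eb(1)]] Eb(2)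
      sign_set_card [OF Eb(1)] by (simp add: N_def)
  have z: "Im (Complex lam y) \<noteq> 0" using y by simp
  obtain B0 where B0: "finite B0" "Q.X' \<subseteq> cspan B0" "complex_vector.dim Q.X' = N"
    unfolding N by (rule Q.X'_finite_dim)
  obtain B ev where B: "finite B" "cindependent B" "cspan B = Q.X'"
    and ev: "\<And>v. v \<in> B \<Longrightarrow> v \<in> gen A' (ev v)"
    and gen_span: "\<And>\<tau>. gen A' \<tau> \<inter> Q.X' \<subseteq> cspan {v \<in> B. ev v = \<tau>}"
    by (rule gen_basis [OF Q.A'_lin Q.subspace_X' Q.A'_X' B0(1,2)], assumption) (rule that; assumption)
  have BX: "B \<subseteq> Q.X'" using complex_vector.span_superset B(3) by blast
  have cardB: "card B = N"
    using complex_vector.dim_span_eq_card_independent [OF B(2)] B(3) B0(3) by simp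
  have eig_near: "cmod (\<tau> - \<sigma>) < \<theta>" if "w \<in> Q.X'" "w \<noteq> 0" "A' w = \<tau> *\<^sub>C w" for w \<tau>
    by (rule Q.eigenvalue_near [OF M \<theta>(1) _ L that]) (use small in \<open>simp add: A'_def\<close>)
  have ev_props: "cmod (ev v - \<sigma>) < \<theta>" "ev v \<noteq> 0" "Im (ev v) \<noteq> 0" if v: "v \<in> B" for v
  proof -
    have v0: "v \<noteq> 0" using v B(2) complex_vector.dependent_zero by blast
    obtain w where w: "w \<in> Q.X'" "w \<noteq> 0" "A' w = ev v *\<^sub>C w"
      using gen_eigenvector [OF Q.A'_lin Q.subspace_X' Q.A'_X' ev [OF v] _ v0] v BX by blast
    show 1: "cmod (ev v - \<sigma>) < \<theta>" by (rule eig_near [OF w])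
    then show 2: "ev v \<noteq> 0" using \<theta>(2) by auto
    show "Im (ev v) \<noteq> 0" using w 2 y unfolding A'_def by (intro Ay_real_eigenvalue)
  qed
  obtain h where h: "bij_betw h {0..<card B} B" using ex_bij_betw_nat_finite [OF B(1)] by blast
  define pl where "pl v = complex_of_real s - inverse (ev v)" for v
  define \<rho> where "\<rho> j = pl (h j)" for j
  have hB: "h j \<in> B" if "j < N" for j using bij_betwE [OF h] that by (auto simp: cardB)
  \<comment> \<open>The eigenvalue and the pole \<open>s - 1/\<tau>\<close> belonging to it lie in
    the same half-plane.\<close>
  have Im_pl: "Im (pl v) = Im (ev v) / (cmod (ev v))\<^sup>2" for v
    by (simp add: pl_def cmod_power2)
  have pl_sign: "0 < t * Im (pl v) \<longleftrightarrow> 0 < t * Im (ev v)" if "v \<in> B" for v t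
  proof -
    have "0 < (cmod (ev v))\<^sup>2" using ev_props(2) [OF that] by simp
    then show ?thesis by (simp add: Im_pl zero_less_divide_iff times_divide_eq_right [symmetric] del: times_divide_eq_right)
       (simp add: zero_less_mult_iff zero_less_divide_iff divide_less_0_iff)
  qed
  have count: "card {j. j < N \<and> Q' (\<rho> j)} = card {v \<in> B. Q' (pl v)}" for Q' :: "complex \<Rightarrow> bool"
  proof -
    have "h ` {j. j < N \<and> Q' (\<rho> j)} = {v \<in> B. Q' (pl v)}"
      using h cardB unfolding bij_betw_def \<rho>_def by force
    moreover have "inj_on h {j. j < N \<and> Q' (\<rho> j)}"
      using h cardB by (auto simp: bij_betw_def intro: inj_on_subset)
    ultimately show ?thesis using card_image by fastforce
  qed
  \<comment> \<open>The lifted sign set is definite of sign \<open>t\<close> and the eigenvectors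
    counted are definite of sign \<open>- t\<close>, so their spans meet only in 0 inside a space of
    dimension \<open>N\<close>.\<close>
  have half: "card (sign_set Eb t) + card {v \<in> B. t * Im (ev v) < 0} \<le> N" if t: "\<bar>t\<bar> = 1" for t :: real
  proof -
    let ?B = "{v \<in> B. t * Im (ev v) < 0}"
    define Y where "Y = cspan (\<Union>\<tau>\<in>{\<tau>. 0 < (- t) * Im \<tau>}. gen A' \<tau> \<inter> Q.X')"
    have YX: "Y \<subseteq> Q.X'" unfolding Y_def by (intro complex_vector.span_minimal Q.subspace_X') blast
    have neg: "0 < (- t) * Re (b u u)" if u: "u \<in> Y" "u \<noteq> 0" for u
    proof (rule form.dissipative_definite [OF Q.A'_lin Q.subspace_X' Q.A'_X' B0(1,2) _ Y_def _ u])
      fix w assume w: "w \<in> Y" "w \<noteq> 0"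
      \<comment> \<open>Strict dissipation needs \<open>A' w\<close> to be non-zero. The eigenvalue
        0 is excluded because its distance from \<open>\<sigma>\<close> is
        \<open>cmod \<sigma>\<close>, which is at least \<open>\<theta>\<close>.\<close>
      have "A' w \<noteq> 0"
      proof
        assume "A' w = 0"
        then have "cmod (0 - \<sigma>) < \<theta>" using w YX by (intro eig_near [of w]) auto
        then show False using \<theta>(2) by simp
      qed
      then show "0 < Im (b w (A' w))" unfolding A'_def by (rule Ay_definite [OF y])
    qed auto
    have BY: "cspan ?B \<subseteq> Y"
      unfolding Y_def using ev BX by (intro complex_vector.span_mono) auto
    have os: "form.orthogonal_system (sign_set Eb t)" by (rule sign_set_orthogonal [OF Eb(1)])
    have sX: "sign_set Eb t \<subseteq> X"
      using complex_vector.span_superset [of Eb] Eb(2) by (auto simp: sign_set_def)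
    let ?G = "(\<lambda>u. u + L u) ` sign_set Eb t"
    have G: "cindependent ?G" "card ?G = card (sign_set Eb t)"
      by (rule Q.independent_graph_image [OF form.orthogonal_system_independent [OF os] sX])+
    have "card ?G + card ?B \<le> complex_vector.dim Q.X'"
    proof (rule card_add_le_dim [OF G(1) _ _ _ B0(1,2)])
      show "cindependent ?B" by (rule complex_vector.independent_mono [OF B(2)]) auto
      show "?G \<subseteq> Q.X'" unfolding Q.X'_eq_image using sX by blast
      show "?B \<subseteq> Q.X'" using BX by auto
      show "cspan ?G \<inter> cspan ?B \<subseteq> {0}"
      proof
        fix w assume w: "w \<in> cspan ?G \<inter> cspan ?B"
        have "cspan ?G = (\<lambda>u. u + L u) ` cspan (sign_set Eb t)"
          by (rule cpair.linear_span_image [OF Q.graph_map_lin])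
        then obtain u where u: "u \<in> cspan (sign_set Eb t)" "w = u + L u" using w by auto
        show "w \<in> {0}"
        proof (rule ccontr)
          assume "w \<notin> {0}"
          then have w0: "w \<noteq> 0" by simp
          then have "u \<noteq> 0" using u(2) by (auto simp: blinfun.zero_right)
          then have "0 < t * Re (b w w)" unfolding u(2) by (rule pos [OF t u(1)])
          moreover have "0 < (- t) * Re (b w w)" using w BY w0 by (intro neg) auto
          ultimately show False by simp
        qed
      qed
    qed
    then show ?thesis by (simp add: G(2) B0(3))
  qed
  have split: "card {v \<in> B. Im (ev v) < 0} + card {v \<in> B. 0 < Im (ev v)} = N"
  proof -
    have "{v \<in> B. Im (ev v) < 0} \<union> {v \<in> B. 0 < Im (ev v)} = B"
      using ev_props(3) by (auto simp: neq_iff)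
    moreover have "{v \<in> B. Im (ev v) < 0} \<inter> {v \<in> B. 0 < Im (ev v)} = {}" by auto
    ultimately show ?thesis
      using card_Un_disjoint [of "{v \<in> B. Im (ev v) < 0}" "{v \<in> B. 0 < Im (ev v)}"] B(1) cardB by simp
  qed
  \<comment> \<open>The two instances of \<open>half\<close> add up to an inequality between
    \<open>2 * N\<close> and itself, so both are equalities.\<close>
  have counts: "card {v \<in> B. 0 < Im (ev v)} = card (sign_set Eb 1)" "card {v \<in> B. Im (ev v) < 0} = card (sign_set Eb (- 1))"
    using half [of 1] half [of "- 1"] split by (simp_all add: N_def)
  have "splitting e \<delta> y (card (sign_set Eb 1)) (card (sign_set Eb (- 1))) \<rho>"
    unfolding splitting_def N_def [symmetric]
  proof (intro conjI ballI allI impI)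
    fix j assume "j < N"
    then have v: "h j \<in> B" by (rule hB)
    show "\<rho> j \<in> ball (complex_of_real r) \<delta>"
      unfolding \<rho>_def pl_def by (rule \<theta>(3) [OF ev_props(1) [OF v]])
    show "Im (\<rho> j) \<noteq> 0"
      unfolding \<rho>_def Im_pl using ev_props(2,3) [OF v] by simp
  next
    have "{v \<in> B. 0 < Im (pl v)} = {v \<in> B. 0 < Im (ev v)}" using pl_sign [of _ 1] by auto
    then show "card {j. j < N \<and> 0 < Im (\<rho> j)} = card (sign_set Eb 1)"
      using count [of "\<lambda>p. 0 < Im p"] counts(1) by simp
    have "{v \<in> B. Im (pl v) < 0} = {v \<in> B. Im (ev v) < 0}" using pl_sign [of _ "- 1"] by auto
    then show "card {j. j < N \<and> Im (\<rho> j) < 0} = card (sign_set Eb (- 1))"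
      using count [of "\<lambda>p. Im p < 0"] counts(2) by simp
  next
    fix p and s' :: real assume p: "p \<in> ball (complex_of_real r) e"
    show "card {j. j < N \<and> \<rho> j = p} = pole_multiplicity F J H0 V (Complex lam y) s' p"
    proof (cases "Im p = 0")
      case True
      have "Im (\<rho> j) \<noteq> 0" if "j < N" for j
        unfolding \<rho>_def Im_pl using ev_props(2,3) [OF hB [OF that]] by simp
      then have "{j. j < N \<and> \<rho> j = p} = {}" using True by auto
      then show ?thesis using True by (simp add: pole_multiplicity_eq [OF z, where s = s])
    next
      case False
      let ?\<tau> = "inverse (complex_of_real s - p)"
      have sp: "complex_of_real s - p \<noteq> 0" using False by (auto simp: complex_eq_iff)
      have eq: "{v \<in> B. pl v = p} = {v \<in> B. ev v = ?\<tau>}"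
        unfolding pl_def using ev_props(2) sp by (auto simp: field_simps)
      \<comment> \<open>Without this inclusion, \<open>B\<close> might count only a part of the
        multiplicity.\<close>
      have "gen A' ?\<tau> \<subseteq> Q.X'"
        by (rule Q.gen_subset_X' [OF _ L]) (use near [OF p] in \<open>simp add: A'_def\<close>)
      then have gs: "gen A' ?\<tau> \<subseteq> cspan {v \<in> B. ev v = ?\<tau>}" using gen_span [of ?\<tau>] by blast
      have "complex_vector.dim (gen A' ?\<tau>) = card {v \<in> B. ev v = ?\<tau>}"
      proof (rule complex_vector.dim_unique [OF _ gs _ refl])
        show "{v \<in> B. ev v = ?\<tau>} \<subseteq> gen A' ?\<tau>"
        proof
          fix v assume v: "v \<in> {v \<in> B. ev v = ?\<tau>}"
          then have "v \<in> gen A' (ev v)" by (intro ev) simp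
          then show "v \<in> gen A' ?\<tau>" using v by simp
        qed
        show "cindependent {v \<in> B. ev v = ?\<tau>}"
          by (rule complex_vector.independent_mono [OF B(2)]) auto
      qed
      then show ?thesis
        using count [of "\<lambda>q. q = p"] False unfolding pole_multiplicity_eq [OF z, where s = s] eq A'_def by simp
    qed
  qed
  then show thesis by (rule that)
qed

text \<open>The radius \<open>e\<close> is fixed before \<open>\<delta>\<close>. This uniformity
  later allows a list chosen once, with radius \<open>e\<close>, to be compared with lists confined
  to arbitrarily small discs.\<close>

theorem splitting_exists:
  assumes Eb: "form.orthogonal_system Eb" "cspan Eb = X"
  obtains e where "e > 0" "\<And>\<delta>. \<delta> > 0 \<Longrightarrow>
    \<forall>\<^sub>F y in at_right 0. \<exists>\<rho>. splitting e \<delta> y (card (sign_set Eb 1)) (card (sign_set Eb (- 1))) \<rho>"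
proof -
  have coercive: "\<exists>c>0. \<forall>u\<in>cspan (sign_set Eb t). c * (norm u)\<^sup>2 \<le> t * Re (b u u)" for t
  proof -
    show ?thesis
    proof (rule form.orthogonal_system_coercive [OF sign_set_orthogonal [OF Eb(1), of t], where s = t and norm_a = norm])
      show "norm (\<Sum>e\<in>sign_set Eb t. c e *\<^sub>C e) \<le> (\<Sum>e\<in>sign_set Eb t. cmod (c e) * norm e)" for c
        by (rule order_trans [OF norm_sum]) simp
      show "0 < t * Re (b e e)" if "e \<in> sign_set Eb t" for e using that by (simp add: sign_set_def)
    qed auto
  qed
  obtain c1 c2 where c12: "c1 > 0" "\<And>u. u \<in> cspan (sign_set Eb 1) \<Longrightarrow> c1 * (norm u)\<^sup>2 \<le> 1 * Re (b u u)"
    "c2 > 0" "\<And>u. u \<in> cspan (sign_set Eb (- 1)) \<Longrightarrow> c2 * (norm u)\<^sup>2 \<le> (- 1) * Re (b u u)"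
    using coercive [of 1] coercive [of "- 1"] by blast
  define c where "c = min c1 c2"
  have c: "c > 0" "c * (norm u)\<^sup>2 \<le> t * Re (b u u)" if "\<bar>t\<bar> = 1" "u \<in> cspan (sign_set Eb t)" for t u
  proof -
    show "c > 0" using c12 by (simp add: c_def)
    have "c * (norm u)\<^sup>2 \<le> c1 * (norm u)\<^sup>2" "c * (norm u)\<^sup>2 \<le> c2 * (norm u)\<^sup>2"
      by (simp_all add: c_def mult_right_mono)
    moreover have "t = 1 \<or> t = - 1" using that(1) by linarith
    ultimately show "c * (norm u)\<^sup>2 \<le> t * Re (b u u)" using c12 that(2) by fastforce
  qed
  have c0: "c > 0" using c12 by (simp add: c_def)
  \<comment> \<open>Keeps the loss \<open>3 * norm J * \<eta>\<close> below the coercivity constant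
    \<open>c\<close>, so lifting to the graph preserves definiteness of the sign sets.\<close>
  define \<eta> where "\<eta> = min 1 (c / (3 * norm J + 1))"
  have \<eta>: "0 < \<eta>" "\<eta> \<le> 1" using c0 by (auto simp: \<eta>_def add_nonneg_pos)
  have \<eta>J: "3 * norm J * \<eta> < c"
  proof -
    have "3 * norm J * \<eta> \<le> 3 * norm J * (c / (3 * norm J + 1))"
      by (intro mult_left_mono) (auto simp: \<eta>_def)
    also have "\<dots> < c"
    proof -
      have "3 * norm J + 1 > 0" by (simp add: add_nonneg_pos)
      then show ?thesis
        unfolding times_divide_eq_right using c0 by (subst pos_divide_less_eq) (auto simp: algebra_simps)
    qed
    finally show ?thesis .
  qed
  obtain \<epsilon>1 where \<epsilon>1: "\<epsilon>1 > 0" "\<And>A'. clinear (blinfun_apply A') \<Longrightarrow> norm (A' - A0) < \<epsilon>1 \<Longrightarrow>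
    \<exists>L. norm L \<le> \<eta> \<and> riesz_perturbation A0 \<sigma> n P S E A' L"
    by (rule R.perturbation_exists [OF \<eta>]) blast
  \<comment> \<open>\<open>\<eta>0\<close> limits the distance of eigenvalues and
    \<open>\<epsilon>2\<close> below that of operators; each contributes at most one half to the
    bound \<open>near\<close>, the first of them strictly less.\<close>
  define \<eta>0 where "\<eta>0 = inverse (2 * (norm S + 1))"
  have \<eta>0: "\<eta>0 > 0" "norm S * \<eta>0 < 1 / 2"
  proof -
    have S1: "norm S + 1 > 0" by (simp add: add_nonneg_pos)
    then show "\<eta>0 > 0" by (simp add: \<eta>0_def)
    have "norm S * \<eta>0 = (norm S / (norm S + 1)) / 2"
      unfolding \<eta>0_def by (simp only: divide_inverse inverse_mult_distrib mult_ac)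
    also have "\<dots> < 1 / 2"
      using S1 by (intro divide_strict_right_mono) (subst pos_divide_less_eq, auto)
    finally show "norm S * \<eta>0 < 1 / 2" .
  qed
  define \<epsilon>2 where "\<epsilon>2 = inverse (2 * (norm S + 1) * (norm P + 2))"
  have \<epsilon>2: "\<epsilon>2 > 0" by (auto simp: \<epsilon>2_def add_nonneg_pos)
  have \<epsilon>2': "norm S * ((norm P + 2) * \<epsilon>2) \<le> 1 / 2"
  proof -
    have "(norm P + 2) * \<epsilon>2 = \<eta>0"
      using norm_ge_zero [of P] by (simp add: \<epsilon>2_def \<eta>0_def add_nonneg_eq_0_iff)
    then show ?thesis using \<eta>0 by simp
  qed
  have sr: "complex_of_real s - complex_of_real r \<noteq> 0" using r_neq_s by simp
  have "((\<lambda>p. inverse (complex_of_real s - p)) \<longlongrightarrow> inverse (complex_of_real s - complex_of_real r)) (at (complex_of_real r))"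
    using sr by (intro tendsto_intros)
  moreover have inv_\<sigma>: "inverse (complex_of_real s - complex_of_real r) = \<sigma>" by (simp add: \<sigma>_def)
  ultimately have "\<forall>\<^sub>F p in at (complex_of_real r). dist (inverse (complex_of_real s - p)) \<sigma> < \<eta>0"
    using tendstoD \<eta>0(1) by metis
  then obtain e where e: "e > 0" "\<And>p. p \<noteq> complex_of_real r \<Longrightarrow> dist p (complex_of_real r) < e \<Longrightarrow> dist (inverse (complex_of_real s - p)) \<sigma> < \<eta>0"
    unfolding eventually_at by blast
  have e': "cmod (inverse (complex_of_real s - p) - \<sigma>) < \<eta>0" if "p \<in> ball (complex_of_real r) e" for p
    unfolding dist_norm [symmetric] using e(2) [of p] that \<eta>0(1) inv_\<sigma>
    by (cases "p = complex_of_real r") (simp_all add: dist_commute)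
  obtain M where M: "\<And>k u. norm ((R.W ^^ k) (P u)) \<le> M k * norm u" by (rule R.nilpotent_bounds) (rule that)
  show thesis
  proof (rule that [OF e(1)])
    fix \<delta> :: real assume \<delta>: "\<delta> > 0"
    have "((\<lambda>\<tau>. complex_of_real s - inverse \<tau>) \<longlongrightarrow> complex_of_real s - inverse \<sigma>) (at \<sigma>)"
      using \<sigma>_nonzero by (intro tendsto_intros)
    moreover have s\<sigma>: "complex_of_real s - inverse \<sigma> = complex_of_real r" by (simp add: \<sigma>_def)
    ultimately have "\<forall>\<^sub>F \<tau> in at \<sigma>. dist (complex_of_real s - inverse \<tau>) (complex_of_real r) < \<delta>"
      using tendstoD \<delta> by metis
    then obtain \<theta>' where \<theta>': "\<theta>' > 0" "\<And>\<tau>. \<tau> \<noteq> \<sigma> \<Longrightarrow> dist \<tau> \<sigma> < \<theta>' \<Longrightarrow> dist (complex_of_real s - inverse \<tau>) (complex_of_real r) < \<delta>"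
      unfolding eventually_at by blast
    define \<theta> where "\<theta> = min \<theta>' (cmod \<sigma>)"
    have \<theta>0: "\<theta> > 0" "\<theta> \<le> cmod \<sigma>" using \<theta>'(1) \<sigma>_nonzero by (auto simp: \<theta>_def)
    have \<theta>: "complex_of_real s - inverse \<tau> \<in> ball (complex_of_real r) \<delta>" if "cmod (\<tau> - \<sigma>) < \<theta>" for \<tau>
      using \<theta>'(2) [of \<tau>] that \<delta> s\<sigma> by (cases "\<tau> = \<sigma>") (auto simp: \<theta>_def dist_commute dist_norm norm_minus_commute)
    define K where "K = (\<Sum>k<n. inverse \<theta> ^ Suc k * M k)"
    \<comment> \<open>The smallness required by \<open>eigenvalue_near\<close>; the absolute value
      appears because no sign of \<open>M\<close> is known.\<close>
    define \<epsilon>3 where "\<epsilon>3 = inverse (2 * (\<bar>K\<bar> + 1))"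
    have \<epsilon>3: "\<epsilon>3 > 0" by (simp add: \<epsilon>3_def add_nonneg_pos)
    have "\<forall>\<^sub>F y in at_right 0. dist (Ay y) A0 < min \<epsilon>1 (min \<epsilon>2 \<epsilon>3)"
      using A_plus_tendsto [OF s_nonresonant] \<epsilon>1(1) \<epsilon>2 \<epsilon>3 by (intro tendstoD) auto
    then show "\<forall>\<^sub>F y in at_right 0. \<exists>\<rho>. splitting e \<delta> y (card (sign_set Eb 1)) (card (sign_set Eb (- 1))) \<rho>"
      using eventually_Im_pos [of lam]
    proof eventually_elim
      case (elim y)
      have y: "y > 0" using elim(2) by simp
      have close: "norm (Ay y - A0) < \<epsilon>1" "norm (Ay y - A0) < \<epsilon>2" "norm (Ay y - A0) < \<epsilon>3"
        using elim(1) by (auto simp: dist_norm)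
      have "clinear (blinfun_apply (Ay y))" using y by (intro A_lin) simp
      then obtain L where L: "norm L \<le> \<eta>" "riesz_perturbation A0 \<sigma> n P S E (Ay y) L"
        using \<epsilon>1(2) close(1) by blast
      have L1: "norm L \<le> 1" using L(1) \<eta>(2) by simp
      have pos: "0 < t * Re (b (u + L u) (u + L u))"
        if t: "\<bar>t\<bar> = 1" and u: "u \<in> cspan (sign_set Eb t)" "u \<noteq> 0" for t u
      proof -
        have "3 * norm J * \<eta> * (norm u)\<^sup>2 < c * (norm u)\<^sup>2"
          using \<eta>J u(2) by (intro mult_strict_right_mono) auto
        then show ?thesis using Re_b_perturb [OF L(1) \<eta>(2) t, of u] c(2) [OF t u(1)] by linarith
      qed
      have near: "norm S * ((norm P + 2) * norm (Ay y - A0) + cmod (inverse (complex_of_real s - p) - \<sigma>)) < 1"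
        if "p \<in> ball (complex_of_real r) e" for p
      proof -
        have "norm S * ((norm P + 2) * norm (Ay y - A0)) \<le> norm S * ((norm P + 2) * \<epsilon>2)"
          using close(2) by (intro mult_left_mono) auto
        moreover have "norm S * cmod (inverse (complex_of_real s - p) - \<sigma>) \<le> norm S * \<eta>0"
          using e' [OF that] by (intro mult_left_mono) auto
        ultimately show ?thesis using \<epsilon>2' \<eta>0(2) by (simp only: distrib_left)
      qed
      have "K * (2 * norm (Ay y - A0)) \<le> \<bar>K\<bar> * (2 * \<epsilon>3)"
        using close(3) by (intro mult_mono) auto
      also have "\<dots> < 1" by (simp add: \<epsilon>3_def field_simps add_nonneg_pos)
      finally have small: "(\<Sum>k<n. inverse \<theta> ^ Suc k * M k) * (2 * norm (Ay y - A0)) < 1" by (simp only: K_def)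
      obtain \<rho> where "splitting e \<delta> y (card (sign_set Eb 1)) (card (sign_set Eb (- 1))) \<rho>"
        by (rule splitting_exists_aux [OF Eb L(2) L1 y pos near M \<theta>0 \<theta> small])
      then show ?case by blast
    qed
  qed
qed

text \<open>The lists are chosen separately for each \<open>y\<close>, with no continuity in
  \<open>y\<close>. They nevertheless converge: any list confined to radius \<open>\<delta>\<close>
  has the same multiplicities within \<open>e\<close>, so every chosen point occurs in it.\<close>

theorem pole_splits_exists:
  assumes Eb: "form.orthogonal_system Eb" "cspan Eb = X"
  shows "\<exists>\<rho>. pole_splits F J H0 V lam r (card (sign_set Eb 1) + card (sign_set Eb (- 1))) \<rho>
    (card (sign_set Eb 1)) (card (sign_set Eb (- 1)))"
proof -
  define Np where "Np = card (sign_set Eb 1)"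
  define Nm where "Nm = card (sign_set Eb (- 1))"
  obtain e where e: "e > 0" "\<And>\<delta>. \<delta> > 0 \<Longrightarrow> \<forall>\<^sub>F y in at_right 0. \<exists>\<rho>. splitting e \<delta> y Np Nm \<rho>"
    unfolding Np_def Nm_def by (rule splitting_exists [OF Eb]) blast
  define \<rho> where "\<rho> j y = (SOME \<rho>. splitting e e y Np Nm \<rho>) j" for j y
  have ev: "\<forall>\<^sub>F y in at_right 0. splitting e e y Np Nm (\<lambda>j. \<rho> j y)"
    using e(2) [OF e(1)]
  proof eventually_elim
    case (elim y)
    then show ?case unfolding \<rho>_def by (rule someI_ex)
  qed
  have lim: "(\<rho> j \<longlongrightarrow> complex_of_real r) (at_right 0)" if j: "j < Np + Nm" for j
  proof (rule tendstoI)
    fix \<delta> :: real assume \<delta>: "\<delta> > 0"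
    show "\<forall>\<^sub>F y in at_right 0. dist (\<rho> j y) (complex_of_real r) < \<delta>"
      using ev e(2) [OF \<delta>]
    proof eventually_elim
      case (elim y)
      then obtain \<rho>' where \<rho>': "splitting e \<delta> y Np Nm \<rho>'" by blast
      have in_e: "\<rho> j y \<in> ball (complex_of_real r) e" using elim(1) j by (simp add: splitting_def)
      have "card {i. i < Np + Nm \<and> \<rho>' i = \<rho> j y} = card {i. i < Np + Nm \<and> \<rho> i y = \<rho> j y}"
        using \<rho>' elim(1) in_e by (simp add: splitting_def)
      moreover have "{i. i < Np + Nm \<and> \<rho> i y = \<rho> j y} \<noteq> {}" using j by auto
      then have "card {i. i < Np + Nm \<and> \<rho> i y = \<rho> j y} \<noteq> 0" by simp
      ultimately have "{i. i < Np + Nm \<and> \<rho>' i = \<rho> j y} \<noteq> {}" by (metis card.empty)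
      then obtain i where "i < Np + Nm" "\<rho>' i = \<rho> j y" by blast
      then show ?case using \<rho>' by (auto simp: splitting_def dist_commute)
    qed
  qed
  have "pole_splits F J H0 V lam r (Np + Nm) \<rho> Np Nm"
    unfolding pole_splits_def
  proof (intro conjI allI impI)
    show "\<exists>e>0. \<forall>\<^sub>F y in at_right 0. \<forall>p\<in>ball (complex_of_real r) e. \<forall>s::real.
        card {j. j < Np + Nm \<and> \<rho> j y = p} = pole_multiplicity F J H0 V (Complex lam y) s p"
      using e(1) ev by (intro exI [of _ e] conjI) (auto elim!: eventually_mono simp: splitting_def)
    show "\<forall>\<^sub>F y in at_right 0. (\<forall>j<Np + Nm. Im (\<rho> j y) \<noteq> 0) \<and>
        card {j. j < Np + Nm \<and> 0 < Im (\<rho> j y)} = Np \<and> card {j. j < Np + Nm \<and> Im (\<rho> j y) < 0} = Nm"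
      using ev by (auto elim!: eventually_mono simp: splitting_def)
  qed (rule lim)
  then show ?thesis unfolding Np_def Nm_def by blast
qed

end

text \<open>Two lists with the same multiplicities on a set containing both are equal up to order,
  so any property holds for equally many entries.\<close>

lemma card_preimage_eq:
  fixes \<rho> \<rho>' :: "nat \<Rightarrow> complex"
  assumes "\<And>p. p \<in> U \<Longrightarrow> card {j. j < N \<and> \<rho> j = p} = card {j. j < N' \<and> \<rho>' j = p}"
    and "\<And>j. j < N \<Longrightarrow> \<rho> j \<in> U" "\<And>j. j < N' \<Longrightarrow> \<rho>' j \<in> U"
  shows "card {j. j < N \<and> Q (\<rho> j)} = card {j. j < N' \<and> Q (\<rho>' j)}"
proof -
  define Z where "Z = {p \<in> \<rho> ` {..<N} \<union> \<rho>' ` {..<N'}. Q p}"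
  have Z: "finite Z" "Z \<subseteq> U" using assms(2,3) by (auto simp: Z_def)
  have eq: "card {j. j < K \<and> Q (f j)} = (\<Sum>p\<in>Z. card {j. j < K \<and> f j = p})"
    if "f ` {..<K} \<subseteq> \<rho> ` {..<N} \<union> \<rho>' ` {..<N'}" for K and f :: "nat \<Rightarrow> complex"
  proof -
    have "{j. j < K \<and> Q (f j)} = (\<Union>p\<in>Z. {j. j < K \<and> f j = p})" using that by (auto simp: Z_def)
    moreover have "card (\<Union>p\<in>Z. {j. j < K \<and> f j = p}) = (\<Sum>p\<in>Z. card {j. j < K \<and> f j = p})"
      using Z(1) by (intro card_UN_disjoint) auto
    ultimately show ?thesis by simp
  qed
  have "(\<Sum>p\<in>Z. card {j. j < N \<and> \<rho> j = p}) = (\<Sum>p\<in>Z. card {j. j < N' \<and> \<rho>' j = p})"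
    using assms(1) Z(2) by (intro sum.cong) auto
  then show ?thesis using eq [of \<rho> N] eq [of \<rho>' N'] by simp
qed

text \<open>For a single small \<open>y\<close>, both lists lie in the common disc, where each
  records the pole multiplicities. Together with existence this makes the definite description in
  \<open>res_index\<close> meaningful.\<close>

lemma pole_splits_unique:
  assumes 1: "pole_splits F J H0 V lam r N \<rho> Np Nm" and 2: "pole_splits F J H0 V lam r N' \<rho>' Np' Nm'"
  shows "Np = Np'" "Nm = Nm'"
proof -
  obtain e where e: "e > 0" "\<forall>\<^sub>F y in at_right 0. \<forall>p\<in>ball (complex_of_real r) e. \<forall>s::real.
        card {j. j < N \<and> \<rho> j y = p} = pole_multiplicity F J H0 V (Complex lam y) s p"
    using 1 unfolding pole_splits_def by blast
  obtain e' where e': "e' > 0" "\<forall>\<^sub>F y in at_right 0. \<forall>p\<in>ball (complex_of_real r) e'. \<forall>s::real.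
        card {j. j < N' \<and> \<rho>' j y = p} = pole_multiplicity F J H0 V (Complex lam y) s p"
    using 2 unfolding pole_splits_def by blast
  define \<delta> where "\<delta> = min e e'"
  have \<delta>: "\<delta> > 0" using e(1) e'(1) by (simp add: \<delta>_def)
  have l1: "\<forall>\<^sub>F y in at_right 0. \<forall>j\<in>{..<N}. dist (\<rho> j y) (complex_of_real r) < \<delta>"
    using 1 \<delta> by (intro eventually_ball_finite ballI) (auto simp: pole_splits_def tendsto_iff)
  have l2: "\<forall>\<^sub>F y in at_right 0. \<forall>j\<in>{..<N'}. dist (\<rho>' j y) (complex_of_real r) < \<delta>"
    using 2 \<delta> by (intro eventually_ball_finite ballI) (auto simp: pole_splits_def tendsto_iff)
  have c1: "\<forall>\<^sub>F y in at_right 0. card {j. j < N \<and> Im (\<rho> j y) > 0} = Np \<and> card {j. j < N \<and> Im (\<rho> j y) < 0} = Nm"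
    using 1 unfolding pole_splits_def by (auto elim: eventually_mono)
  have c2: "\<forall>\<^sub>F y in at_right 0. card {j. j < N' \<and> Im (\<rho>' j y) > 0} = Np' \<and> card {j. j < N' \<and> Im (\<rho>' j y) < 0} = Nm'"
    using 2 unfolding pole_splits_def by (auto elim: eventually_mono)
  have "\<forall>\<^sub>F y::real in at_right 0. Np = Np' \<and> Nm = Nm'"
    using e(2) e'(2) l1 l2 c1 c2
  proof eventually_elim
    case (elim y)
    have eq: "card {j. j < N \<and> Q (\<rho> j y)} = card {j. j < N' \<and> Q (\<rho>' j y)}" for Q
    proof (rule card_preimage_eq [where U = "ball (complex_of_real r) \<delta>"])
      fix p assume "p \<in> ball (complex_of_real r) \<delta>"
      then have "p \<in> ball (complex_of_real r) e" "p \<in> ball (complex_of_real r) e'" by (auto simp: \<delta>_def)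
      then show "card {j. j < N \<and> \<rho> j y = p} = card {j. j < N' \<and> \<rho>' j y = p}"
        using elim(1,2) by metis
    qed (use elim(3,4) in \<open>auto simp: dist_commute\<close>)
    show ?case using eq [of "\<lambda>p. 0 < Im p"] eq [of "\<lambda>p. Im p < 0"] elim(5,6) by simp
  qed
  then show "Np = Np'" "Nm = Nm'" by simp_all
qed

theorem theorem1p35:
  fixes F :: "('h::{chilbert_space,second_countable_topology}
                \<times> 'k::{chilbert_space,second_countable_topology}) set"
    and J :: "'k \<Rightarrow>\<^sub>L 'k"
    and H0 V :: "('h \<times> 'h) set"
    and D :: "'h set"
    and lam s r_lam :: real
  assumes "resonance_setting F J H0 V D"
    and "s \<notin> resonance_points F H0 V lam"
    and "r_lam \<in> resonance_points F H0 V lam"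
  shows "\<bar>res_index F J H0 V lam r_lam\<bar> \<le> int (complex_vector.dim (Upsilon1 F J H0 V lam s r_lam))"
proof -
  interpret RS: resonance_setting F J H0 V D by (rule assms(1))
  have rs: "r_lam \<noteq> s" using assms(2,3) by blast
  have "complex_of_real (inverse (s - r_lam)) \<noteq> 0" using rs by simp
  then obtain n P S E where rd:
    "riesz_decomposition (A_op_plus F J H0 V lam s) (complex_of_real (inverse (s - r_lam))) n P S E"
    by (rule riesz_decomposition_exists [OF RS.A_plus_compact [OF assms(2)] RS.A_plus_lin [OF assms(2)]]) (rule that)
  interpret RP: resonance_point F J H0 V D lam s r_lam n P S E
    by (intro resonance_point.intro resonance_point_axioms.intro assms(1,2) rs rd)
  obtain Eb where Eb: "RP.form.orthogonal_system Eb" "cspan Eb = riesz_space P"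
    by (rule RP.form.orthogonal_basis [OF RP.R.subspace_riesz_space RP.R.E_finite RP.R.riesz_space_in_span RP.nondegenerate])
  let ?p = "card (RP.sign_set Eb 1)" and ?m = "card (RP.sign_set Eb (- 1))"
  have "res_index F J H0 V lam r_lam = int ?p - int ?m"
    unfolding res_index_def
  proof (rule the_equality)
    show "\<exists>N \<rho> Np Nm. pole_splits F J H0 V lam r_lam N \<rho> Np Nm \<and> int ?p - int ?m = int Np - int Nm"
      using RP.pole_splits_exists [OF Eb] by blast
    fix k assume "\<exists>N \<rho> Np Nm. pole_splits F J H0 V lam r_lam N \<rho> Np Nm \<and> k = int Np - int Nm"
    then obtain N \<rho> Np Nm where "pole_splits F J H0 V lam r_lam N \<rho> Np Nm" "k = int Np - int Nm" by blast
    then show "k = int ?p - int ?m"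
      using RP.pole_splits_exists [OF Eb] pole_splits_unique by metis
  qed
  then show ?thesis using RP.signature_bound [OF Eb] by simp
qed

end
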